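(* Let $n=2$ or $n=3$, let $\mathcal M=\mathbb H^n$ be hyperbolic space, let $R_0>0$, $\mathbf p\in\mathbb H^n$, $N\ge 2$, and let $\mu$ be the probability measure on $(\mathbb H^n)^N$ with density $$\frac{1}{\mathrm{Vol}_{\mathbb H^n}(B_{R_0}(\mathbf p))^N}\,1_{B_{R_0}(\mathbf p)\times\cdots\times B_{R_0}(\mathbf p)}(\mathbf X)$$ with respect to the Riemannian volume measure, where $B_{R_0}(\mathbf p)$ is the geodesic ball of radius $R_0$ about $\mathbf p$. Let $\rho$, $w$ and $A$ be as defined in the context. Let $\mathcal H$ be a compact subspace of $L^2([0,2R_0];\rho;\mathbb R)$ (i.e. a linear subspace whose unit ball is compact with respect to the $L^2(\rho)$ norm) that is contained in $$\{\varphi\in C([0,2R_0];\mathbb R):\ \operatorname{supp}\varphi\subset[0,R_0),\ \varphi\text{ has only a finite number of zeros in }\operatorname{supp}\varphi\}.$$ Then $$\inf_{\varphi\in\mathcal H,\ \varphi\neq0}\frac{\|A\varphi\|_{L^2(\mu)}^2}{\|\varphi\|_{L^2(\rho)}^2}\ \ge\ \frac{N-1}{N^2}+c_{\mathcal H,\mathcal M}\,\frac{(N-1)(N-2)}{N^2},$$ where $$c_{\mathcal H,\mathcal M}:=\inf_{\varphi\in\mathcal H,\ \|\varphi\|_{L^2(\rho)}=1}\mathbb E\Bigl[\varphi(d(\mathbf x,\mathbf y))\,\varphi(d(\mathbf x,\mathbf z))\,g\bigl(w(\mathbf x,\mathbf y),w(\mathbf x,\mathbf z)\bigr)\Bigr]>0,$$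 with $\mathbf x,\mathbf y,\mathbf z$ i.i.d. uniformly distributed on $B_{R_0}(\mathbf p)$ (with respect to Riemannian volume).
   Context: $\mathbb H^n=\{(x_1,\dots,x_n)\in\mathbb R^n:x_n>0\}$ with metric $g=x_n^{-2}g_{\mathrm{Euclid}}$, and $d$ is its Riemannian distance; all cut loci are empty. The influence vector is $w(\mathbf x,\mathbf y)=\exp_{\mathbf x}^{-1}(\mathbf y)\in T_{\mathbf x}\mathbb H^n$ (so $w(\mathbf x,\mathbf x)=0$ and $\|w(\mathbf x,\mathbf y)\|=d(\mathbf x,\mathbf y)$). With $\mathcal M=\mathbb H^n$, the tangent space $T_{\mathbf X}\mathcal M^N=T_{\mathbf x_1}\mathcal M\times\cdots\times T_{\mathbf x_N}\mathcal M$ of the product manifold carries the weighted inner product $\langle (\mathbf u_i)_i,(\mathbf v_i)_i\rangle=\frac1N\sum_{i=1}^N g(\mathbf u_i,\mathbf v_i)$, and for a measurable vector field $F$ on $\mathcal M^N$, $\|F\|_{L^2(\mu)}^2=\int_{\mathcal M^N}\|F(\mathbf X)\|^2_{T_{\mathbf X}\mathcal M^N}\,d\mu(\mathbf X)$. For $\varphi:[0,2R_0]\to\mathbb R$, extended by $0$ to $\mathbb R^+=[0,\infty)$, $\mathbf f_\varphi$ is the vector field on $\mathcal M^N$ whose $i$-th component at $\mathbf X=(\mathbf x_1,\dots,\mathbf x_N)$ is $\frac1N\sum_{j=1}^N\varphi(d(\mathbf x_i,\mathbf x_j))\,w(\mathbf x_i,\mathbf x_j)$, and $A\varphi:=\mathbf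 f_\varphi$. With $P_{ij}(\mathbf X)=d(\mathbf x_i,\mathbf x_j)$, the measure $\rho$ on Borel sets $B\subset\mathbb R^+$ is $\rho(B)=\frac{1}{N(N-1)}\sum_{i\ne j}\int_{P_{ij}^{-1}(B)}P_{ij}^2(\mathbf X)\,d\mu(\mathbf X)$ (sum over ordered pairs of distinct indices). $L^2([0,2R_0];\rho;\mathbb R)$ uses the restriction of $\rho$ to $[0,2R_0]$, with norm $\|\cdot\|_{L^2(\rho)}$. The support $\operatorname{supp}\varphi$ is the closure of $\{\varphi\ne0\}$. *)

theory Defs
  imports "HOL-Analysis.Analysis" "HOL-Probability.Probability"
begin

section \<open>Hyperbolic space in the upper half-space model\<close>

text \<open>
  The coordinates \<open>x\<^sub>1, \<dots>, x\<^sub>n\<close> are indexed by a finite linearly ordered type \<open>'n\<close>,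
  so that the last coordinate is the one with index \<open>Max UNIV\<close>. Tangent vectors are also
  elements of \<open>'n point\<close>.
\<close>

type_synonym 'n point = "(real, 'n) vec"

definition height :: "'n::{finite,linorder} point \<Rightarrow> real" where
  "height x = x $ Max UNIV"

definition hyp_space :: "('n::{finite,linorder} point) set" where
  "hyp_space = {x. height x > 0}"

definition hyp_metric ::
    "'n::{finite,linorder} point \<Rightarrow> 'n point \<Rightarrow> 'n point \<Rightarrow> real" where
  "hyp_metric x u v = (u \<bullet> v) / (height x)\<^sup>2"

definition hyp_metric_matrix :: "'n::{finite,linorder} point \<Rightarrow> ('n point, 'n) vec" where
  "hyp_metric_matrix x = (\<chi> i j. hyp_metric x (axis i 1) (axis j 1))"

definition hyp_volume :: "('n::{finite,linorder} point) measure" where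
  "hyp_volume = density (restrict_space lborel hyp_space)
     (\<lambda>x. ennreal (sqrt (det (hyp_metric_matrix x))))"

text \<open>
  The length is a Lebesgue integral with values in \<open>[0, \<infinity>]\<close>: the library's piecewise
  \<open>C\<^sup>1\<close> paths may have an unbounded derivative near the exceptional points, and such a path
  of infinite length must not be assigned length 0.
\<close>

definition hyp_length :: "(real \<Rightarrow> 'n::{finite,linorder} point) \<Rightarrow> ennreal" where
  "hyp_length \<gamma> = (\<integral>\<^sup>+ t \<in> {0..1}.
     ennreal (sqrt (hyp_metric (\<gamma> t) (vector_derivative \<gamma> (at t)) (vector_derivative \<gamma> (at t))))
     \<partial>lborel)"

definition hyp_dist :: "'n::{finite,linorder} point \<Rightarrow> 'n point \<Rightarrow> real" where
  "hyp_dist x y = enn2real (INF \<gamma> \<in> {\<gamma>. \<gamma> piecewise_C1_differentiable_on {0..1} \<and>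
     \<gamma> ` {0..1} \<subseteq> hyp_space \<and> \<gamma> 0 = x \<and> \<gamma> 1 = y}. hyp_length \<gamma>)"

definition hyp_ball :: "'n::{finite,linorder} point \<Rightarrow> real \<Rightarrow> ('n point) set" where
  "hyp_ball p r = {x \<in> hyp_space. hyp_dist p x < r}"

text \<open>\<open>metric_partial l i j x\<close> is \<open>\<partial>\<^sub>l g\<^sub>i\<^sub>j\<close> at \<open>x\<close>, and \<open>christoffel k i j x\<close> is the
  symbol of the Levi-Civita connection with upper index \<open>k\<close>.\<close>

definition metric_partial :: "'n::{finite,linorder} \<Rightarrow> 'n \<Rightarrow> 'n \<Rightarrow> 'n point \<Rightarrow> real" where
  "metric_partial l i j x = deriv (\<lambda>s. hyp_metric_matrix (x + s *\<^sub>R axis l 1) $ i $ j) 0"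

definition christoffel :: "'n::{finite,linorder} \<Rightarrow> 'n \<Rightarrow> 'n \<Rightarrow> 'n point \<Rightarrow> real" where
  "christoffel k i j x = (1 / 2) * (\<Sum>l\<in>UNIV. matrix_inv (hyp_metric_matrix x) $ k $ l *
     (metric_partial i j l x + metric_partial j i l x - metric_partial l i j x))"

text \<open>\<open>hyp_geodesic \<gamma> \<gamma>'\<close>: \<open>\<gamma>\<close> is a geodesic in \<open>hyp_space\<close> with velocity \<open>\<gamma>'\<close>.\<close>

definition hyp_geodesic ::
    "(real \<Rightarrow> 'n::{finite,linorder} point) \<Rightarrow> (real \<Rightarrow> 'n point) \<Rightarrow> bool" where
  "hyp_geodesic \<gamma> \<gamma>' \<longleftrightarrow> (\<forall>t\<in>{0..1}. \<gamma> t \<in> hyp_space \<and>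
     (\<gamma> has_vector_derivative \<gamma>' t) (at t within {0..1}) \<and>
     (\<gamma>' has_vector_derivative
        (\<chi> k. - (\<Sum>i\<in>UNIV. \<Sum>j\<in>UNIV. christoffel k i j (\<gamma> t) * \<gamma>' t $ i * \<gamma>' t $ j)))
       (at t within {0..1}))"

definition hyp_exp :: "'n::{finite,linorder} point \<Rightarrow> 'n point \<Rightarrow> 'n point" where
  "hyp_exp x v = (THE y. \<exists>\<gamma> \<gamma>'. hyp_geodesic \<gamma> \<gamma>' \<and> \<gamma> 0 = x \<and> \<gamma>' 0 = v \<and> \<gamma> 1 = y)"

definition influence :: "'n::{finite,linorder} point \<Rightarrow> 'n point \<Rightarrow> 'n point" where
  "influence x y = inv (hyp_exp x) y"


section \<open>The measures and the operator\<close>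

text \<open>
  Agents are indexed by \<open>{1..N}\<close>; a configuration is an element of the space of the product
  measure, that is, an extensional function on \<open>{1..N}\<close> with values in \<open>hyp_space\<close>.
\<close>

definition config_measure ::
    "'n::{finite,linorder} point \<Rightarrow> real \<Rightarrow> nat \<Rightarrow> (nat \<Rightarrow> 'n point) measure" where
  "config_measure p R0 N = density (PiM {1..N} (\<lambda>_. hyp_volume))
     (\<lambda>X. indicator (PiE {1..N} (\<lambda>_. hyp_ball p R0)) X / emeasure hyp_volume (hyp_ball p R0) ^ N)"

definition rho_measure :: "'n::{finite,linorder} point \<Rightarrow> real \<Rightarrow> nat \<Rightarrow> real measure" where
  "rho_measure p R0 N = measure_of {0..} (sets (restrict_space borel {0..}))
     (\<lambda>B. ennreal (1 / (real N * (real N - 1))) *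
        (\<Sum>(i, j) \<in> {(i, j). i \<in> {1..N} \<and> j \<in> {1..N} \<and> i \<noteq> j}.
           \<integral>\<^sup>+ X \<in> (\<lambda>X. hyp_dist (X i) (X j)) -` B. ennreal ((hyp_dist (X i) (X j))\<^sup>2)
             \<partial>config_measure p R0 N))"

text \<open>
  A function on \<open>[0, 2R\<^sub>0]\<close> is represented by its extension by 0 to all of \<open>real\<close>.
\<close>

definition L2_norm :: "real \<Rightarrow> real measure \<Rightarrow> (real \<Rightarrow> real) \<Rightarrow> real" where
  "L2_norm R0 \<rho> \<phi> = sqrt (\<integral>r. (\<phi> r)\<^sup>2 \<partial>restrict_space \<rho> {0..2 * R0})"

definition L2_functions :: "real \<Rightarrow> real measure \<Rightarrow> (real \<Rightarrow> real) set" where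
  "L2_functions R0 \<rho> = {\<phi>. (\<forall>r. r \<notin> {0..2 * R0} \<longrightarrow> \<phi> r = 0) \<and>
     \<phi> \<in> borel_measurable (restrict_space \<rho> {0..2 * R0}) \<and>
     integrable (restrict_space \<rho> {0..2 * R0}) (\<lambda>r. (\<phi> r)\<^sup>2)}"

text \<open>
  Elements of \<open>L\<^sup>2\<close> are treated as functions, not as classes. For sets of functions that are
  continuous on \<open>[0, 2R\<^sub>0]\<close>, the only ones considered below, this makes no difference, since
  the topological support of the measure is the whole interval and so the \<open>L\<^sup>2\<close> distance is
  a metric on such a set.
\<close>

definition compact_subspace_L2 :: "real \<Rightarrow> real measure \<Rightarrow> (real \<Rightarrow> real) set \<Rightarrow> bool" where
  "compact_subspace_L2 R0 \<rho> H \<longleftrightarrow>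
     H \<subseteq> L2_functions R0 \<rho> \<and>
     (\<lambda>_. 0) \<in> H \<and>
     (\<forall>\<phi>\<in>H. \<forall>\<psi>\<in>H. (\<lambda>r. \<phi> r + \<psi> r) \<in> H) \<and>
     (\<forall>a. \<forall>\<phi>\<in>H. (\<lambda>r. a * \<phi> r) \<in> H) \<and>
     compactin (Metric_space.mtopology H (\<lambda>\<phi> \<psi>. L2_norm R0 \<rho> (\<lambda>r. \<phi> r - \<psi> r)))
       {\<phi> \<in> H. L2_norm R0 \<rho> \<phi> \<le> 1}"

definition admissible_functions :: "real \<Rightarrow> (real \<Rightarrow> real) set" where
  "admissible_functions R0 = {\<phi>. (\<forall>r. r \<notin> {0..2 * R0} \<longrightarrow> \<phi> r = 0) \<and>
     continuous_on {0..2 * R0} \<phi> \<and>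
     closure {r. \<phi> r \<noteq> 0} \<subseteq> {0..<R0} \<and>
     finite {r \<in> closure {r. \<phi> r \<noteq> 0}. \<phi> r = 0}}"

definition interaction_field ::
    "nat \<Rightarrow> (real \<Rightarrow> real) \<Rightarrow> (nat \<Rightarrow> 'n::{finite,linorder} point) \<Rightarrow> nat \<Rightarrow> 'n point" where
  "interaction_field N \<phi> X i =
     (1 / real N) *\<^sub>R (\<Sum>j\<in>{1..N}. \<phi> (hyp_dist (X i) (X j)) *\<^sub>R influence (X i) (X j))"

definition prod_inner :: "nat \<Rightarrow> (nat \<Rightarrow> 'n::{finite,linorder} point) \<Rightarrow>
    (nat \<Rightarrow> 'n point) \<Rightarrow> (nat \<Rightarrow> 'n point) \<Rightarrow> real" where
  "prod_inner N X U V = (1 / real N) * (\<Sum>i\<in>{1..N}. hyp_metric (X i) (U i) (V i))"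

definition field_L2_norm :: "nat \<Rightarrow> (nat \<Rightarrow> 'n::{finite,linorder} point) measure \<Rightarrow>
    ((nat \<Rightarrow> 'n point) \<Rightarrow> nat \<Rightarrow> 'n point) \<Rightarrow> real" where
  "field_L2_norm N \<mu> F = sqrt (\<integral>X. prod_inner N X (F X) (F X) \<partial>\<mu>)"

definition triple_expectation ::
    "'n::{finite,linorder} point \<Rightarrow> real \<Rightarrow> (real \<Rightarrow> real) \<Rightarrow> real" where
  "triple_expectation p R0 \<phi> =
     (let U = uniform_measure hyp_volume (hyp_ball p R0) in
      \<integral>(x, y, z). \<phi> (hyp_dist x y) * \<phi> (hyp_dist x z) *
        hyp_metric x (influence x y) (influence x z) \<partial>(U \<Otimes>\<^sub>M (U \<Otimes>\<^sub>M U)))"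

text \<open>The infimum is taken in \<open>ereal\<close>, so that it is \<open>\<infinity>\<close> if \<open>H\<close> is the zero subspace.\<close>

definition coercivity_const ::
    "'n::{finite,linorder} point \<Rightarrow> real \<Rightarrow> nat \<Rightarrow> (real \<Rightarrow> real) set \<Rightarrow> ereal" where
  "coercivity_const p R0 N H =
     (INF \<phi> \<in> {\<phi> \<in> H. L2_norm R0 (rho_measure p R0 N) \<phi> = 1}. ereal (triple_expectation p R0 \<phi>))"

end

theory Submission
  imports Defs
begin

text \<open>
  Let \<open>F(x, y) = \<phi>(d(x, y)) w(x, y) / x\<^sub>n\<close>, so that the hyperbolic norm becomes the Euclidean one. Expanding
  the square in \<open>\<parallel>A\<phi>\<parallel>\<^sup>2\<close> over index triples \<open>(i, j, k)\<close>, the diagonal \<open>j = k\<close> contributes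
  \<open>\<parallel>\<phi>\<parallel>\<^sup>2 = E |F(x, y)|\<^sup>2\<close> and distinct indices contribute \<open>T(\<phi>) = E |E\<^sub>y F(x, y)|\<^sup>2 \<ge> 0\<close>. Since
  \<open>T \<le> \<parallel>\<cdot>\<parallel>\<^sup>2\<close> is continuous, compactness reduces \<open>c > 0\<close> to \<open>T(\<phi>) > 0\<close> for a single \<open>\<phi> \<noteq> 0\<close>, that is, to a
  point \<open>x\<close> with \<open>E\<^sub>y F(x, y) \<noteq> 0\<close>. Take \<open>x\<close> so close to the boundary of the ball that only the outermost
  part of the support of \<open>\<phi>\<close>, where \<open>\<phi>\<close> has constant sign, sticks out; then reflecting in a totally
  geodesic hyperplane through \<open>x\<close> leaves an integral of constant sign.

  The distance and the exponential map are computed explicitly: along a geodesic \<open>1 / x\<^sub>n\<close> solves a linear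
  second-order equation, and \<open>cosh d\<close> has gradient norm \<open>sinh d\<close>, which bounds lengths of paths from below.
\<close>

section \<open>Geodesics and the exponential map\<close>

abbreviation last_idx :: "'n::{finite,linorder}" ("\<ll>") where "\<ll> \<equiv> Max UNIV"

lemma has_vector_derivative_vec_iff:
  fixes f :: "real \<Rightarrow> (real, 'n::finite) vec"
  shows "(f has_vector_derivative f') (at t within A) \<longleftrightarrow>
    (\<forall>i. ((\<lambda>t. f t $ i) has_real_derivative f' $ i) (at t within A))"
proof -
  have "(f has_vector_derivative f') (at t within A) \<longleftrightarrow>
     (\<forall>i\<in>Basis. ((\<lambda>x. f x \<bullet> i) has_derivative (\<lambda>x. (x *\<^sub>R f') \<bullet> i)) (at t within A))"
    unfolding has_vector_derivative_def by (rule has_derivative_componentwise_within)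
  also have "\<dots> \<longleftrightarrow> (\<forall>i. ((\<lambda>t. f t $ i) has_real_derivative f' $ i) (at t within A))"
    by (simp add: Basis_vec_def inner_axis has_field_derivative_def mult_commute_abs)
  finally show ?thesis .
qed

lemma hyp_metric_matrix_eq: "hyp_metric_matrix x = (1 / (height x)\<^sup>2) *\<^sub>R mat 1"
  by (auto simp: hyp_metric_matrix_def hyp_metric_def vec_eq_iff mat_def inner_axis_axis)

lemma matrix_inv_scaleR_mat:
  assumes "c \<noteq> 0" shows "matrix_inv (c *\<^sub>R mat 1 :: ((real, 'n::finite) vec, 'n) vec) = (1 / c) *\<^sub>R mat 1"
proof -
  let ?A = "c *\<^sub>R mat 1 :: ((real, 'n) vec, 'n) vec" and ?B = "(1 / c) *\<^sub>R mat 1 :: ((real, 'n) vec, 'n) vec"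
  have AB: "?A ** ?B = mat 1" "?B ** ?A = mat 1"
    using assms by (simp_all add: scalar_matrix_assoc[symmetric] matrix_scalar_ac)
  then have "invertible ?A" unfolding invertible_def by blast
  then have "matrix_inv ?A ** ?A = mat 1" unfolding invertible_def matrix_inv_def by (rule someI2_ex) auto
  then have "matrix_inv ?A ** (?A ** ?B) = ?B" by (simp add: matrix_mul_assoc)
  then show ?thesis by (simp add: AB)
qed

lemma metric_partial_eq:
  assumes "height x > 0"
  shows "metric_partial l i j x = - 2 / (height x) ^ 3 * (if l = \<ll> \<and> i = j then 1 else 0)"
proof -
  have 1: "hyp_metric_matrix (x + s *\<^sub>R axis l 1) $ i $ j =
      (if i = j then 1 / (height x + (if l = \<ll> then s else 0))\<^sup>2 else 0)" for s
    by (simp add: hyp_metric_matrix_eq mat_def height_def axis_def)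
  have "((\<lambda>s. 1 / (height x + s)\<^sup>2) has_real_derivative - 2 / (height x) ^ 3) (at 0)"
    using assms by (auto intro!: derivative_eq_intros simp: field_simps power2_eq_square power3_eq_cube)
  then show ?thesis unfolding metric_partial_def 1
    by (cases "l = \<ll>"; cases "i = j") (auto intro: DERIV_imp_deriv)
qed

lemma sum_delta_mult:
  fixes f :: "'n::finite \<Rightarrow> real"
  shows "(\<Sum>l\<in>UNIV. (if k = l then 1 else 0) * f l) = f k"
proof -
  have "(\<Sum>l\<in>UNIV. (if k = l then 1 else 0) * f l) = (\<Sum>l\<in>UNIV. if k = l then f l else 0)"
    by (rule sum.cong) auto
  then show ?thesis by simp
qed

lemma christoffel_eq:
  assumes "height x > 0"
  shows "christoffel k i j x = - ((if i = \<ll> \<and> j = k then 1 else 0) + (if j = \<ll> \<and> i = k then 1 else 0)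
     - (if k = \<ll> \<and> i = j then 1 else 0)) / height x"
proof -
  have 1: "matrix_inv (hyp_metric_matrix x) = ((height x)\<^sup>2) *\<^sub>R mat 1"
    unfolding hyp_metric_matrix_eq using assms by (subst matrix_inv_scaleR_mat) auto
  have arith: "(1 / 2) * (h\<^sup>2 * (- 2 / h ^ 3 * a + - 2 / h ^ 3 * b - - 2 / h ^ 3 * c)) = - (a + b - c) / h"
    if "h > 0" for a b c h :: real
    using that by (simp add: field_simps power2_eq_square power3_eq_cube)
  have "christoffel k i j x = (1 / 2) * (\<Sum>l\<in>UNIV. (height x)\<^sup>2 * ((if k = l then 1 else 0) *
     (metric_partial i j l x + metric_partial j i l x - metric_partial l i j x)))"
    unfolding christoffel_def 1 by (simp add: mat_def mult.assoc)
  also have "\<dots> = (1 / 2) * ((height x)\<^sup>2 *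
     (metric_partial i j k x + metric_partial j i k x - metric_partial k i j x))"
    by (simp only: sum_distrib_left[symmetric] sum_delta_mult)
  finally have "christoffel k i j x = (1 / 2) * ((height x)\<^sup>2 *
     (metric_partial i j k x + metric_partial j i k x - metric_partial k i j x))" .
  then show ?thesis unfolding metric_partial_eq[OF assms] arith[OF assms] .
qed

lemma geodesic_acceleration:
  assumes "height x > 0"
  shows "- (\<Sum>i\<in>UNIV. \<Sum>j\<in>UNIV. christoffel k i j x * v $ i * v $ j) =
    (2 * v $ \<ll> * v $ k - (if k = \<ll> then v \<bullet> v else 0)) / height x"
proof -
  have "christoffel k i j x * v $ i * v $ j =
     ((if k = \<ll> then if i = j then v $ i * v $ j else 0 else 0) - (if i = \<ll> then if j = k then v $ i * v $ j else 0 else 0)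
       - (if j = \<ll> then if i = k then v $ i * v $ j else 0 else 0)) / height x" for i j
    by (auto simp: christoffel_eq[OF assms] field_simps)
  then have "(\<Sum>i\<in>UNIV. \<Sum>j\<in>UNIV. christoffel k i j x * v $ i * v $ j) =
     ((if k = \<ll> then \<Sum>i\<in>UNIV. v $ i * v $ i else 0) - v $ \<ll> * v $ k - v $ k * v $ \<ll>) / height x"
  proof -
    have 1: "(\<Sum>i\<in>UNIV. \<Sum>j\<in>UNIV. if k = \<ll> then if i = j then v $ i * v $ j else 0 else 0) =
      (if k = \<ll> then \<Sum>i\<in>UNIV. v $ i * v $ i else 0)" by simp
    have 2: "(\<Sum>i\<in>UNIV. \<Sum>j\<in>UNIV. if i = \<ll> then if j = k then v $ i * v $ j else 0 else 0) = v $ \<ll> * v $ k"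
    proof -
      have "(\<Sum>j\<in>UNIV. if i = \<ll> then if j = k then v $ i * v $ j else 0 else 0) = (if i = \<ll> then v $ i * v $ k else 0)" for i
        by simp
      then show ?thesis by simp
    qed
    have 3: "(\<Sum>i\<in>UNIV. \<Sum>j\<in>UNIV. if j = \<ll> then if i = k then v $ i * v $ j else 0 else 0) = v $ k * v $ \<ll>"
      by simp
    show ?thesis using 1 2 3
      by (simp only: \<open>\<And>i j. christoffel k i j x * v $ i * v $ j = _ i j\<close> sum_divide_distrib[symmetric] sum_subtractf)
  qed
  then show ?thesis by (simp add: inner_vec_def minus_divide_left)
qed

definition sinhc :: "real \<Rightarrow> real \<Rightarrow> real" where
  "sinhc s t = (if s = 0 then t else sinh (s * t) / s)"

lemma sinhc_0[simp]: "sinhc s 0 = 0" by (simp add: sinhc_def)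
lemma mult_sinhc: "s * sinhc s t = sinh (s * t)" by (simp add: sinhc_def)
lemma sinhc_pos: "s \<ge> 0 \<Longrightarrow> t > 0 \<Longrightarrow> sinhc s t > 0" by (simp add: sinhc_def)
lemma sinhc_deriv[derivative_intros]:
  "(f has_real_derivative f') (at t within A) \<Longrightarrow> ((\<lambda>t. sinhc s (f t)) has_real_derivative cosh (s * f t) * f') (at t within A)"
  unfolding sinhc_def by (cases "s = 0") (auto intro!: derivative_eq_intros)

lemma cosh_sinhc: "(cosh (s * t))\<^sup>2 - s\<^sup>2 * (sinhc s t)\<^sup>2 = 1"
  using hyperbolic_pythagoras[of "s*t"] by (metis mult_sinhc power_mult_distrib)


definition geod_u :: "'n::{finite,linorder} point \<Rightarrow> 'n point \<Rightarrow> real \<Rightarrow> real" where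
  "geod_u x v t = cosh (norm v / height x * t) / height x - height v / (height x)\<^sup>2 * sinhc (norm v / height x) t"

definition geod_u' :: "'n::{finite,linorder} point \<Rightarrow> 'n point \<Rightarrow> real \<Rightarrow> real" where
  "geod_u' x v t = (norm v / height x)\<^sup>2 * sinhc (norm v / height x) t / height x - height v / (height x)\<^sup>2 * cosh (norm v / height x * t)"

definition geod :: "'n::{finite,linorder} point \<Rightarrow> 'n point \<Rightarrow> real \<Rightarrow> 'n point" where
  "geod x v t = (\<chi> i. if i = \<ll> then 1 / geod_u x v t
     else x $ i + v $ i / height x * sinhc (norm v / height x) t / geod_u x v t)"

definition geod' :: "'n::{finite,linorder} point \<Rightarrow> 'n point \<Rightarrow> real \<Rightarrow> 'n point" where
  "geod' x v t = (\<chi> i. if i = \<ll> then - geod_u' x v t / (geod_u x v t)\<^sup>2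
     else v $ i / (height x * geod_u x v t)\<^sup>2)"

lemma abs_height_le_norm: "\<bar>height v\<bar> \<le> norm v"
  unfolding height_def by (rule component_le_norm_cart)

lemma abs_sinh_real_less_cosh: "\<bar>sinh x\<bar> < cosh x" for x :: real
  using sinh_less_cosh_real[of x] sinh_less_cosh_real[of "-x"] by (simp add: abs_if)

lemma geod_u_pos:
  assumes "height x > 0" shows "geod_u x v t > 0"
proof -
  let ?s = "norm v / height x"
  have "\<bar>height v * sinhc ?s t\<bar> \<le> norm v * \<bar>sinhc ?s t\<bar>"
    using abs_height_le_norm[of v] by (simp add: abs_mult mult_right_mono)
  also have "\<dots> = height x * \<bar>?s * sinhc ?s t\<bar>" using assms by (simp add: abs_mult)
  also have "\<dots> = height x * \<bar>sinh (?s * t)\<bar>" by (simp only: mult_sinhc)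
  also have "\<dots> < height x * cosh (?s * t)"
    using assms abs_sinh_real_less_cosh by simp
  finally have "height v * sinhc ?s t < height x * cosh (?s * t)" by linarith
  then show ?thesis using assms unfolding geod_u_def by (simp add: field_simps power2_eq_square)
qed

lemma geod_u_deriv:
  "(geod_u x v has_real_derivative geod_u' x v t) (at t within A)"
proof -
  have "((\<lambda>t. cosh (s * t) / h - K * sinhc s t) has_real_derivative s * sinh (s * t) / h - K * cosh (s * t))
      (at t within A)" for s h K :: real
    by (cases "h = 0") (auto intro!: derivative_eq_intros)
  then show ?thesis
    unfolding geod_u_def[abs_def] geod_u'_def mult_sinhc[symmetric] power2_eq_square mult.assoc .
qed

lemma geod_u'_deriv:
  "(geod_u' x v has_real_derivative (norm v / height x)\<^sup>2 * geod_u x v t) (at t within A)"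
proof -
  have "((\<lambda>t. s\<^sup>2 * sinhc s t / h - K * cosh (s * t)) has_real_derivative s\<^sup>2 * (cosh (s * t) / h - K * sinhc s t))
      (at t within A)" for s h K :: real
  proof -
    have "((\<lambda>t. s\<^sup>2 * sinhc s t / h - K * cosh (s * t)) has_real_derivative s\<^sup>2 * cosh (s * t) / h - K * (sinh (s * t) * s))
      (at t within A)"
      by (cases "h = 0") (auto intro!: derivative_eq_intros)
    then show ?thesis unfolding mult_sinhc[symmetric] by (simp add: power2_eq_square algebra_simps)
  qed
  then show ?thesis unfolding geod_u_def geod_u'_def[abs_def] .
qed

lemma geod_u_energy:
  assumes "height x > 0"
  shows "(norm v / height x)\<^sup>2 * (geod_u x v t)\<^sup>2 - (geod_u' x v t)\<^sup>2 = ((norm v)\<^sup>2 - (height v)\<^sup>2) / (height x) ^ 4"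
proof -
  define s C S where "s = norm v / height x" and "C = cosh (s * t)" and "S = sinhc s t"
  have 1: "C\<^sup>2 = 1 + s\<^sup>2 * S\<^sup>2" using cosh_sinhc[of s t] unfolding C_def S_def by simp
  have 2: "norm v = s * height x" using assms by (simp add: s_def)
  define h where "h = height x"
  have "s\<^sup>2 * (C / h - height v / h\<^sup>2 * S)\<^sup>2 - (s\<^sup>2 * S / h - height v / h\<^sup>2 * C)\<^sup>2 =
     (s\<^sup>2 / h\<^sup>2 - (height v)\<^sup>2 / h^4) * (C\<^sup>2 - s\<^sup>2 * S\<^sup>2)"
    using assms unfolding h_def[symmetric] by (simp add: field_simps power2_eq_square power4_eq_xxxx)
  also have "\<dots> = ((norm v)\<^sup>2 - (height v)\<^sup>2) / h ^ 4"
    using assms unfolding 1 2 h_def[symmetric] by (simp add: field_simps power2_eq_square power4_eq_xxxx)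
  finally show ?thesis by (simp add: geod_u_def geod_u'_def s_def C_def S_def h_def)
qed

lemma height_geod: "height (geod x v t) = 1 / geod_u x v t" by (simp add: geod_def height_def)

lemma sum_split_last:
  fixes f :: "'n::{finite,linorder} \<Rightarrow> real"
  shows "(\<Sum>i\<in>UNIV. f i) = f \<ll> + (\<Sum>i\<in>UNIV - {\<ll>}. f i)"
  by (simp add: sum.remove)

lemma norm_split_last: "(norm v)\<^sup>2 = (height v)\<^sup>2 + (\<Sum>i\<in>UNIV - {\<ll>}. (v $ i)\<^sup>2)"
  for v :: "'n::{finite,linorder} point"
  unfolding power2_norm_eq_inner inner_vec_def height_def by (subst sum_split_last) (simp add: power2_eq_square)

lemma geod'_speed:
  assumes "height x > 0"
  shows "geod' x v t \<bullet> geod' x v t = (norm v / height x)\<^sup>2 / (geod_u x v t)\<^sup>2"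
proof -
  let ?u = "geod_u x v t" and ?h = "height x"
  have u: "?u > 0" by (rule geod_u_pos[OF assms])
  have "geod' x v t \<bullet> geod' x v t = (geod_u' x v t / ?u\<^sup>2)\<^sup>2 + (\<Sum>i\<in>UNIV - {\<ll>}. (v $ i)\<^sup>2) / (?h * ?u) ^ 4"
    unfolding power2_norm_eq_inner[symmetric] norm_split_last[of "geod' _ _ _"]
    by (simp add: geod'_def height_def power_divide sum_divide_distrib flip: power_mult)
  also have "(\<Sum>i\<in>UNIV - {\<ll>}. (v $ i)\<^sup>2) = (norm v)\<^sup>2 - (height v)\<^sup>2"
    using norm_split_last[of v] by simp
  also have "(geod_u' x v t / ?u\<^sup>2)\<^sup>2 + ((norm v)\<^sup>2 - (height v)\<^sup>2) / (?h * ?u) ^ 4 =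
     ((geod_u' x v t)\<^sup>2 + ((norm v)\<^sup>2 - (height v)\<^sup>2) / ?h ^ 4) / ?u ^ 4"
    using u assms by (simp add: field_simps)
  also have "\<dots> = (norm v / ?h)\<^sup>2 * ?u\<^sup>2 / ?u ^ 4"
    using geod_u_energy[OF assms, of v t] by simp
  also have "\<dots> = (norm v / ?h)\<^sup>2 / ?u\<^sup>2" using u by (simp add: power4_eq_xxxx power2_eq_square)
  finally show ?thesis .
qed

lemma geod_has_vector_derivative:
  assumes "height x > 0"
  shows "(geod x v has_vector_derivative geod' x v t) (at t within A)"
  unfolding has_vector_derivative_vec_iff
proof
  fix i
  let ?u = "geod_u x v" and ?h = "height x" and ?s = "norm v / height x"
  have u: "?u t > 0" by (rule geod_u_pos[OF assms])
  have C: "(cosh (?s * t))\<^sup>2 = 1 + ?s\<^sup>2 * (sinhc ?s t)\<^sup>2" using cosh_sinhc[of ?s t] by simp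
  show "((\<lambda>t. geod x v t $ i) has_real_derivative geod' x v t $ i) (at t within A)"
  proof (cases "i = \<ll>")
    case True
    then show ?thesis using u geod_u_deriv[of x v t A]
      by (auto simp: geod_def geod'_def power2_eq_square intro!: derivative_eq_intros)
  next
    case False
    have 1: "cosh (?s * t) * ?u t - sinhc ?s t * geod_u' x v t = 1 / ?h"
    proof -
      have "cosh (?s * t) * ?u t - sinhc ?s t * geod_u' x v t = ((cosh (?s * t))\<^sup>2 - ?s\<^sup>2 * (sinhc ?s t)\<^sup>2) / ?h"
        unfolding geod_u_def geod_u'_def by (simp only: power2_eq_square) (simp add: algebra_simps diff_divide_distrib)
      then show ?thesis by (simp only: cosh_sinhc)
    qed
    have "((\<lambda>t. x $ i + v $ i / ?h * sinhc ?s t / ?u t) has_real_derivative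
       v $ i / ?h * ((cosh (?s * t) * ?u t - sinhc ?s t * geod_u' x v t) / (?u t)\<^sup>2)) (at t within A)"
      using u assms geod_u_deriv[of x v t A]
      by (auto intro!: derivative_eq_intros simp: field_simps power2_eq_square)
    moreover have "v $ i / ?h * (1 / ?h / (?u t)\<^sup>2) = geod' x v t $ i"
      using False by (simp add: geod'_def power2_eq_square ac_simps)
    moreover have "(\<lambda>t. geod x v t $ i) = (\<lambda>t. x $ i + v $ i / ?h * sinhc ?s t / ?u t)"
      using False by (simp add: geod_def)
    ultimately show ?thesis by (simp only: 1)
  qed
qed

lemma geod'_has_vector_derivative:
  assumes "height x > 0"
  shows "(geod' x v has_vector_derivative
     (\<chi> k. - (\<Sum>i\<in>UNIV. \<Sum>j\<in>UNIV. christoffel k i j (geod x v t) * geod' x v t $ i * geod' x v t $ j))) (at t within A)"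
  unfolding has_vector_derivative_vec_iff
proof
  fix i
  let ?u = "geod_u x v" and ?u' = "geod_u' x v" and ?h = "height x" and ?s = "norm v / height x"
  have u: "?u t > 0" by (rule geod_u_pos[OF assms])
  have h: "height (geod x v t) > 0" using u by (simp add: height_geod)
  note d = geod_u_deriv[of x v t A] geod_u'_deriv[of x v t A]
  show "((\<lambda>t. geod' x v t $ i) has_real_derivative
     (\<chi> k. - (\<Sum>i\<in>UNIV. \<Sum>j\<in>UNIV. christoffel k i j (geod x v t) * geod' x v t $ i * geod' x v t $ j)) $ i) (at t within A)"
  proof (cases "i = \<ll>")
    case True
    have "((\<lambda>t. - ?u' t / (?u t)\<^sup>2) has_real_derivative (2 * (?u' t / (?u t)\<^sup>2)\<^sup>2 - ?s\<^sup>2 / (?u t)\<^sup>2) * ?u t) (at t within A)"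
      using u by (auto intro!: derivative_eq_intros d simp: field_simps power2_eq_square power3_eq_cube)
    then show ?thesis using True
      by (simp add: geodesic_acceleration[OF h] geod'_speed[OF assms] height_geod) (simp add: geod'_def power2_eq_square mult.assoc)
  next
    case False
    have "((\<lambda>t. v $ i / (?h * ?u t)\<^sup>2) has_real_derivative 2 * (- ?u' t / (?u t)\<^sup>2) * (v $ i / (?h * ?u t)\<^sup>2) * ?u t) (at t within A)"
      using u assms by (auto intro!: derivative_eq_intros d simp: field_simps power2_eq_square)
    then show ?thesis using False
      by (simp add: geodesic_acceleration[OF h] geod'_speed[OF assms] height_geod) (simp add: geod'_def power2_eq_square)
  qed
qed

lemma geod_0: "geod x v 0 = x"
  by (auto simp: geod_def geod_u_def vec_eq_iff height_def)

lemma geod'_0: "height x > 0 \<Longrightarrow> geod' x v 0 = v"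
  by (auto simp: geod'_def geod_u_def geod_u'_def vec_eq_iff height_def power_divide)

lemma hyp_geodesic_geod:
  assumes "height x > 0"
  shows "hyp_geodesic (geod x v) (geod' x v)"
  unfolding hyp_geodesic_def
  using geod_has_vector_derivative[OF assms] geod'_has_vector_derivative[OF assms]
    geod_u_pos[OF assms] by (auto simp: hyp_space_def height_geod)



lemma DERIV_eq_0_imp_eq:
  fixes f :: "real \<Rightarrow> real"
  assumes "\<And>t. t \<in> {0..1} \<Longrightarrow> (f has_real_derivative 0) (at t within {0..1})" and "t \<in> {0..1}"
  shows "f t = f 0"
proof -
  obtain c where "\<forall>x\<in>{0..1}. f x = c"
    using has_field_derivative_zero_constant[of "{0..1}" f] assms(1) by auto
  then show ?thesis using assms(2) by auto
qed

text \<open>Factoring the operator as \<open>(d/dt + s)(d/dt - s)\<close> makes uniqueness a matter of integrating factors.\<close>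

lemma ode_cosh_unique:
  fixes D D' :: "real \<Rightarrow> real"
  assumes D: "\<And>t. t \<in> {0..1} \<Longrightarrow> (D has_real_derivative D' t) (at t within {0..1})"
    and D': "\<And>t. t \<in> {0..1} \<Longrightarrow> (D' has_real_derivative s\<^sup>2 * D t) (at t within {0..1})"
    and 0: "D 0 = 0" "D' 0 = 0" and t: "t \<in> {0..1}"
  shows "D t = 0"
proof -
  have 1: "D' t = s * D t" if "t \<in> {0..1}" for t
  proof -
    have "(\<lambda>t. (D' t - s * D t) * exp (s * t)) t = (\<lambda>t. (D' t - s * D t) * exp (s * t)) 0"
      using that by (intro DERIV_eq_0_imp_eq)
        (auto intro!: derivative_eq_intros D D' simp: algebra_simps power2_eq_square)
    then show ?thesis using 0 by simp
  qed
  have "(\<lambda>t. D t * exp (- s * t)) t = (\<lambda>t. D t * exp (- s * t)) 0"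
    using t by (intro DERIV_eq_0_imp_eq) (auto intro!: derivative_eq_intros D simp: 1)
  then show ?thesis using 0 by simp
qed

lemma hyp_geodesic_unique:
  assumes g: "hyp_geodesic \<gamma> \<gamma>'" and t: "t \<in> {0..1}"
  shows "\<gamma> t = geod (\<gamma> 0) (\<gamma>' 0) t"
proof -
  define x v where "x = \<gamma> 0" and "v = \<gamma>' 0"
  define a where "a = (\<lambda>t. height (\<gamma> t))"
  define E where "E = (\<lambda>t. (\<gamma>' t \<bullet> \<gamma>' t) / (a t)\<^sup>2)"
  have a: "a t > 0" if "t \<in> {0..1}" for t
    using g that unfolding hyp_geodesic_def a_def hyp_space_def by auto
  have hx: "height x > 0" using a[of 0] by (simp add: a_def x_def)
  have d1: "((\<lambda>t. \<gamma> t $ i) has_real_derivative \<gamma>' t $ i) (at t within {0..1})" if "t \<in> {0..1}" for t i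
    using g that unfolding hyp_geodesic_def has_vector_derivative_vec_iff by blast
  have d2: "((\<lambda>t. \<gamma>' t $ i) has_real_derivative
      (2 * \<gamma>' t $ \<ll> * \<gamma>' t $ i - (if i = \<ll> then \<gamma>' t \<bullet> \<gamma>' t else 0)) / a t) (at t within {0..1})" if "t \<in> {0..1}" for t i
  proof -
    have "((\<lambda>t. \<gamma>' t $ i) has_real_derivative
      (\<chi> k. - (\<Sum>i\<in>UNIV. \<Sum>j\<in>UNIV. christoffel k i j (\<gamma> t) * \<gamma>' t $ i * \<gamma>' t $ j)) $ i) (at t within {0..1})"
      using g that unfolding hyp_geodesic_def has_vector_derivative_vec_iff by blast
    then show ?thesis using geodesic_acceleration[of "\<gamma> t"] a[OF that] by (simp add: a_def)
  qed
  have da: "(a has_real_derivative \<gamma>' t $ \<ll>) (at t within {0..1})" if "t \<in> {0..1}" for t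
    using d1[OF that, of "\<ll>"] by (simp add: a_def height_def[abs_def])
  have dQ: "((\<lambda>t. \<gamma>' t \<bullet> \<gamma>' t) has_real_derivative 2 * \<gamma>' t $ \<ll> * (\<gamma>' t \<bullet> \<gamma>' t) / a t) (at t within {0..1})" if "t \<in> {0..1}" for t
  proof -
    have "((\<lambda>t. \<Sum>i\<in>UNIV. \<gamma>' t $ i * \<gamma>' t $ i) has_real_derivative
       (\<Sum>i\<in>UNIV. 2 * \<gamma>' t $ i * ((2 * \<gamma>' t $ \<ll> * \<gamma>' t $ i - (if i = \<ll> then \<gamma>' t \<bullet> \<gamma>' t else 0)) / a t))) (at t within {0..1})"
      by (intro DERIV_sum) (auto intro!: derivative_eq_intros d2 that simp: algebra_simps)
    moreover have "(\<Sum>i\<in>UNIV. 2 * \<gamma>' t $ i * ((2 * \<gamma>' t $ \<ll> * \<gamma>' t $ i - (if i = \<ll> then \<gamma>' t \<bullet> \<gamma>' t else 0)) / a t)) =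
      2 * \<gamma>' t $ \<ll> * (\<gamma>' t \<bullet> \<gamma>' t) / a t"
    proof -
      have "(\<Sum>i\<in>UNIV. 2 * \<gamma>' t $ i * ((2 * \<gamma>' t $ \<ll> * \<gamma>' t $ i - (if i = \<ll> then \<gamma>' t \<bullet> \<gamma>' t else 0)) / a t)) =
        (\<Sum>i\<in>UNIV. 4 * \<gamma>' t $ \<ll> / a t * (\<gamma>' t $ i * \<gamma>' t $ i) - (if i = \<ll> then 2 * \<gamma>' t $ \<ll> * (\<gamma>' t \<bullet> \<gamma>' t) / a t else 0))"
        using a[OF that] by (intro sum.cong) (auto simp: field_simps)
      also have "\<dots> = 4 * \<gamma>' t $ \<ll> / a t * (\<gamma>' t \<bullet> \<gamma>' t) - 2 * \<gamma>' t $ \<ll> * (\<gamma>' t \<bullet> \<gamma>' t) / a t"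
        unfolding sum_subtractf sum_distrib_left[symmetric] by (simp add: inner_vec_def)
      finally show ?thesis by simp
    qed
    ultimately show ?thesis by (simp add: inner_vec_def)
  qed
  have E: "E t = E 0" if "t \<in> {0..1}" for t
  proof (rule DERIV_eq_0_imp_eq[OF _ that])
    fix t :: real assume t: "t \<in> {0..1}"
    show "(E has_real_derivative 0) (at t within {0..1})"
      unfolding E_def using a[OF t]
      by (auto intro!: derivative_eq_intros da dQ t simp: field_simps power2_eq_square)
  qed
  define s where "s = norm v / height x"
  have E0: "E 0 = s\<^sup>2" by (simp add: E_def s_def a_def v_def x_def power_divide power2_norm_eq_inner)
  have du: "((\<lambda>t. 1 / a t) has_real_derivative - \<gamma>' t $ \<ll> / (a t)\<^sup>2) (at t within {0..1})" if "t \<in> {0..1}" for t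
    using a[OF that] by (auto intro!: derivative_eq_intros da that simp: power2_eq_square)
  have du': "((\<lambda>t. - \<gamma>' t $ \<ll> / (a t)\<^sup>2) has_real_derivative s\<^sup>2 * (1 / a t)) (at t within {0..1})" if "t \<in> {0..1}" for t
  proof -
    have "((\<lambda>t. - \<gamma>' t $ \<ll> / (a t)\<^sup>2) has_real_derivative E t * (1 / a t)) (at t within {0..1})"
      unfolding E_def using a[OF that]
      by (auto intro!: derivative_eq_intros da that d2 simp: field_simps power2_eq_square)
    then show ?thesis by (simp add: E[OF that] E0)
  qed
  have u: "1 / a t = geod_u x v t" if t: "t \<in> {0..1}" for t
  proof -
    have "(\<lambda>t. 1 / a t - geod_u x v t) t = 0"
    proof (rule ode_cosh_unique[where s = s and D = "\<lambda>t. 1 / a t - geod_u x v t" and D' = "\<lambda>t. - \<gamma>' t $ \<ll> / (a t)\<^sup>2 - geod_u' x v t"])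
      fix t :: real assume t: "t \<in> {0..1}"
      show "((\<lambda>t. 1 / a t - geod_u x v t) has_real_derivative - \<gamma>' t $ \<ll> / (a t)\<^sup>2 - geod_u' x v t) (at t within {0..1})"
        by (intro DERIV_diff du t geod_u_deriv)
      show "((\<lambda>t. - \<gamma>' t $ \<ll> / (a t)\<^sup>2 - geod_u' x v t) has_real_derivative s\<^sup>2 * (1 / a t - geod_u x v t)) (at t within {0..1})"
        using DERIV_diff[OF du'[OF t] geod_u'_deriv[of x v t]] by (simp add: s_def algebra_simps)
    qed (use t in \<open>auto simp: geod_u_def geod_u'_def a_def x_def v_def height_def\<close>)
    then show ?thesis by simp
  qed
  have c: "\<gamma>' t $ i = v $ i / (height x * geod_u x v t)\<^sup>2" if t: "t \<in> {0..1}" and i: "i \<noteq> \<ll>" for t i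
  proof -
    have "(\<lambda>t. \<gamma>' t $ i / (a t)\<^sup>2) t = (\<lambda>t. \<gamma>' t $ i / (a t)\<^sup>2) 0"
    proof (rule DERIV_eq_0_imp_eq[OF _ t])
      fix t :: real assume t: "t \<in> {0..1}"
      show "((\<lambda>t. \<gamma>' t $ i / (a t)\<^sup>2) has_real_derivative 0) (at t within {0..1})"
        using a[OF t] i by (auto intro!: derivative_eq_intros da t d2 simp: field_simps power2_eq_square)
    qed
    then have "\<gamma>' t $ i = v $ i / (height x)\<^sup>2 * (a t)\<^sup>2"
      using a[OF t] hx by (simp add: a_def x_def v_def field_simps)
    also have "a t = 1 / geod_u x v t" by (simp flip: u[OF t])
    finally show ?thesis by (simp add: power_divide power_mult_distrib)
  qed
  have "\<gamma> t $ i = geod x v t $ i" for i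
  proof (cases "i = \<ll>")
    case True
    have "1 / geod_u x v t = a t" by (simp flip: u[OF t])
    then show ?thesis using True by (simp add: geod_def a_def height_def)
  next
    case False
    have "(\<lambda>t. \<gamma> t $ i - geod x v t $ i) t = (\<lambda>t. \<gamma> t $ i - geod x v t $ i) 0"
    proof (rule DERIV_eq_0_imp_eq[OF _ t])
      fix t :: real assume t: "t \<in> {0..1}"
      have "((\<lambda>t. geod x v t $ i) has_real_derivative geod' x v t $ i) (at t within {0..1})"
        using geod_has_vector_derivative[OF hx] unfolding has_vector_derivative_vec_iff by blast
      from DERIV_diff[OF d1[OF t, of i] this]
      show "((\<lambda>t. \<gamma> t $ i - geod x v t $ i) has_real_derivative 0) (at t within {0..1})"
        using False by (simp add: c[OF t False] geod'_def)
    qed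
    then show ?thesis by (simp add: geod_0 x_def)
  qed
  then show ?thesis by (simp add: vec_eq_iff x_def v_def)
qed

lemma hyp_exp_eq:
  assumes "x \<in> hyp_space" shows "hyp_exp x v = geod x v 1"
proof -
  have hx: "height x > 0" using assms by (simp add: hyp_space_def)
  show ?thesis unfolding hyp_exp_def
  proof (rule the_equality)
    show "\<exists>\<gamma> \<gamma>'. hyp_geodesic \<gamma> \<gamma>' \<and> \<gamma> 0 = x \<and> \<gamma>' 0 = v \<and> \<gamma> 1 = geod x v 1"
      using hyp_geodesic_geod[OF hx] geod_0 geod'_0[OF hx] by blast
    show "y = geod x v 1" if "\<exists>\<gamma> \<gamma>'. hyp_geodesic \<gamma> \<gamma>' \<and> \<gamma> 0 = x \<and> \<gamma>' 0 = v \<and> \<gamma> 1 = y" for y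
      using that hyp_geodesic_unique[of _ _ 1] by auto
  qed
qed

definition hyp_cosh :: "'n::{finite,linorder} point \<Rightarrow> 'n point \<Rightarrow> real" where
  "hyp_cosh x y = 1 + (norm (x - y))\<^sup>2 / (2 * height x * height y)"

lemma hyp_cosh_ge_1: "x \<in> hyp_space \<Longrightarrow> y \<in> hyp_space \<Longrightarrow> hyp_cosh x y \<ge> 1"
  by (simp add: hyp_cosh_def hyp_space_def)

lemma hyp_cosh_geod:
  assumes "height x > 0"
  shows "hyp_cosh x (geod x v 1) = cosh (norm v / height x)"
proof -
  define h s C S u where "h = height x" and "s = norm v / h" and "C = cosh s" and "S = sinhc s 1" and "u = geod_u x v 1"
  have h: "h > 0" using assms by (simp add: h_def)
  have u: "u > 0" unfolding u_def by (rule geod_u_pos[OF assms])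
  have S: "s\<^sup>2 * S\<^sup>2 = C\<^sup>2 - 1" using cosh_sinhc[of s 1] by (simp add: C_def S_def)
  have hu: "h * u = C - height v * S / h"
    using h by (simp add: u_def geod_u_def C_def S_def s_def h_def field_simps power2_eq_square)
  have "(norm (x - geod x v 1))\<^sup>2 = (h - 1 / u)\<^sup>2 + (\<Sum>i\<in>UNIV - {\<ll>}. (v $ i)\<^sup>2) * (S / (h * u))\<^sup>2"
    unfolding norm_split_last[of "x - _"] sum_distrib_right
    by (simp add: geod_def height_def h_def u_def S_def s_def power_mult_distrib power_divide)
  also have "(\<Sum>i\<in>UNIV - {\<ll>}. (v $ i)\<^sup>2) = (s * h)\<^sup>2 - (height v)\<^sup>2"
    using norm_split_last[of v] h by (simp add: s_def)
  also have "(h - 1 / u)\<^sup>2 + ((s * h)\<^sup>2 - (height v)\<^sup>2) * (S / (h * u))\<^sup>2 =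
     ((h * u - 1)\<^sup>2 + s\<^sup>2 * S\<^sup>2 - (height v * S / h)\<^sup>2) / u\<^sup>2"
    using h u by (simp add: field_simps power2_eq_square)
  also have "height v * S / h = C - h * u" using hu by simp
  also have "(h * u - 1)\<^sup>2 + s\<^sup>2 * S\<^sup>2 - (C - h * u)\<^sup>2 = 2 * h * u * (C - 1)"
    unfolding S by (simp add: power2_eq_square algebra_simps)
  finally have "(norm (x - geod x v 1))\<^sup>2 = 2 * h * u * (C - 1) / u\<^sup>2" .
  then have "(norm (x - geod x v 1))\<^sup>2 = 2 * h / u * (C - 1)"
    using u by (simp add: power2_eq_square)
  then show ?thesis using h u unfolding hyp_cosh_def height_geod
    by (simp add: h_def[symmetric] u_def[symmetric] s_def[symmetric] C_def[symmetric])
qed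

definition geod_log :: "'n::{finite,linorder} point \<Rightarrow> 'n point \<Rightarrow> 'n point" where
  "geod_log x y = (1 / sinhc (arcosh (hyp_cosh x y)) 1) *\<^sub>R
     (\<chi> i. if i = \<ll> then height x * (hyp_cosh x y - height x / height y)
       else height x / height y * (y $ i - x $ i))"

lemma norm_geod_log:
  assumes "x \<in> hyp_space" "y \<in> hyp_space"
  shows "norm (geod_log x y) = height x * arcosh (hyp_cosh x y)"
proof -
  define h k C s where "h = height x" and "k = height y" and "C = hyp_cosh x y" and "s = arcosh C"
  have hk: "h > 0" "k > 0" using assms by (auto simp: hyp_space_def h_def k_def)
  have C1: "C \<ge> 1" using hyp_cosh_ge_1[OF assms] by (simp add: C_def)
  have s0: "s \<ge> 0" and coshs: "cosh s = C" using C1 by (simp_all add: s_def)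
  have S: "sinhc s 1 > 0" using s0 by (simp add: sinhc_pos)
  have A: "(norm (x - y))\<^sup>2 = 2 * h * k * (C - 1)"
    using hk by (simp add: C_def hyp_cosh_def h_def k_def)
  have "(norm (geod_log x y))\<^sup>2 = (1 / sinhc s 1)\<^sup>2 * ((h * (C - h / k))\<^sup>2 + (h / k)\<^sup>2 * (\<Sum>i\<in>UNIV - {\<ll>}. ((x - y) $ i)\<^sup>2))"
    unfolding norm_split_last[of "geod_log _ _"] sum_distrib_left distrib_left
    by (simp add: geod_log_def height_def h_def k_def C_def s_def power_mult_distrib power_divide power2_commute)
  also have "(\<Sum>i\<in>UNIV - {\<ll>}. ((x - y) $ i)\<^sup>2) = 2 * h * k * (C - 1) - (h - k)\<^sup>2"
    using norm_split_last[of "x - y"] A by (simp add: height_def h_def k_def)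
  also have "(h * (C - h / k))\<^sup>2 + (h / k)\<^sup>2 * (2 * h * k * (C - 1) - (h - k)\<^sup>2) = h\<^sup>2 * (C\<^sup>2 - 1)"
    using hk by (simp add: field_simps power2_eq_square)
  also have "C\<^sup>2 - 1 = s\<^sup>2 * (sinhc s 1)\<^sup>2" using cosh_sinhc[of s 1] coshs by simp
  also have "(1 / sinhc s 1)\<^sup>2 * (h\<^sup>2 * (s\<^sup>2 * (sinhc s 1)\<^sup>2)) = (h * s)\<^sup>2"
    using S by (simp add: field_simps)
  finally have "(norm (geod_log x y))\<^sup>2 = (h * s)\<^sup>2" .
  then show ?thesis using hk s0 unfolding h_def[symmetric] C_def[symmetric] s_def[symmetric]
    by (subst (asm) power2_eq_iff_nonneg) auto
qed

lemma geod_geod_log: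
  assumes "x \<in> hyp_space" "y \<in> hyp_space"
  shows "geod x (geod_log x y) 1 = y"
proof -
  define h k C s where "h = height x" and "k = height y" and "C = hyp_cosh x y" and "s = arcosh C"
  have hk: "h > 0" "k > 0" using assms by (auto simp: hyp_space_def h_def k_def)
  have C1: "C \<ge> 1" using hyp_cosh_ge_1[OF assms] by (simp add: C_def)
  have s0: "s \<ge> 0" and coshs: "cosh s = C" using C1 by (simp_all add: s_def)
  have S: "sinhc s 1 > 0" using s0 by (simp add: sinhc_pos)
  have n: "norm (geod_log x y) / height x = s"
    using norm_geod_log[OF assms] hk by (simp add: s_def C_def h_def)
  have hv: "height (geod_log x y) = h * (C - h / k) / sinhc s 1"
    by (simp add: geod_log_def height_def h_def k_def C_def s_def)
  have u: "geod_u x (geod_log x y) 1 = 1 / k"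
    unfolding geod_u_def n hv using S hk by (simp add: h_def[symmetric] coshs power2_eq_square field_simps)
  have l: "geod_log x y $ i = h / k * (y $ i - x $ i) / sinhc s 1" if "i \<noteq> \<ll>" for i
    using that by (simp add: geod_log_def h_def k_def C_def s_def)
  show ?thesis
    using S hk unfolding vec_eq_iff geod_def u n
    by (auto simp: l h_def[symmetric]) (simp add: k_def height_def)
qed

lemma geod_log_geod:
  assumes "x \<in> hyp_space"
  shows "geod_log x (geod x v 1) = v"
proof -
  define h s where "h = height x" and "s = norm v / h"
  have h: "h > 0" using assms by (auto simp: hyp_space_def h_def)
  have s0: "s \<ge> 0" using h by (simp add: s_def)
  have C: "hyp_cosh x (geod x v 1) = cosh s" using hyp_cosh_geod h unfolding s_def h_def by blast
  have S: "sinhc s 1 > 0" using s0 by (simp add: sinhc_pos)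
  have u: "geod_u x v 1 > 0" using geod_u_pos h unfolding h_def by blast
  have hu: "h * geod_u x v 1 = cosh s - height v * sinhc s 1 / h"
    using h by (simp add: geod_u_def s_def h_def field_simps power2_eq_square)
  have "geod_log x (geod x v 1) $ i = v $ i" for i
  proof (cases "i = \<ll>")
    case True
    then show ?thesis using S u h hu
      by (simp add: geod_log_def C arcosh_cosh_real[OF s0] height_geod h_def[symmetric]) (simp add: height_def)
  next
    case False
    then show ?thesis using S u h
      by (simp add: geod_log_def C arcosh_cosh_real[OF s0] height_geod h_def[symmetric])
        (simp add: geod_def h_def[symmetric] s_def[symmetric])
  qed
  then show ?thesis by (simp add: vec_eq_iff)
qed

lemma influence_eq:
  assumes "x \<in> hyp_space" "y \<in> hyp_space"
  shows "influence x y = geod_log x y"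
proof -
  have e: "hyp_exp x = (\<lambda>v. geod x v 1)" using hyp_exp_eq[OF assms(1)] by auto
  have "hyp_exp x (influence x y) = y"
    unfolding influence_def by (rule f_inv_into_f) (metis e geod_geod_log[OF assms] rangeI)
  then show ?thesis using geod_log_geod[OF assms(1)] by (metis e)
qed

section \<open>The distance function\<close>

text \<open>Here \<open>|\<nabla> cosh d(x, \<cdot>)|\<^sup>2 = cosh\<^sup>2 d - 1\<close>, and the parameter \<open>e\<close> removes the singularity of
  \<open>arcosh\<close> at \<open>1\<close>.\<close>

lemma hyp_cosh_deriv_bound:
  fixes x z w :: "'n::{finite,linorder} point"
  assumes "height x > 0" "height z > 0"
  shows "\<bar>(z - x) \<bullet> w / (height x * height z) - (norm (z - x))\<^sup>2 * height w / (2 * height x * (height z)\<^sup>2)\<bar>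
    \<le> sqrt ((hyp_cosh x z)\<^sup>2 - 1) * (norm w / height z)"
proof -
  define h k where "h = height x" and "k = height z"
  have hk: "h > 0" "k > 0" using assms by (auto simp: h_def k_def)
  define g :: "'n point" where "g = (1 / (h * k)) *\<^sub>R (z - x) - ((norm (z - x))\<^sup>2 / (2 * h * k\<^sup>2)) *\<^sub>R axis \<ll> 1"
  have gw: "(z - x) \<bullet> w / (height x * height z) - (norm (z - x))\<^sup>2 * height w / (2 * height x * (height z)\<^sup>2) = g \<bullet> w"
    by (simp add: g_def inner_diff_left inner_diff_right inner_axis' h_def k_def height_def)
  have "(norm g)\<^sup>2 = (norm (z - x))\<^sup>2 / (h * k)\<^sup>2 + ((norm (z - x))\<^sup>2 / (2 * h * k\<^sup>2))\<^sup>2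
      - 2 * (1 / (h * k)) * ((norm (z - x))\<^sup>2 / (2 * h * k\<^sup>2)) * (k - h)"
  proof -
    have "(norm (a *\<^sub>R u - b *\<^sub>R axis \<ll> 1))\<^sup>2 = a\<^sup>2 * (norm u)\<^sup>2 + b\<^sup>2 - 2 * a * b * height u"
      for a b and u :: "'n point"
      unfolding power2_norm_eq_inner
      by (simp add: inner_diff_left inner_diff_right inner_axis inner_axis' inner_axis_axis height_def
          power2_eq_square algebra_simps)
    from this[of "1 / (h * k)" "z - x"] show ?thesis
      unfolding g_def by (simp add: h_def k_def height_def power_divide)
  qed
  also have "\<dots> = ((hyp_cosh x z)\<^sup>2 - 1) / k\<^sup>2"
    using hk unfolding hyp_cosh_def norm_minus_commute[of x z] h_def[symmetric] k_def[symmetric]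
    by (simp add: field_simps power2_eq_square)
  finally have "norm g = sqrt ((hyp_cosh x z)\<^sup>2 - 1) / k"
    using hk by (metis norm_ge_zero real_sqrt_divide real_sqrt_abs real_sqrt_unique abs_of_pos)
  then show ?thesis unfolding gw using Cauchy_Schwarz_ineq2[of g w] by (simp add: k_def)
qed

lemma dist_increment_le_hyp_length:
  fixes \<gamma> :: "real \<Rightarrow> 'n::{finite,linorder} point"
  assumes C1: "\<gamma> piecewise_C1_differentiable_on {0..1}" and im: "\<gamma> ` {0..1} \<subseteq> hyp_space"
    and x: "x \<in> hyp_space"
  shows "ennreal (arcosh (hyp_cosh x (\<gamma> 1)) - arcosh (hyp_cosh x (\<gamma> 0))) \<le> hyp_length \<gamma>"
proof (cases "hyp_length \<gamma> = \<infinity>")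
  case False
  obtain S where S: "finite S" "\<gamma> C1_differentiable_on ({0..1} - S)" and cont: "continuous_on {0..1} \<gamma>"
    using C1 unfolding piecewise_C1_differentiable_on_def by blast
  obtain D where D: "\<And>t. t \<in> {0..1} - S \<Longrightarrow> (\<gamma> has_vector_derivative D t) (at t)"
    and contD: "continuous_on ({0..1} - S) D"
    using S(2) unfolding C1_differentiable_on_def by blast
  define k where "k = (\<lambda>t. height (\<gamma> t))"
  have k: "k t > 0" if "t \<in> {0..1}" for t using im that unfolding k_def hyp_space_def by (auto simp: image_subset_iff)
  have hx: "height x > 0" using x by (simp add: hyp_space_def)
  have contk: "continuous_on {0..1} k" unfolding k_def height_def by (intro continuous_intros cont)
  define sp where "sp = (\<lambda>t. if t \<in> {0..1} - S then norm (D t) / k t else 0)"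
  have sp0: "sp t \<ge> 0" for t using k[of t] by (auto simp: sp_def)
  have sp_meas: "sp \<in> borel_measurable lborel"
  proof -
    have "continuous_on ({0..1} - S) (\<lambda>t. norm (D t) / k t)"
      by (intro continuous_intros contD continuous_on_subset[OF contk]) (use k in force)+
    then have "(\<lambda>t. norm (D t) / k t) \<in> borel_measurable (restrict_space borel ({0..1} - S))"
      by (rule borel_measurable_continuous_on_restrict)
    moreover have "{0..1} - S \<in> sets borel" using borel_closed[OF finite_imp_closed[OF S(1)]] by auto
    ultimately show ?thesis unfolding sp_def
      by (subst (asm) measurable_restrict_space_iff[where c=0]) auto
  qed
  have len: "hyp_length \<gamma> = (\<integral>\<^sup>+ t. ennreal (sp t) \<partial>lborel)"
    unfolding hyp_length_def
  proof (rule nn_integral_cong_AE)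
    have "AE t in lborel. t \<notin> S" using S(1) by (intro AE_not_in finite_imp_null_set_lborel)
    then show "AE t in lborel. ennreal (sqrt (hyp_metric (\<gamma> t) (vector_derivative \<gamma> (at t)) (vector_derivative \<gamma> (at t)))) * indicator {0..1} t = ennreal (sp t)"
    proof eventually_elim
      case (elim t)
      show ?case
      proof (cases "t \<in> {0..1}")
        case True
        then have "vector_derivative \<gamma> (at t) = D t" using D[of t] elim by (auto intro: vector_derivative_at)
        moreover have "height (\<gamma> t) = k t" by (simp add: k_def)
        ultimately show ?thesis using True elim k[OF True]
          by (simp add: sp_def hyp_metric_def real_sqrt_divide norm_eq_sqrt_inner)
      qed (auto simp: sp_def)
    qed
  qed
  have int: "integrable lborel sp"
    using False sp_meas sp0 by (intro integrableI_bounded) (auto simp: len less_top)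
  define L where "L = integral\<^sup>L lborel sp"
  have L: "hyp_length \<gamma> = ennreal L" unfolding len L_def by (intro nn_integral_eq_integral int) (simp add: sp0)
  have L0: "L \<ge> 0" unfolding L_def using sp0 by simp
  have spint: "(sp has_integral L) {0..1}"
  proof -
    have "((\<lambda>t. if t \<in> {0..1} then sp t else 0) has_integral L) UNIV"
      unfolding L_def using has_integral_integral_lborel[OF int]
      by (rule has_integral_eq_rhs[OF has_integral_cong[THEN iffD1, rotated]]) (auto simp: sp_def)
    then show ?thesis by (simp only: has_integral_restrict_UNIV)
  qed
  define C where "C = (\<lambda>t. hyp_cosh x (\<gamma> t))"
  have C1: "C t \<ge> 1" if "t \<in> {0..1}" for t unfolding C_def by (rule hyp_cosh_ge_1[OF x]) (use im that in auto)
  define C' where "C' = (\<lambda>t. (\<gamma> t - x) \<bullet> D t / (height x * k t) - (norm (\<gamma> t - x))\<^sup>2 * height (D t) / (2 * height x * (k t)\<^sup>2))"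
  have dC: "(C has_real_derivative C' t) (at t)" if t: "t \<in> {0..1} - S" for t
  proof -
    have dk: "(k has_real_derivative height (D t)) (at t)"
      using D[OF t] unfolding has_vector_derivative_vec_iff k_def height_def by blast
    have "((\<lambda>t. (\<gamma> t - x) \<bullet> (\<gamma> t - x)) has_derivative
        (\<lambda>s. (\<gamma> t - x) \<bullet> (s *\<^sub>R D t) + (s *\<^sub>R D t) \<bullet> (\<gamma> t - x))) (at t)"
      using D[OF t] unfolding has_vector_derivative_def
      by (auto intro!: derivative_eq_intros)
    then have dn: "((\<lambda>t. (\<gamma> t - x) \<bullet> (\<gamma> t - x)) has_real_derivative 2 * ((\<gamma> t - x) \<bullet> D t)) (at t)"
      unfolding has_field_derivative_def
      by (rule has_derivative_eq_rhs) (auto simp: fun_eq_iff inner_commute)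
    have "((\<lambda>t. 1 + (\<gamma> t - x) \<bullet> (\<gamma> t - x) / (2 * height x * k t)) has_real_derivative C' t) (at t)"
      unfolding C'_def power2_norm_eq_inner using hx k[of t] t
      by (auto intro!: derivative_eq_intros dn dk simp: field_simps power2_eq_square)
    moreover have "C = (\<lambda>t. 1 + (\<gamma> t - x) \<bullet> (\<gamma> t - x) / (2 * height x * k t))"
      unfolding C_def hyp_cosh_def power2_norm_eq_inner[symmetric] k_def by (simp add: norm_minus_commute)
    ultimately show ?thesis by simp
  qed
  have C'_le: "\<bar>C' t\<bar> \<le> sqrt ((C t)\<^sup>2 - 1) * sp t" if t: "t \<in> {0..1} - S" for t
    using hyp_cosh_deriv_bound[of x "\<gamma> t" "D t"] hx k[of t] t unfolding C'_def C_def k_def sp_def by auto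
  have contC: "continuous_on {0..1} C"
    unfolding C_def hyp_cosh_def
    by (intro continuous_intros cont contk[unfolded k_def]) (use hx k in \<open>force simp: k_def\<close>)
  have main: "ln (C 1 + sqrt ((C 1)\<^sup>2 - 1 + e)) - ln (C 0 + sqrt ((C 0)\<^sup>2 - 1 + e)) \<le> L" if e: "e > 0" for e
  proof -
    define G where "G = (\<lambda>c. ln (c + sqrt (c\<^sup>2 - 1 + e)))"
    have pos: "c\<^sup>2 - 1 + e > 0" if "c \<ge> 1" for c :: real using that e one_le_power[of c 2] by linarith
    have pos': "c + sqrt (c\<^sup>2 - 1 + e) > 0" if "c \<ge> 1" for c :: real
      using that pos[OF that] by (intro add_pos_pos) auto
    have dG: "(G has_real_derivative 1 / sqrt (c\<^sup>2 - 1 + e)) (at c)" if "c \<ge> 1" for c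
    proof -
      define r where "r = sqrt (c\<^sup>2 - 1 + e)"
      have r: "r > 0" "c + r > 0" using pos[OF that] pos'[OF that] by (auto simp: r_def)
      have "(G has_real_derivative (1 + 2 * c * (inverse r / 2)) / (c + r)) (at c)"
        unfolding G_def r_def using pos[OF that] pos'[OF that]
        by (auto intro!: derivative_eq_intros simp: divide_simps)
      also have "1 + 2 * c * (inverse r / 2) = (c + r) / r" using r by (simp add: field_simps)
      also have "(c + r) / r / (c + r) = 1 / r" using r by simp
      finally show ?thesis by (simp add: r_def)
    qed
    have "((\<lambda>t. C' t / sqrt ((C t)\<^sup>2 - 1 + e)) has_integral (G (C 1) - G (C 0))) {0..1}"
    proof (rule fundamental_theorem_of_calculus_strong[OF S(1), where f = "\<lambda>t. G (C t)"])
      show "continuous_on {0..1} (\<lambda>t. G (C t))"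
        unfolding G_def by (intro continuous_intros contC) (use C1 pos' in force)
      fix t :: real assume t: "t \<in> {0..1} - S"
      have "((\<lambda>t. G (C t)) has_real_derivative 1 / sqrt ((C t)\<^sup>2 - 1 + e) * C' t) (at t)"
        using t by (intro DERIV_chain2[OF dG dC] C1) auto
      then show "((\<lambda>t. G (C t)) has_vector_derivative C' t / sqrt ((C t)\<^sup>2 - 1 + e)) (at t)"
        by (simp add: has_real_derivative_iff_has_vector_derivative)
    qed simp
    then have "((\<lambda>t. if t \<in> S then 0 else C' t / sqrt ((C t)\<^sup>2 - 1 + e)) has_integral (G (C 1) - G (C 0))) {0..1}"
      by (rule has_integral_spike_finite[OF S(1), rotated]) auto
    then have "G (C 1) - G (C 0) \<le> L"
    proof (rule has_integral_le[OF _ spint])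
      fix t :: real assume t: "t \<in> {0..1}"
      show "(if t \<in> S then 0 else C' t / sqrt ((C t)\<^sup>2 - 1 + e)) \<le> sp t"
      proof (cases "t \<in> S")
        case False
        have "C' t \<le> sqrt ((C t)\<^sup>2 - 1) * sp t" using C'_le[of t] t False by (auto dest: abs_le_D1)
        also have "\<dots> \<le> sqrt ((C t)\<^sup>2 - 1 + e) * sp t" using e sp0 by (intro mult_right_mono) auto
        finally show ?thesis using False pos[OF C1[OF t]] by (simp add: divide_le_eq mult.commute)
      qed (simp add: sp0)
    qed
    then show ?thesis by (simp add: G_def)
  qed
  have "((\<lambda>e. ln (C 1 + sqrt ((C 1)\<^sup>2 - 1 + e)) - ln (C 0 + sqrt ((C 0)\<^sup>2 - 1 + e))) \<longlongrightarrow>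
     ln (C 1 + sqrt ((C 1)\<^sup>2 - 1 + 0)) - ln (C 0 + sqrt ((C 0)\<^sup>2 - 1 + 0))) (at_right 0)"
  proof (intro tendsto_intros)
    have *: "C t + sqrt ((C t)\<^sup>2 - 1 + 0) > 0" if "t \<in> {0..1}" for t
      using C1[OF that] one_le_power[of "C t" 2] by (intro add_pos_nonneg) auto
    show "C 1 + sqrt ((C 1)\<^sup>2 - 1 + 0) \<noteq> 0" using *[of 1] by simp
    show "C 0 + sqrt ((C 0)\<^sup>2 - 1 + 0) \<noteq> 0" using *[of 0] by simp
  qed
  then have "ln (C 1 + sqrt ((C 1)\<^sup>2 - 1 + 0)) - ln (C 0 + sqrt ((C 0)\<^sup>2 - 1 + 0)) \<le> L"
    by (rule tendsto_upperbound) (auto intro!: main eventually_mono[OF eventually_at_right_less[of "0::real"]])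
  then show ?thesis unfolding L using C1[of 0] C1[of 1] by (simp add: arcosh_real_def C_def ennreal_leI)
qed simp

lemma hyp_length_geod:
  assumes "height x > 0"
  shows "hyp_length (geod x v) = ennreal (norm v / height x)"
proof -
  have 1: "vector_derivative (geod x v) (at t) = geod' x v t" for t
    by (rule vector_derivative_at[OF geod_has_vector_derivative[OF assms]])
  have 2: "sqrt (hyp_metric (geod x v t) (geod' x v t) (geod' x v t)) = norm v / height x" for t
    unfolding hyp_metric_def geod'_speed[OF assms] height_geod
    using geod_u_pos[OF assms, of v t] assms by (simp add: power_divide real_sqrt_divide)
  show ?thesis unfolding hyp_length_def 1 2 by (simp add: nn_integral_cmult_indicator)
qed

lemma geod_in_hyp_space: "x \<in> hyp_space \<Longrightarrow> geod x v t \<in> hyp_space"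
  by (simp add: hyp_space_def height_geod geod_u_pos)

lemma geod_C1:
  assumes "height x > 0"
  shows "geod x v piecewise_C1_differentiable_on {0..1}"
proof (rule C1_differentiable_imp_piecewise)
  have "continuous_on {0..1} (geod' x v)"
    using geod'_has_vector_derivative[OF assms, of v _ "{0..1}"] by (meson continuous_on_eq_continuous_within has_vector_derivative_continuous)
  then show "geod x v C1_differentiable_on {0..1}"
    unfolding C1_differentiable_on_def using geod_has_vector_derivative[OF assms] by blast
qed

lemma hyp_dist_eq:
  assumes x: "x \<in> hyp_space" and y: "y \<in> hyp_space"
  shows "hyp_dist x y = arcosh (hyp_cosh x y)"
proof -
  let ?P = "{\<gamma>. \<gamma> piecewise_C1_differentiable_on {0..1} \<and> \<gamma> ` {0..1} \<subseteq> hyp_space \<and> \<gamma> 0 = x \<and> \<gamma> 1 = y}"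
  have hx: "height x > 0" using x by (simp add: hyp_space_def)
  have "(INF \<gamma> \<in> ?P. hyp_length \<gamma>) = ennreal (arcosh (hyp_cosh x y))"
  proof (rule antisym)
    have "geod x (geod_log x y) \<in> ?P"
      using geod_C1[OF hx] geod_in_hyp_space[OF x] geod_geod_log[OF x y] by (auto simp: geod_0)
    then have "(INF \<gamma> \<in> ?P. hyp_length \<gamma>) \<le> hyp_length (geod x (geod_log x y))" by (rule INF_lower)
    also have "\<dots> = ennreal (arcosh (hyp_cosh x y))"
      using hx by (simp add: hyp_length_geod norm_geod_log[OF x y])
    finally show "(INF \<gamma> \<in> ?P. hyp_length \<gamma>) \<le> ennreal (arcosh (hyp_cosh x y))" .
    show "ennreal (arcosh (hyp_cosh x y)) \<le> (INF \<gamma> \<in> ?P. hyp_length \<gamma>)"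
    proof (rule INF_greatest)
      fix \<gamma> assume "\<gamma> \<in> ?P"
      then show "ennreal (arcosh (hyp_cosh x y)) \<le> hyp_length \<gamma>"
        using dist_increment_le_hyp_length[of \<gamma> x] x by (auto simp: hyp_cosh_def)
    qed
  qed
  then show ?thesis unfolding hyp_dist_def using hyp_cosh_ge_1[OF x y] by simp
qed

lemma hyp_dist_triangle:
  assumes x: "x \<in> hyp_space" and y: "y \<in> hyp_space" and z: "z \<in> hyp_space"
  shows "hyp_dist x z \<le> hyp_dist x y + hyp_dist y z"
proof -
  have hy: "height y > 0" using y by (simp add: hyp_space_def)
  have "geod y (geod_log y z) ` {0..1} \<subseteq> hyp_space" using geod_in_hyp_space[OF y] by auto
  then have "ennreal (arcosh (hyp_cosh x z) - arcosh (hyp_cosh x y)) \<le> hyp_length (geod y (geod_log y z))"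
    using dist_increment_le_hyp_length[OF geod_C1[OF hy, of "geod_log y z"] _ x]
    by (simp add: geod_0 geod_geod_log[OF y z])
  also have "\<dots> = ennreal (arcosh (hyp_cosh y z))"
    using hy by (simp add: hyp_length_geod norm_geod_log[OF y z])
  finally show ?thesis using hyp_cosh_ge_1[OF y z]
    by (simp add: hyp_dist_eq assms)
qed

lemma hyp_dist_nonneg: "x \<in> hyp_space \<Longrightarrow> y \<in> hyp_space \<Longrightarrow> hyp_dist x y \<ge> 0"
  by (simp add: hyp_dist_eq hyp_cosh_ge_1)

section \<open>Volume and product measures\<close>

lemma sqrt_det_hyp_metric_matrix:
  fixes x :: "'n::{finite,linorder} point"
  assumes "x \<in> hyp_space"
  shows "sqrt (det (hyp_metric_matrix x)) = 1 / (height x) ^ CARD('n)"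
proof -
  have "hyp_metric_matrix x = matrix ((*\<^sub>R) (1 / (height x)\<^sup>2))"
    unfolding hyp_metric_matrix_eq matrix_scaleR by (simp add: vec_eq_iff mat_def)
  then have "det (hyp_metric_matrix x) = (1 / (height x) ^ CARD('n))\<^sup>2"
    by (simp add: power_divide flip: power_mult) (simp add: mult.commute)
  then show ?thesis using assms by (simp add: hyp_space_def)
qed

lemma height_measurable[measurable]: "height \<in> borel_measurable borel"
  unfolding height_def by measurable

lemma continuous_on_height[continuous_intros]: "continuous_on A f \<Longrightarrow> continuous_on A (\<lambda>x. height (f x))"
  unfolding height_def by (intro continuous_intros)

lemma open_hyp_space: "open (hyp_space :: 'n::{finite,linorder} point set)"
  unfolding hyp_space_def by (intro open_Collect_less continuous_intros)

lemma hyp_space_borel[measurable]: "hyp_space \<in> sets borel"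
  using open_hyp_space by (rule borel_open)

lemma continuous_on_hyp_cosh:
  assumes "continuous_on A f" "continuous_on A g" "\<And>x. x \<in> A \<Longrightarrow> f x \<in> hyp_space" "\<And>x. x \<in> A \<Longrightarrow> g x \<in> hyp_space"
  shows "continuous_on A (\<lambda>x. hyp_cosh (f x) (g x))"
  unfolding hyp_cosh_def using assms(3,4)
  by (intro continuous_intros assms(1,2)) (force simp: hyp_space_def)

lemma open_hyp_cosh_less:
  assumes "open A" "x \<in> hyp_space" "continuous_on A f" "\<And>y. y \<in> A \<Longrightarrow> f y \<in> hyp_space"
  shows "open {y \<in> A. hyp_cosh x (f y) < c}" "open {y \<in> A. hyp_cosh x (f y) > c}"
proof -
  have c: "continuous_on A (\<lambda>y. hyp_cosh x (f y))" using assms by (intro continuous_on_hyp_cosh) auto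
  have "open (A \<inter> (\<lambda>y. hyp_cosh x (f y)) -` {..<c})" "open (A \<inter> (\<lambda>y. hyp_cosh x (f y)) -` {c<..})"
    by (auto intro!: continuous_open_preimage[OF c assms(1)])
  moreover have "A \<inter> (\<lambda>y. hyp_cosh x (f y)) -` {..<c} = {y \<in> A. hyp_cosh x (f y) < c}"
    "A \<inter> (\<lambda>y. hyp_cosh x (f y)) -` {c<..} = {y \<in> A. hyp_cosh x (f y) > c}" by auto
  ultimately show "open {y \<in> A. hyp_cosh x (f y) < c}" "open {y \<in> A. hyp_cosh x (f y) > c}" by auto
qed

lemma hyp_dist_less_iff:
  assumes "x \<in> hyp_space" "y \<in> hyp_space" "r > 0"
  shows "hyp_dist x y < r \<longleftrightarrow> hyp_cosh x y < cosh r"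
proof -
  have "hyp_dist x y < r \<longleftrightarrow> arcosh (hyp_cosh x y) < arcosh (cosh r)"
    using assms by (simp add: hyp_dist_eq arcosh_cosh_real)
  also have "\<dots> \<longleftrightarrow> hyp_cosh x y < cosh r"
    using hyp_cosh_ge_1[OF assms(1,2)] cosh_real_ge_1[of r] by (rule arcosh_less_iff_real)
  finally show ?thesis .
qed

lemma hyp_ball_eq:
  assumes "p \<in> hyp_space" "R > 0"
  shows "hyp_ball p R = {x \<in> hyp_space. hyp_cosh p x < cosh R}"
  unfolding hyp_ball_def using assms by (auto simp: hyp_dist_less_iff)

lemma open_hyp_ball:
  assumes "p \<in> hyp_space" "R > 0" shows "open (hyp_ball p R)"
  unfolding hyp_ball_eq[OF assms] using assms open_hyp_space by (intro open_hyp_cosh_less) auto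

lemma hyp_ball_bounds:
  fixes p :: "'n::{finite,linorder} point"
  assumes "p \<in> hyp_space" "R > 0" "x \<in> hyp_ball p R"
  shows "height x > height p / (2 * cosh R)" "norm (p - x) < 2 * height p * cosh R"
proof -
  define h k c where "h = height p" and "k = height x" and "c = cosh R"
  have x: "x \<in> hyp_space" "hyp_cosh p x < c" using assms by (auto simp: hyp_ball_eq c_def)
  have hk: "h > 0" "k > 0" using assms(1) x by (auto simp: hyp_space_def h_def k_def)
  have c: "c \<ge> 1" by (simp add: c_def cosh_real_ge_1)
  have n: "(norm (p - x))\<^sup>2 < 2 * h * k * (c - 1)"
    using x(2) hk unfolding hyp_cosh_def h_def[symmetric] k_def[symmetric] by (simp add: field_simps)
  have "(h - k)\<^sup>2 \<le> (norm (p - x))\<^sup>2"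
    using power_mono[OF abs_height_le_norm[of "p - x"], of 2] by (simp add: height_def h_def k_def)
  with n have 1: "h\<^sup>2 + k\<^sup>2 < 2 * h * k * c" by (simp add: power2_eq_square algebra_simps)
  have "h * h < 2 * h * k * c" using 1 by (smt (verit) power2_eq_square zero_le_power2)
  then have "h < 2 * k * c" using hk by (simp add: mult.assoc)
  then show "height x > height p / (2 * cosh R)"
    using c unfolding h_def[symmetric] k_def[symmetric] c_def[symmetric] by (simp add: divide_less_eq mult_ac)
  have "k * k < 2 * h * k * c" using 1 by (smt (verit) power2_eq_square zero_le_power2)
  then have k: "k < 2 * h * c" using hk by (simp add: mult_ac)
  have "(norm (p - x))\<^sup>2 < 2 * h * (c - 1) * k" using n by (simp add: mult_ac)
  also have "\<dots> \<le> 2 * h * c * k" using hk by (simp add: mult_right_mono)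
  also have "\<dots> \<le> 2 * h * c * (2 * h * c)" using k hk c by (intro mult_left_mono) auto
  also have "\<dots> = (2 * h * c)\<^sup>2" by (rule power2_eq_square[symmetric])
  finally have "(norm (p - x))\<^sup>2 < (2 * h * c)\<^sup>2" .
  then have "norm (p - x) < 2 * h * c" using hk c by (auto dest: power2_less_imp_less)
  then show "norm (p - x) < 2 * height p * cosh R" by (simp only: h_def c_def)
qed

definition hyp_density :: "'n::{finite,linorder} point \<Rightarrow> ennreal" where
  "hyp_density x = ennreal (1 / (height x) ^ CARD('n))"

lemma hyp_density_measurable[measurable]: "hyp_density \<in> borel_measurable borel"
  unfolding hyp_density_def by measurable

lemma hyp_volume_eq: "hyp_volume = density (restrict_space lborel hyp_space) hyp_density"
  unfolding hyp_volume_def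
proof (rule density_cong)
  let ?M = "restrict_space lborel (hyp_space :: 'a point set)"
  show 1: "hyp_density \<in> borel_measurable ?M" by (simp add: measurable_restrict_space1)
  have eq: "ennreal (sqrt (det (hyp_metric_matrix x))) = hyp_density x" if "x \<in> space ?M" for x :: "'a point"
    using that sqrt_det_hyp_metric_matrix[of x] by (simp add: space_restrict_space hyp_density_def)
  then show "(\<lambda>x. ennreal (sqrt (det (hyp_metric_matrix x)))) \<in> borel_measurable ?M"
    using 1 by (subst measurable_cong[OF eq])
  show "AE x in ?M. ennreal (sqrt (det (hyp_metric_matrix x))) = hyp_density x"
    using eq by (rule AE_I2)
qed

lemma space_hyp_volume[simp]: "space hyp_volume = hyp_space"
  by (simp add: hyp_volume_eq space_restrict_space)

lemma sets_hyp_volume[measurable_cong]: "sets hyp_volume = sets (restrict_space borel hyp_space)"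
  by (simp add: hyp_volume_eq sets_restrict_space)

lemma in_sets_hyp_volume: "A \<in> sets borel \<Longrightarrow> A \<subseteq> hyp_space \<Longrightarrow> A \<in> sets hyp_volume"
  by (subst sets_hyp_volume, subst sets_restrict_space_iff) auto

lemma nn_integral_hyp_volume:
  assumes [measurable]: "f \<in> borel_measurable borel"
  shows "(\<integral>\<^sup>+ x. f x \<partial>hyp_volume) = (\<integral>\<^sup>+ x. hyp_density x * f x * indicator hyp_space x \<partial>lborel)"
proof -
  have "(\<integral>\<^sup>+ x. f x \<partial>hyp_volume) = (\<integral>\<^sup>+ x. hyp_density x * f x \<partial>restrict_space lborel hyp_space)"
    unfolding hyp_volume_eq by (intro nn_integral_density measurable_restrict_space1) auto
  also have "\<dots> = (\<integral>\<^sup>+ x. hyp_density x * f x * indicator hyp_space x \<partial>lborel)"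
    by (intro nn_integral_restrict_space) auto
  finally show ?thesis .
qed

lemma emeasure_hyp_volume:
  assumes "A \<in> sets borel" "A \<subseteq> hyp_space"
  shows "emeasure hyp_volume A = (\<integral>\<^sup>+ x. hyp_density x * indicator A x \<partial>lborel)"
proof -
  have "emeasure hyp_volume A = (\<integral>\<^sup>+ x. indicator A x \<partial>hyp_volume)"
    using in_sets_hyp_volume[OF assms] by simp
  also have "\<dots> = (\<integral>\<^sup>+ x. hyp_density x * indicator A x * indicator hyp_space x \<partial>lborel)"
    using assms by (intro nn_integral_hyp_volume) auto
  also have "\<dots> = (\<integral>\<^sup>+ x. hyp_density x * indicator A x \<partial>lborel)"
    using assms(2) by (intro nn_integral_cong) (auto simp: indicator_def)
  finally show ?thesis .
qed

lemma emeasure_hyp_volume_open: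
  assumes "open A" "A \<subseteq> hyp_space" "A \<noteq> {}"
  shows "emeasure hyp_volume A > 0"
proof (rule ccontr)
  assume "\<not> ?thesis"
  then have "(\<integral>\<^sup>+ x. hyp_density x * indicator A x \<partial>lborel) = 0"
    using emeasure_hyp_volume[of A] assms by auto
  then have "AE x in lborel. hyp_density x * indicator A x = 0"
    using assms(1) by (subst (asm) nn_integral_0_iff_AE) auto
  then have "AE x in lborel. x \<notin> A"
  proof (eventually_elim)
    case (elim x)
    show ?case
    proof
      assume x: "x \<in> A"
      then have "height x ^ CARD('a) > 0" using assms(2) by (intro zero_less_power) (auto simp: hyp_space_def)
      then show False using elim x by (simp add: hyp_density_def ennreal_eq_0_iff)
    qed
  qed
  then have "A \<in> null_sets lborel" using assms(1) by (subst (asm) AE_iff_null_sets[symmetric]) auto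
  then have "negligible A" by (simp add: negligible_iff_null_sets null_sets_completionI)
  then show False using open_not_negligible[OF assms(1,3)] by simp
qed

lemma sigma_finite_hyp_volume: "sigma_finite_measure (hyp_volume :: 'n::{finite,linorder} point measure)"
proof -
  interpret sigma_finite_measure "restrict_space lborel (hyp_space :: 'n point set)"
    by (rule sigma_finite_measure_restrict_space) (auto intro: lborel.sigma_finite_measure_axioms)
  show ?thesis unfolding hyp_volume_eq
    by (subst sigma_finite_iff_density_finite) (auto simp: measurable_restrict_space1 hyp_density_def)
qed

lemma emeasure_hyp_ball_finite:
  fixes p :: "'n::{finite,linorder} point"
  assumes "p \<in> hyp_space" "R > 0"
  shows "emeasure hyp_volume (hyp_ball p R) < \<infinity>"
proof -
  let ?B = "hyp_ball p R" and ?d = "height p / (2 * cosh R)"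
  have o: "open ?B" by (rule open_hyp_ball[OF assms])
  have sub: "?B \<subseteq> hyp_space" by (auto simp: hyp_ball_def)
  have d: "?d > 0" using assms cosh_real_pos[of R] by (simp add: hyp_space_def)
  have "bounded ?B"
    using hyp_ball_bounds(2)[OF assms]
    by (intro boundedI[of _ "norm p + 2 * height p * cosh R"]) (smt (verit) norm_minus_commute norm_triangle_sub)
  then have fin: "emeasure lborel ?B < \<infinity>" by (rule emeasure_bounded_finite)
  have "emeasure hyp_volume ?B = (\<integral>\<^sup>+ x. hyp_density x * indicator ?B x \<partial>lborel)"
    using o sub by (intro emeasure_hyp_volume) auto
  also have "\<dots> \<le> (\<integral>\<^sup>+ x. ennreal (1 / ?d ^ CARD('n)) * indicator ?B x \<partial>lborel)"
  proof (rule nn_integral_mono)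
    fix x show "hyp_density x * indicator ?B x \<le> ennreal (1 / ?d ^ CARD('n)) * indicator ?B x"
    proof (cases "x \<in> ?B")
      case True
      then have "?d ^ CARD('n) \<le> height x ^ CARD('n)"
        using hyp_ball_bounds(1)[OF assms True] d by (intro power_mono) auto
      then show ?thesis using True d
        by (auto simp: hyp_density_def intro!: ennreal_leI frac_le)
    qed simp
  qed
  also have "\<dots> = ennreal (1 / ?d ^ CARD('n)) * emeasure lborel ?B"
    using o by (subst nn_integral_cmult_indicator) auto
  also have "\<dots> < \<infinity>" using fin by (simp add: ennreal_mult_less_top)
  finally show ?thesis .
qed

lemma config_measure_eq:
  fixes p :: "'n::{finite,linorder} point"
  assumes "p \<in> hyp_space" "R > 0"
  shows "config_measure p R N = PiM {1..N} (\<lambda>_. uniform_measure hyp_volume (hyp_ball p R))"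
proof -
  let ?B = "hyp_ball p R" let ?v = "emeasure hyp_volume ?B" let ?U = "uniform_measure hyp_volume ?B"
  have B: "?B \<in> sets hyp_volume"
    using open_hyp_ball[OF assms] by (intro in_sets_hyp_volume) (auto simp: hyp_ball_def)
  have "1 < cosh R" using cosh_real_nonneg_less_iff[of 0 R] assms by simp
  then have "p \<in> ?B" using assms by (simp add: hyp_ball_eq hyp_cosh_def)
  then have "?v > 0"
    by (intro emeasure_hyp_volume_open open_hyp_ball assms) (auto simp: hyp_ball_def)
  then have v0: "?v \<noteq> 0" by simp
  have vf: "?v \<noteq> \<infinity>" using emeasure_hyp_ball_finite[OF assms] by auto
  interpret U: prob_space ?U by (rule prob_space_uniform_measure[OF v0 vf])
  interpret P: product_prob_space "\<lambda>_::nat. ?U" ..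
  interpret V: sigma_finite_measure "hyp_volume :: 'n point measure" by (rule sigma_finite_hyp_volume)
  interpret VP: product_sigma_finite "\<lambda>_::nat. hyp_volume :: 'n point measure" ..
  show ?thesis
  proof (rule P.PiM_eqI)
    have s: "sets (PiM {1..N} (\<lambda>_. ?U)) = sets (PiM {1..N} (\<lambda>_. hyp_volume))" by (intro sets_PiM_cong) auto
    show "sets (config_measure p R N) = sets (PiM {1..N} (\<lambda>_. ?U))"
      unfolding s by (simp add: config_measure_def)
    fix A :: "nat \<Rightarrow> 'n point set" assume A: "\<And>i. i \<in> {1..N} \<Longrightarrow> A i \<in> sets ?U"
    then have [measurable]: "\<And>i. i \<in> {1..N} \<Longrightarrow> A i \<in> sets hyp_volume" by simp
    have [measurable]: "PiE {1..N} (\<lambda>_. ?B) \<in> sets (PiM {1..N} (\<lambda>_. hyp_volume))"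
      "PiE {1..N} A \<in> sets (PiM {1..N} (\<lambda>_. hyp_volume))"
      using B by (auto intro!: sets_PiM_I_finite)
    have "emeasure (config_measure p R N) (PiE {1..N} A) =
       (\<integral>\<^sup>+ X. indicator (PiE {1..N} (\<lambda>_. ?B)) X / ?v ^ N * indicator (PiE {1..N} A) X \<partial>PiM {1..N} (\<lambda>_. hyp_volume))"
      unfolding config_measure_def by (intro emeasure_density) measurable
    also have "\<dots> = (\<integral>\<^sup>+ X. inverse (?v ^ N) * indicator (PiE {1..N} (\<lambda>i. ?B \<inter> A i)) X \<partial>PiM {1..N} (\<lambda>_. hyp_volume))"
      by (intro nn_integral_cong) (auto simp: indicator_def divide_ennreal_def PiE_iff)
    also have "\<dots> = inverse (?v ^ N) * emeasure (PiM {1..N} (\<lambda>_. hyp_volume)) (PiE {1..N} (\<lambda>i. ?B \<inter> A i))"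
      using B by (intro nn_integral_cmult_indicator sets_PiM_I_finite) auto
    also have "\<dots> = inverse (?v ^ N) * (\<Prod>i\<in>{1..N}. emeasure hyp_volume (?B \<inter> A i))"
      using B by (subst VP.emeasure_PiM) auto
    also have "\<dots> = (\<Prod>i\<in>{1..N}. inverse ?v * emeasure hyp_volume (?B \<inter> A i))"
      by (simp add: prod.distrib ennreal_inverse_power)
    also have "\<dots> = (\<Prod>i\<in>{1..N}. emeasure ?U (A i))"
      using B by (intro prod.cong) (auto simp: divide_ennreal_def mult.commute)
    finally show "emeasure (config_measure p R N) (PiE {1..N} A) = (\<Prod>i\<in>{1..N}. emeasure ?U (A i))" .
  qed simp
qed

lemma (in prob_space) distr_PiM_pair:
  assumes "finite I" "i \<in> I" "j \<in> I" "i \<noteq> j"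
  shows "distr (PiM I (\<lambda>_. M)) (M \<Otimes>\<^sub>M M) (\<lambda>X. (X i, X j)) = M \<Otimes>\<^sub>M M"
proof (rule measure_eqI)
  interpret P: product_prob_space "\<lambda>_. M" I ..
  fix E assume "E \<in> sets (distr (PiM I (\<lambda>_. M)) (M \<Otimes>\<^sub>M M) (\<lambda>X. (X i, X j)))"
  then have E[measurable]: "E \<in> sets (M \<Otimes>\<^sub>M M)" by simp
  let ?J = "{i, j}"
  have m: "(\<lambda>X. (X i, X j)) \<in> measurable (PiM I (\<lambda>_. M)) (M \<Otimes>\<^sub>M M)" using assms by measurable
  have m': "(\<lambda>X. (X i, X j)) \<in> measurable (PiM ?J (\<lambda>_. M)) (M \<Otimes>\<^sub>M M)" by measurable
  have mE: "(\<lambda>X. indicator E (X i, X j)) \<in> borel_measurable (PiM ?J (\<lambda>_. M))"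
    using m' by (rule measurable_compose) auto
  have "emeasure (distr (PiM I (\<lambda>_. M)) (M \<Otimes>\<^sub>M M) (\<lambda>X. (X i, X j))) E = (\<integral>\<^sup>+ e. indicator E e \<partial>distr (PiM I (\<lambda>_. M)) (M \<Otimes>\<^sub>M M) (\<lambda>X. (X i, X j)))"
    by simp
  also have "\<dots> = (\<integral>\<^sup>+ X. indicator E (X i, X j) \<partial>PiM I (\<lambda>_. M))"
    using m by (subst nn_integral_distr) auto
  also have "\<dots> = (\<integral>\<^sup>+ X. indicator E (X i, X j) \<partial>distr (PiM I (\<lambda>_. M)) (PiM ?J (\<lambda>_. M)) (\<lambda>X. restrict X ?J))"
    using assms mE by (subst nn_integral_distr) (auto intro!: measurable_restrict_subset)
  also have "distr (PiM I (\<lambda>_. M)) (PiM ?J (\<lambda>_. M)) (\<lambda>X. restrict X ?J) = PiM ?J (\<lambda>_. M)"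
    using assms by (intro P.distr_PiM_restrict_finite) auto
  also have "(\<integral>\<^sup>+ X. indicator E (X i, X j) \<partial>PiM ?J (\<lambda>_. M)) = (\<integral>\<^sup>+ x. \<integral>\<^sup>+ Y. indicator E (x, Y j) \<partial>PiM {j} (\<lambda>_. M) \<partial>M)"
    using assms mE by (subst P.product_nn_integral_insert_rev) (auto simp: fun_upd_def)
  also have "\<dots> = (\<integral>\<^sup>+ x. \<integral>\<^sup>+ y. indicator E (x, y) \<partial>M \<partial>M)"
  proof (rule nn_integral_cong)
    fix x assume [measurable]: "x \<in> space M"
    show "(\<integral>\<^sup>+ Y. indicator E (x, Y j) \<partial>PiM {j} (\<lambda>_. M)) = (\<integral>\<^sup>+ y. indicator E (x, y) \<partial>M)"
      by (rule P.product_nn_integral_singleton) measurable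
  qed
  also have "\<dots> = emeasure (M \<Otimes>\<^sub>M M) E" by (simp add: emeasure_pair_measure)
  finally show "emeasure (distr (PiM I (\<lambda>_. M)) (M \<Otimes>\<^sub>M M) (\<lambda>X. (X i, X j))) E = emeasure (M \<Otimes>\<^sub>M M) E" .
qed simp

lemma (in prob_space) distr_PiM_triple:
  assumes "finite I" "i \<in> I" "j \<in> I" "k \<in> I" "i \<noteq> j" "i \<noteq> k" "j \<noteq> k"
  shows "distr (PiM I (\<lambda>_. M)) (M \<Otimes>\<^sub>M (M \<Otimes>\<^sub>M M)) (\<lambda>X. (X i, X j, X k)) = M \<Otimes>\<^sub>M (M \<Otimes>\<^sub>M M)"
proof (rule measure_eqI)
  interpret P: product_prob_space "\<lambda>_. M" I ..
  interpret MM: pair_prob_space M M ..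
  let ?T = "M \<Otimes>\<^sub>M (M \<Otimes>\<^sub>M M)"
  fix E assume "E \<in> sets (distr (PiM I (\<lambda>_. M)) ?T (\<lambda>X. (X i, X j, X k)))"
  then have E[measurable]: "E \<in> sets ?T" by simp
  let ?J = "{i, j, k}"
  have m: "(\<lambda>X. (X i, X j, X k)) \<in> measurable (PiM I (\<lambda>_. M)) ?T" using assms by measurable
  have m': "(\<lambda>X. (X i, X j, X k)) \<in> measurable (PiM ?J (\<lambda>_. M)) ?T" by measurable
  have mE: "(\<lambda>X. indicator E (X i, X j, X k)) \<in> borel_measurable (PiM ?J (\<lambda>_. M))"
    using m' by (rule measurable_compose) auto
  have "emeasure (distr (PiM I (\<lambda>_. M)) ?T (\<lambda>X. (X i, X j, X k))) E = (\<integral>\<^sup>+ e. indicator E e \<partial>distr (PiM I (\<lambda>_. M)) ?T (\<lambda>X. (X i, X j, X k)))"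
    by simp
  also have "\<dots> = (\<integral>\<^sup>+ X. indicator E (X i, X j, X k) \<partial>PiM I (\<lambda>_. M))"
    using m by (subst nn_integral_distr) auto
  also have "\<dots> = (\<integral>\<^sup>+ X. indicator E (X i, X j, X k) \<partial>distr (PiM I (\<lambda>_. M)) (PiM ?J (\<lambda>_. M)) (\<lambda>X. restrict X ?J))"
    using assms mE by (subst nn_integral_distr) (auto intro!: measurable_restrict_subset)
  also have "distr (PiM I (\<lambda>_. M)) (PiM ?J (\<lambda>_. M)) (\<lambda>X. restrict X ?J) = PiM ?J (\<lambda>_. M)"
    using assms by (intro P.distr_PiM_restrict_finite) auto
  also have "(\<integral>\<^sup>+ X. indicator E (X i, X j, X k) \<partial>PiM ?J (\<lambda>_. M)) =
     (\<integral>\<^sup>+ x. \<integral>\<^sup>+ Y. indicator E (x, Y j, Y k) \<partial>PiM {j, k} (\<lambda>_. M) \<partial>M)"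
    using assms mE by (subst P.product_nn_integral_insert_rev) (auto simp: fun_upd_def)
  also have "\<dots> = (\<integral>\<^sup>+ x. \<integral>\<^sup>+ z. indicator E (x, z) \<partial>(M \<Otimes>\<^sub>M M) \<partial>M)"
  proof (rule nn_integral_cong)
    fix x assume x[measurable]: "x \<in> space M"
    have "(\<integral>\<^sup>+ z. indicator E (x, z) \<partial>(M \<Otimes>\<^sub>M M)) = (\<integral>\<^sup>+ z. indicator E (x, z) \<partial>distr (PiM {j, k} (\<lambda>_. M)) (M \<Otimes>\<^sub>M M) (\<lambda>X. (X j, X k)))"
      using assms by (subst distr_PiM_pair) auto
    also have "\<dots> = (\<integral>\<^sup>+ Y. indicator E (x, Y j, Y k) \<partial>PiM {j, k} (\<lambda>_. M))"
      by (subst nn_integral_distr) measurable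
    finally show "(\<integral>\<^sup>+ Y. indicator E (x, Y j, Y k) \<partial>PiM {j, k} (\<lambda>_. M)) = (\<integral>\<^sup>+ z. indicator E (x, z) \<partial>(M \<Otimes>\<^sub>M M))" by simp
  qed
  also have "\<dots> = emeasure ?T E" by (simp add: MM.emeasure_pair_measure)
  finally show "emeasure (distr (PiM I (\<lambda>_. M)) ?T (\<lambda>X. (X i, X j, X k))) E = emeasure ?T E" .
qed simp

section \<open>Quadratic forms of bounded kernels\<close>

lemma L2_triangle:
  fixes f g :: "'a \<Rightarrow> 'b::real_inner"
  assumes f: "integrable M (\<lambda>x. (norm (f x))\<^sup>2)" and g: "integrable M (\<lambda>x. (norm (g x))\<^sup>2)"
    and fg: "integrable M (\<lambda>x. f x \<bullet> g x)"
  shows "sqrt (\<integral>x. (norm (f x + g x))\<^sup>2 \<partial>M) \<le> sqrt (\<integral>x. (norm (f x))\<^sup>2 \<partial>M) + sqrt (\<integral>x. (norm (g x))\<^sup>2 \<partial>M)"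
proof -
  define a b c where "a = (\<integral>x. (norm (f x))\<^sup>2 \<partial>M)" and "b = (\<integral>x. (norm (g x))\<^sup>2 \<partial>M)" and "c = (\<integral>x. f x \<bullet> g x \<partial>M)"
  have eq: "(\<integral>x. (norm (s *\<^sub>R f x + t *\<^sub>R g x))\<^sup>2 \<partial>M) = s\<^sup>2 * a + 2 * s * t * c + t\<^sup>2 * b" for s t :: real
  proof -
    have "(\<integral>x. (norm (s *\<^sub>R f x + t *\<^sub>R g x))\<^sup>2 \<partial>M) = (\<integral>x. s\<^sup>2 * (norm (f x))\<^sup>2 + 2 * s * t * (f x \<bullet> g x) + t\<^sup>2 * (norm (g x))\<^sup>2 \<partial>M)"
      unfolding power2_norm_eq_inner
      by (simp add: inner_add_left inner_add_right inner_commute power2_eq_square algebra_simps)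
    also have "\<dots> = s\<^sup>2 * a + 2 * s * t * c + t\<^sup>2 * b" using f g fg by (simp add: a_def b_def c_def)
    finally show ?thesis .
  qed
  have a: "a \<ge> 0" and b: "b \<ge> 0" by (simp_all add: a_def b_def)
  have pos: "s\<^sup>2 * a + 2 * s * t * c + t\<^sup>2 * b \<ge> 0" for s t :: real
    unfolding eq[symmetric] by simp
  have c: "c \<le> sqrt a * sqrt b"
  proof (rule ccontr)
    assume "\<not> ?thesis"
    then have c: "c > sqrt a * sqrt b" by simp
    have c0: "c > 0" using c a b by (smt (verit) mult_nonneg_nonneg real_sqrt_ge_zero)
    have "(sqrt a * sqrt b)\<^sup>2 < c\<^sup>2" using c a b by (intro power_strict_mono) auto
    then have ab: "a * b < c\<^sup>2" using a b by (simp add: power_mult_distrib)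
    show False
    proof (cases "a = 0")
      case True
      have "2 * ((b + 1) / (2 * c)) * (-1) * c + b \<ge> 0"
        using pos[of "(b + 1) / (2 * c)" "-1"] True by simp
      moreover have "2 * ((b + 1) / (2 * c)) * (-1) * c = - (b + 1)" using c0 by (simp add: field_simps)
      ultimately show False by simp
    next
      case False
      have "c\<^sup>2 * a + 2 * c * (- a) * c + (- a)\<^sup>2 * b \<ge> 0" by (rule pos)
      then have "a * (a * b - c\<^sup>2) \<ge> 0" by (simp add: power2_eq_square algebra_simps)
      then show False using False a ab by (simp add: zero_le_mult_iff)
    qed
  qed
  have "(\<integral>x. (norm (f x + g x))\<^sup>2 \<partial>M) = a + 2 * c + b" using eq[of 1 1] by simp
  also have "\<dots> \<le> (sqrt a + sqrt b)\<^sup>2" using c a b by (simp add: power2_sum)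
  finally have "sqrt (\<integral>x. (norm (f x + g x))\<^sup>2 \<partial>M) \<le> sqrt ((sqrt a + sqrt b)\<^sup>2)" by (rule real_sqrt_le_mono)
  then show ?thesis using a b by (simp add: a_def b_def)
qed

definition bounded_kernel :: "'a measure \<Rightarrow> ('a \<Rightarrow> 'a \<Rightarrow> 'b::euclidean_space) \<Rightarrow> bool" where
  "bounded_kernel M F \<longleftrightarrow> (\<lambda>(x, y). F x y) \<in> borel_measurable (M \<Otimes>\<^sub>M M) \<and>
     (\<exists>K. \<forall>x\<in>space M. \<forall>y\<in>space M. norm (F x y) \<le> K)"

definition mean_sq :: "'a measure \<Rightarrow> ('a \<Rightarrow> 'a \<Rightarrow> 'b::euclidean_space) \<Rightarrow> real" where
  "mean_sq M F = (\<integral>x. (norm (\<integral>y. F x y \<partial>M))\<^sup>2 \<partial>M)"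

definition total_sq :: "'a measure \<Rightarrow> ('a \<Rightarrow> 'a \<Rightarrow> 'b::euclidean_space) \<Rightarrow> real" where
  "total_sq M F = (\<integral>(x, y). (norm (F x y))\<^sup>2 \<partial>(M \<Otimes>\<^sub>M M))"

lemma mean_sq_nonneg: "mean_sq M F \<ge> 0"
  unfolding mean_sq_def by simp

lemma (in prob_space) norm_integral_le_bound:
  fixes f :: "'a \<Rightarrow> 'b::euclidean_space"
  assumes "\<And>x. x \<in> space M \<Longrightarrow> norm (f x) \<le> K"
  shows "norm (\<integral>x. f x \<partial>M) \<le> K"
proof (cases "integrable M f")
  case True
  have "norm (\<integral>x. f x \<partial>M) \<le> (\<integral>x. norm (f x) \<partial>M)" by (rule integral_norm_bound)
  also have "\<dots> \<le> (\<integral>x. K \<partial>M)" using True assms by (intro integral_mono) auto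
  finally show ?thesis by (simp add: prob_space)
next
  case False
  obtain x where "x \<in> space M" using not_empty by blast
  then have "K \<ge> 0" using assms[of x] norm_ge_zero[of "f x"] by linarith
  then show ?thesis using False by (simp add: not_integrable_integral_eq)
qed

lemma (in prob_space) integrable_bounded:
  fixes f :: "'a \<Rightarrow> 'b::{banach, second_countable_topology}"
  assumes "f \<in> borel_measurable M" "\<And>x. x \<in> space M \<Longrightarrow> norm (f x) \<le> K"
  shows "integrable M f"
  using assms by (intro integrable_const_bound[of _ K]) auto

lemma (in prob_space) bounded_kernel_facts:
  fixes F :: "'a \<Rightarrow> 'a \<Rightarrow> 'b::euclidean_space"
  assumes F: "bounded_kernel M F"
  shows bounded_kernel_section: "\<And>x. x \<in> space M \<Longrightarrow> integrable M (F x)"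
    and bounded_kernel_mean_measurable: "(\<lambda>x. \<integral>y. F x y \<partial>M) \<in> borel_measurable M"
    and mean_sq_triple: "(\<integral>(x, y, z). F x y \<bullet> F x z \<partial>(M \<Otimes>\<^sub>M (M \<Otimes>\<^sub>M M))) = mean_sq M F"
    and mean_sq_le_total_sq: "mean_sq M F \<le> total_sq M F"
proof -
  interpret MM: pair_prob_space M M ..
  interpret MMM: pair_prob_space M "M \<Otimes>\<^sub>M M" ..
  obtain K where m[measurable]: "(\<lambda>(x, y). F x y) \<in> borel_measurable (M \<Otimes>\<^sub>M M)"
    and K: "\<And>x y. x \<in> space M \<Longrightarrow> y \<in> space M \<Longrightarrow> norm (F x y) \<le> K"
    using F unfolding bounded_kernel_def by blast
  have mc[measurable (raw)]: "(\<lambda>z. F (f z) (g z)) \<in> borel_measurable N"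
    if "f \<in> measurable N M" "g \<in> measurable N M" for N :: "'c measure" and f g
    using measurable_compose[OF measurable_Pair[OF that] m] by simp
  have mc2: "(\<lambda>z. F (fst z) (fst (snd z)) \<bullet> F (fst z) (snd (snd z))) \<in> borel_measurable (M \<Otimes>\<^sub>M (M \<Otimes>\<^sub>M M))"
    using m by (intro borel_measurable_inner) (auto intro!: measurable_compose[OF measurable_Pair m, simplified])
  show sec: "integrable M (F x)" if x: "x \<in> space M" for x
  proof (rule integrable_bounded[of _ K])
    show "F x \<in> borel_measurable M" using measurable_compose[OF measurable_Pair1'[OF x] m] by simp
  qed (use K x in auto)
  show meas: "(\<lambda>x. \<integral>y. F x y \<partial>M) \<in> borel_measurable M"
    using m by (rule borel_measurable_lebesgue_integral)
  have inner_int: "(\<integral>y. F x y \<bullet> v \<partial>M) = (\<integral>y. F x y \<partial>M) \<bullet> v" "(\<integral>y. v \<bullet> F x y \<partial>M) = v \<bullet> (\<integral>y. F x y \<partial>M)"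
    if "x \<in> space M" for x v
    using sec[OF that] by simp_all
  have mean_bd: "norm (\<integral>y. F x y \<partial>M) \<le> K" if "x \<in> space M" for x
    using K that by (intro norm_integral_le_bound) auto
  have sq_le: "(norm (F x y))\<^sup>2 \<le> K\<^sup>2" if "x \<in> space M" "y \<in> space M" for x y
    using K[OF that] by (intro power_mono) auto
  show "(\<integral>(x, y, z). F x y \<bullet> F x z \<partial>(M \<Otimes>\<^sub>M (M \<Otimes>\<^sub>M M))) = mean_sq M F"
  proof -
    let ?G = "\<lambda>z. F (fst z) (fst (snd z)) \<bullet> F (fst z) (snd (snd z))"
    have bd: "norm (F x y \<bullet> F x z) \<le> K * K" if "x \<in> space M" "y \<in> space M" "z \<in> space M" for x y z
    proof -
      have "norm (F x y \<bullet> F x z) \<le> norm (F x y) * norm (F x z)" using Cauchy_Schwarz_ineq2 by simp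
      also have "\<dots> \<le> K * K" using K that order_trans[OF norm_ge_zero K[OF that(1,2)]] by (intro mult_mono) auto
      finally show ?thesis .
    qed
    have "integrable (M \<Otimes>\<^sub>M (M \<Otimes>\<^sub>M M)) ?G"
      by (rule MMM.P.integrable_bounded[OF mc2, of "K * K"]) (use bd in \<open>auto simp: space_pair_measure\<close>)
    then have "integral\<^sup>L (M \<Otimes>\<^sub>M (M \<Otimes>\<^sub>M M)) ?G = (\<integral>x. \<integral>z. ?G (x, z) \<partial>(M \<Otimes>\<^sub>M M) \<partial>M)"
      by (rule MMM.integral_fst'[symmetric])
    also have "\<dots> = (\<integral>x. (norm (\<integral>y. F x y \<partial>M))\<^sup>2 \<partial>M)"
    proof (rule Bochner_Integration.integral_cong[OF refl])
      fix x assume x: "x \<in> space M"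
      have [measurable]: "F x \<in> borel_measurable M" using sec[OF x] by (rule borel_measurable_integrable)
      have "integrable (M \<Otimes>\<^sub>M M) (\<lambda>z. F x (fst z) \<bullet> F x (snd z))"
        by (rule MM.P.integrable_bounded[of _ "K * K"]) (use bd x in \<open>auto simp: space_pair_measure\<close>)
      then have "(\<integral>z. F x (fst z) \<bullet> F x (snd z) \<partial>(M \<Otimes>\<^sub>M M)) = (\<integral>y. \<integral>z. F x y \<bullet> F x z \<partial>M \<partial>M)"
        using MM.integral_fst' by fastforce
      also have "\<dots> = (norm (\<integral>y. F x y \<partial>M))\<^sup>2"
        by (simp add: inner_int[OF x] power2_norm_eq_inner)
      finally show "(\<integral>z. ?G (x, z) \<partial>(M \<Otimes>\<^sub>M M)) = (norm (\<integral>y. F x y \<partial>M))\<^sup>2" by simp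
    qed
    moreover have "(\<lambda>(x, y, z). F x y \<bullet> F x z) = ?G" by auto
    ultimately show ?thesis by (simp only: mean_sq_def)
  qed
  have int2: "integrable (M \<Otimes>\<^sub>M M) (\<lambda>z. (norm (F (fst z) (snd z)))\<^sup>2)"
    by (rule MM.P.integrable_bounded[of _ "K\<^sup>2"]) (use sq_le m in \<open>auto simp: space_pair_measure case_prod_beta\<close>)
  show "mean_sq M F \<le> total_sq M F"
  proof -
    have "total_sq M F = (\<integral>x. \<integral>y. (norm (F x y))\<^sup>2 \<partial>M \<partial>M)"
      unfolding total_sq_def case_prod_beta using MM.integral_fst'[OF int2] by simp
    moreover have "mean_sq M F \<le> (\<integral>x. \<integral>y. (norm (F x y))\<^sup>2 \<partial>M \<partial>M)"
      unfolding mean_sq_def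
    proof (rule integral_mono)
      show "integrable M (\<lambda>x. \<integral>y. (norm (F x y))\<^sup>2 \<partial>M)"
        using MM.integrable_fst'[OF int2] by simp
      show "integrable M (\<lambda>x. (norm (\<integral>y. F x y \<partial>M))\<^sup>2)"
        using meas mean_bd by (intro integrable_bounded[of _ "K\<^sup>2"]) (auto intro!: power_mono)
      fix x assume x: "x \<in> space M"
      define v where "v = (\<integral>y. F x y \<partial>M)"
      have [measurable]: "F x \<in> borel_measurable M" using sec[OF x] by (rule borel_measurable_integrable)
      have i: "integrable M (\<lambda>y. (norm (F x y))\<^sup>2)"
        by (rule integrable_bounded[of _ "K\<^sup>2"]) (use sq_le x in auto)
      have "0 \<le> (\<integral>y. (norm (F x y - v))\<^sup>2 \<partial>M)" by simp
      also have "\<dots> = (\<integral>y. (norm (F x y))\<^sup>2 - 2 * (v \<bullet> F x y) + (norm v)\<^sup>2 \<partial>M)"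
        unfolding power2_norm_eq_inner by (simp add: inner_diff_left inner_diff_right inner_commute algebra_simps)
      also have "\<dots> = (\<integral>y. (norm (F x y))\<^sup>2 \<partial>M) - (norm v)\<^sup>2"
        using i sec[OF x] by (simp add: prob_space v_def[symmetric] power2_norm_eq_inner[of v])
      finally show "(norm (\<integral>y. F x y \<partial>M))\<^sup>2 \<le> (\<integral>y. (norm (F x y))\<^sup>2 \<partial>M)" by (simp add: v_def)
    qed
    ultimately show ?thesis by simp
  qed
qed

lemma (in prob_space) total_sq_triangle:
  fixes F :: "'a \<Rightarrow> 'a \<Rightarrow> 'b::euclidean_space"
  assumes F: "bounded_kernel M F" and G: "bounded_kernel M G"
  shows "sqrt (total_sq M (\<lambda>x y. F x y + G x y)) \<le> sqrt (total_sq M F) + sqrt (total_sq M G)"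
proof -
  interpret MM: pair_prob_space M M ..
  obtain K where m[measurable]: "(\<lambda>z. F (fst z) (snd z)) \<in> borel_measurable (M \<Otimes>\<^sub>M M)"
    and K: "\<And>x y. x \<in> space M \<Longrightarrow> y \<in> space M \<Longrightarrow> norm (F x y) \<le> K"
    using F unfolding bounded_kernel_def case_prod_beta by blast
  obtain L where m'[measurable]: "(\<lambda>z. G (fst z) (snd z)) \<in> borel_measurable (M \<Otimes>\<^sub>M M)"
    and L: "\<And>x y. x \<in> space M \<Longrightarrow> y \<in> space M \<Longrightarrow> norm (G x y) \<le> L"
    using G unfolding bounded_kernel_def case_prod_beta by blast
  show ?thesis
    unfolding total_sq_def case_prod_beta
  proof (rule L2_triangle)
    show "integrable (M \<Otimes>\<^sub>M M) (\<lambda>x. (norm (F (fst x) (snd x)))\<^sup>2)"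
      by (rule MM.P.integrable_bounded[of _ "K\<^sup>2"]) (use K in \<open>auto simp: space_pair_measure intro!: power_mono\<close>)
    show "integrable (M \<Otimes>\<^sub>M M) (\<lambda>x. (norm (G (fst x) (snd x)))\<^sup>2)"
      by (rule MM.P.integrable_bounded[of _ "L\<^sup>2"]) (use L in \<open>auto simp: space_pair_measure intro!: power_mono\<close>)
    show "integrable (M \<Otimes>\<^sub>M M) (\<lambda>x. F (fst x) (snd x) \<bullet> G (fst x) (snd x))"
    proof (rule MM.P.integrable_bounded[of _ "K * L"])
      fix z assume "z \<in> space (M \<Otimes>\<^sub>M M)"
      then have s: "fst z \<in> space M" "snd z \<in> space M" by (auto simp: space_pair_measure)
      have "norm (F (fst z) (snd z) \<bullet> G (fst z) (snd z)) \<le> norm (F (fst z) (snd z)) * norm (G (fst z) (snd z))"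
        using Cauchy_Schwarz_ineq2 by simp
      also have "\<dots> \<le> K * L" using K[OF s] L[OF s] order_trans[OF norm_ge_zero K[OF s]] by (intro mult_mono) auto
      finally show "norm (F (fst z) (snd z) \<bullet> G (fst z) (snd z)) \<le> K * L" .
    qed measurable
  qed
qed

lemma (in prob_space) mean_sq_triangle:
  fixes F :: "'a \<Rightarrow> 'a \<Rightarrow> 'b::euclidean_space"
  assumes F: "bounded_kernel M F" and G: "bounded_kernel M G"
  shows "sqrt (mean_sq M (\<lambda>x y. F x y + G x y)) \<le> sqrt (mean_sq M F) + sqrt (mean_sq M G)"
proof -
  note [measurable] = bounded_kernel_mean_measurable[OF F] bounded_kernel_mean_measurable[OF G]
  obtain K where K: "\<And>x y. x \<in> space M \<Longrightarrow> y \<in> space M \<Longrightarrow> norm (F x y) \<le> K"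
    using F unfolding bounded_kernel_def by blast
  obtain L where L: "\<And>x y. x \<in> space M \<Longrightarrow> y \<in> space M \<Longrightarrow> norm (G x y) \<le> L"
    using G unfolding bounded_kernel_def by blast
  have K': "norm (\<integral>y. F x y \<partial>M) \<le> K" and L': "norm (\<integral>y. G x y \<partial>M) \<le> L" if "x \<in> space M" for x
    using K L that by (auto intro!: norm_integral_le_bound)
  have "mean_sq M (\<lambda>x y. F x y + G x y) = (\<integral>x. (norm ((\<integral>y. F x y \<partial>M) + (\<integral>y. G x y \<partial>M)))\<^sup>2 \<partial>M)"
    unfolding mean_sq_def
    by (rule Bochner_Integration.integral_cong) (auto simp: bounded_kernel_section[OF F] bounded_kernel_section[OF G])
  moreover have "sqrt (\<integral>x. (norm ((\<integral>y. F x y \<partial>M) + (\<integral>y. G x y \<partial>M)))\<^sup>2 \<partial>M) \<le> sqrt (mean_sq M F) + sqrt (mean_sq M G)"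
    unfolding mean_sq_def
  proof (rule L2_triangle)
    show "integrable M (\<lambda>x. (norm (\<integral>y. F x y \<partial>M))\<^sup>2)"
      by (rule integrable_bounded[of _ "K\<^sup>2"]) (use K' in \<open>auto intro!: power_mono\<close>)
    show "integrable M (\<lambda>x. (norm (\<integral>y. G x y \<partial>M))\<^sup>2)"
      by (rule integrable_bounded[of _ "L\<^sup>2"]) (use L' in \<open>auto intro!: power_mono\<close>)
    show "integrable M (\<lambda>x. (\<integral>y. F x y \<partial>M) \<bullet> (\<integral>y. G x y \<partial>M))"
    proof (rule integrable_bounded[of _ "K * L"])
      fix x assume s: "x \<in> space M"
      have "norm ((\<integral>y. F x y \<partial>M) \<bullet> (\<integral>y. G x y \<partial>M)) \<le> norm (\<integral>y. F x y \<partial>M) * norm (\<integral>y. G x y \<partial>M)"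
        using Cauchy_Schwarz_ineq2 by simp
      also have "\<dots> \<le> K * L" using K'[OF s] L'[OF s] order_trans[OF norm_ge_zero K'[OF s]] by (intro mult_mono) auto
      finally show "norm ((\<integral>y. F x y \<partial>M) \<bullet> (\<integral>y. G x y \<partial>M)) \<le> K * L" .
    qed measurable
  qed
  ultimately show ?thesis by simp
qed

lemma total_sq_scale: "total_sq M (\<lambda>x y. a *\<^sub>R F x y) = a\<^sup>2 * total_sq M F"
  unfolding total_sq_def case_prod_beta by (simp add: power_mult_distrib)

lemma mean_sq_scale: "mean_sq M (\<lambda>x y. a *\<^sub>R F x y) = a\<^sup>2 * mean_sq M F"
  unfolding mean_sq_def by (simp add: power_mult_distrib)

lemma (in prob_space) pairwise_energy:
  fixes F :: "'a \<Rightarrow> 'a \<Rightarrow> 'b::euclidean_space"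
  assumes F: "bounded_kernel M F" and diag: "\<And>x. x \<in> space M \<Longrightarrow> F x x = 0" and I: "finite I"
  shows "(\<integral>X. (\<Sum>i\<in>I. (norm (\<Sum>j\<in>I. F (X i) (X j)))\<^sup>2) \<partial>PiM I (\<lambda>_. M)) =
    real (card I) * (real (card I) - 1) * total_sq M F
    + real (card I) * (real (card I) - 1) * (real (card I) - 2) * mean_sq M F"
proof -
  interpret P: product_prob_space "\<lambda>_. M" I ..
  have PP: "prob_space (PiM I (\<lambda>_. M))" by (intro prob_space_PiM prob_space_axioms)
  obtain K where m[measurable]: "(\<lambda>(x, y). F x y) \<in> borel_measurable (M \<Otimes>\<^sub>M M)"
    and K: "\<And>x y. x \<in> space M \<Longrightarrow> y \<in> space M \<Longrightarrow> norm (F x y) \<le> K"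
    using F unfolding bounded_kernel_def by blast
  let ?P = "PiM I (\<lambda>_. M)"
  have sp: "X i \<in> space M" if "X \<in> space ?P" "i \<in> I" for X i using that by (auto simp: space_PiM)
  have mF: "(\<lambda>X. F (X i) (X j)) \<in> borel_measurable ?P" if "i \<in> I" "j \<in> I" for i j
  proof -
    have "(\<lambda>X. (X i, X j)) \<in> measurable ?P (M \<Otimes>\<^sub>M M)" using that by measurable
    from measurable_compose[OF this m] show ?thesis by simp
  qed
  have int: "integrable ?P (\<lambda>X. F (X i) (X j) \<bullet> F (X i) (X k))" if "i \<in> I" "j \<in> I" "k \<in> I" for i j k
  proof (rule prob_space.integrable_bounded[OF PP, of _ "K * K"])
    show "(\<lambda>X. F (X i) (X j) \<bullet> F (X i) (X k)) \<in> borel_measurable ?P"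
      using that by (intro borel_measurable_inner mF)
    fix X assume X: "X \<in> space ?P"
    have "norm (F (X i) (X j) \<bullet> F (X i) (X k)) \<le> norm (F (X i) (X j)) * norm (F (X i) (X k))"
      using Cauchy_Schwarz_ineq2 by simp
    also have "\<dots> \<le> K * K" using K[OF sp sp] X that order_trans[OF norm_ge_zero K[OF sp sp]] by (intro mult_mono) auto
    finally show "norm (F (X i) (X j) \<bullet> F (X i) (X k)) \<le> K * K" .
  qed
  have val: "(\<integral>X. F (X i) (X j) \<bullet> F (X i) (X k) \<partial>?P) = (if j = i \<or> k = i then 0 else if j = k then total_sq M F else mean_sq M F)"
    if ijk: "i \<in> I" "j \<in> I" "k \<in> I" for i j k
  proof -
    consider "j = i \<or> k = i" | "j \<noteq> i" "j = k" | "i \<noteq> j" "i \<noteq> k" "j \<noteq> k" by blast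
    then show ?thesis
    proof cases
      case 1
      then have "(\<integral>X. F (X i) (X j) \<bullet> F (X i) (X k) \<partial>?P) = (\<integral>X. 0 \<partial>?P)"
        using ijk by (intro Bochner_Integration.integral_cong) (auto simp: diag sp)
      then show ?thesis using 1 by simp
    next
      case 2
      have "(\<integral>X. F (X i) (X j) \<bullet> F (X i) (X k) \<partial>?P) = (\<integral>X. (\<lambda>(x, y). (norm (F x y))\<^sup>2) (X i, X j) \<partial>?P)"
        using 2 by (simp add: power2_norm_eq_inner)
      also have "\<dots> = (\<integral>z. (\<lambda>(x, y). (norm (F x y))\<^sup>2) z \<partial>distr ?P (M \<Otimes>\<^sub>M M) (\<lambda>X. (X i, X j)))"
        using ijk m by (subst integral_distr) (auto simp: case_prod_beta)
      also have "distr ?P (M \<Otimes>\<^sub>M M) (\<lambda>X. (X i, X j)) = M \<Otimes>\<^sub>M M" using ijk 2 I by (intro distr_PiM_pair) auto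
      finally show ?thesis using 2 by (simp add: total_sq_def)
    next
      case 3
      have m3: "(\<lambda>(x, y, z). F x y \<bullet> F x z) \<in> borel_measurable (M \<Otimes>\<^sub>M (M \<Otimes>\<^sub>M M))"
        unfolding case_prod_beta by (intro borel_measurable_inner measurable_compose[OF measurable_Pair m, simplified]) auto
      have "(\<integral>X. F (X i) (X j) \<bullet> F (X i) (X k) \<partial>?P) = (\<integral>X. (\<lambda>(x, y, z). F x y \<bullet> F x z) (X i, X j, X k) \<partial>?P)" by simp
      also have "\<dots> = (\<integral>z. (\<lambda>(x, y, z). F x y \<bullet> F x z) z \<partial>distr ?P (M \<Otimes>\<^sub>M (M \<Otimes>\<^sub>M M)) (\<lambda>X. (X i, X j, X k)))"
        using ijk m3 by (subst integral_distr) auto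
      also have "distr ?P (M \<Otimes>\<^sub>M (M \<Otimes>\<^sub>M M)) (\<lambda>X. (X i, X j, X k)) = M \<Otimes>\<^sub>M (M \<Otimes>\<^sub>M M)"
        using ijk 3 I by (intro distr_PiM_triple) auto
      finally show ?thesis using 3 mean_sq_triple[OF F] by simp
    qed
  qed
  have "(\<integral>X. (\<Sum>i\<in>I. (norm (\<Sum>j\<in>I. F (X i) (X j)))\<^sup>2) \<partial>?P) = (\<integral>X. (\<Sum>i\<in>I. \<Sum>j\<in>I. \<Sum>k\<in>I. F (X i) (X j) \<bullet> F (X i) (X k)) \<partial>?P)"
    by (simp only: power2_norm_eq_inner inner_sum_left) (simp only: inner_sum_right)
  also have "\<dots> = (\<Sum>i\<in>I. \<Sum>j\<in>I. \<Sum>k\<in>I. \<integral>X. F (X i) (X j) \<bullet> F (X i) (X k) \<partial>?P)"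
    using int by (simp add: Bochner_Integration.integral_sum)
  also have "\<dots> = (\<Sum>i\<in>I. \<Sum>j\<in>I. \<Sum>k\<in>I. if j = i \<or> k = i then 0 else if j = k then total_sq M F else mean_sq M F)"
    by (intro sum.cong refl val)
  also have "\<dots> = (\<Sum>i\<in>I. (real (card I) - 1) * (total_sq M F + (real (card I) - 2) * mean_sq M F))"
  proof (rule sum.cong[OF refl])
    fix i assume i: "i \<in> I"
    have "(\<Sum>j\<in>I. \<Sum>k\<in>I. if j = i \<or> k = i then 0 else if j = k then total_sq M F else mean_sq M F) =
      (\<Sum>j\<in>I - {i}. \<Sum>k\<in>I - {i}. if j = k then total_sq M F else mean_sq M F)"
      by (subst sum.remove[OF I i], simp, rule sum.cong[OF refl], subst sum.remove[OF I i]) (auto intro!: sum.cong)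
    also have "\<dots> = (\<Sum>j\<in>I - {i}. total_sq M F + (real (card I) - 2) * mean_sq M F)"
    proof (rule sum.cong[OF refl])
      fix j assume j: "j \<in> I - {i}"
      have "(\<Sum>k\<in>I - {i}. if j = k then total_sq M F else mean_sq M F) = total_sq M F + (\<Sum>k\<in>I - {i} - {j}. mean_sq M F)"
      proof -
        have "(\<Sum>k\<in>I - {i} - {j}. if j = k then total_sq M F else mean_sq M F) = (\<Sum>k\<in>I - {i} - {j}. mean_sq M F)"
          by (rule sum.cong) auto
        then show ?thesis using sum.remove[OF _ j, of "\<lambda>k. if j = k then total_sq M F else mean_sq M F"] I by simp
      qed
      also have "\<dots> = total_sq M F + real (card (I - {i} - {j})) * mean_sq M F" by simp
      also have "card (I - {i} - {j}) = card I - 2" using I i j by (simp add: card_Diff_subset)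
      also have "real (card I - 2) = real (card I) - 2"
      proof -
        have "card {i, j} \<le> card I" using I i j by (intro card_mono) auto
        moreover have "card {i, j} = 2" using j by auto
        ultimately show ?thesis by (simp add: of_nat_diff)
      qed
      finally show "(\<Sum>k\<in>I - {i}. if j = k then total_sq M F else mean_sq M F) = total_sq M F + (real (card I) - 2) * mean_sq M F" .
    qed
    also have "\<dots> = (real (card I) - 1) * (total_sq M F + (real (card I) - 2) * mean_sq M F)"
    proof -
      have "card I \<ge> 1" using i I card_gt_0_iff[of I] by (auto simp: Suc_le_eq)
      then show ?thesis using i I by (simp add: of_nat_diff)
    qed
    finally show "(\<Sum>j\<in>I. \<Sum>k\<in>I. if j = i \<or> k = i then 0 else if j = k then total_sq M F else mean_sq M F) =
      (real (card I) - 1) * (total_sq M F + (real (card I) - 2) * mean_sq M F)" .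
  qed
  finally show ?thesis by (simp add: algebra_simps)
qed

section \<open>The interaction kernel on a ball\<close>

lemma sinhc_measurable[measurable]: "f \<in> borel_measurable M \<Longrightarrow> (\<lambda>x. sinhc (f x) 1) \<in> borel_measurable M"
proof -
  assume [measurable]: "f \<in> borel_measurable M"
  have [measurable]: "(sinh :: real \<Rightarrow> real) \<in> borel_measurable borel"
    by (intro borel_measurable_continuous_onI continuous_intros)
  show ?thesis unfolding sinhc_def mult_1_right by measurable
qed

lemma hyp_cosh_measurable[measurable (raw)]:
  assumes [measurable]: "f \<in> borel_measurable M" "g \<in> borel_measurable M"
  shows "(\<lambda>z. hyp_cosh (f z) (g z)) \<in> borel_measurable M"
  unfolding hyp_cosh_def by measurable

lemma hyp_dist_measurable:
  assumes f: "f \<in> measurable M (restrict_space borel hyp_space)" and g: "g \<in> measurable M (restrict_space borel hyp_space)"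
  shows "(\<lambda>z. hyp_dist (f z) (g z)) \<in> borel_measurable M"
proof -
  have [measurable]: "f \<in> borel_measurable M" "g \<in> borel_measurable M"
    and s: "\<And>z. z \<in> space M \<Longrightarrow> f z \<in> hyp_space" "\<And>z. z \<in> space M \<Longrightarrow> g z \<in> hyp_space"
    using f g by (auto simp: measurable_restrict_space2_iff)
  have "(\<lambda>z. ln (hyp_cosh (f z) (g z) + sqrt ((hyp_cosh (f z) (g z))\<^sup>2 - 1))) \<in> borel_measurable M" by measurable
  then show ?thesis
    by (subst measurable_cong[where g = "\<lambda>z. ln (hyp_cosh (f z) (g z) + sqrt ((hyp_cosh (f z) (g z))\<^sup>2 - 1))"])
      (simp_all add: s hyp_dist_eq arcosh_real_def hyp_cosh_ge_1)
qed

lemma influence_eq_vector: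
  assumes "x \<in> hyp_space" "y \<in> hyp_space"
  shows "influence x y = (1 / sinhc (hyp_dist x y) 1) *\<^sub>R ((height x / height y) *\<^sub>R (y - x)
     + (height x * (hyp_cosh x y - height x / height y) - height x / height y * (height y - height x)) *\<^sub>R axis (Max UNIV) 1)"
  unfolding influence_eq[OF assms] hyp_dist_eq[OF assms] geod_log_def
  by (rule arg_cong[where f = "(*\<^sub>R) _"]) (auto simp: vec_eq_iff axis_def height_def)

lemma influence_measurable:
  fixes f g :: "'a \<Rightarrow> 'n::{finite,linorder} point"
  assumes f: "f \<in> measurable M (restrict_space borel hyp_space)" and g: "g \<in> measurable M (restrict_space borel hyp_space)"
  shows "(\<lambda>z. influence (f z) (g z)) \<in> borel_measurable M"
proof -
  have [measurable]: "f \<in> borel_measurable M" "g \<in> borel_measurable M"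
    and s: "\<And>z. z \<in> space M \<Longrightarrow> f z \<in> hyp_space" "\<And>z. z \<in> space M \<Longrightarrow> g z \<in> hyp_space"
    using f g by (auto simp: measurable_restrict_space2_iff)
  note [measurable] = hyp_dist_measurable[OF f g]
  show ?thesis by (subst measurable_cong[OF influence_eq_vector[OF s]]) measurable
qed

definition kern :: "(real \<Rightarrow> real) \<Rightarrow> 'n::{finite,linorder} point \<Rightarrow> 'n point \<Rightarrow> 'n point" where
  "kern \<phi> x y = (\<phi> (hyp_dist x y) / height x) *\<^sub>R influence x y"

lemma norm_kern:
  assumes "x \<in> hyp_space" "y \<in> hyp_space"
  shows "norm (kern \<phi> x y) = \<bar>\<phi> (hyp_dist x y)\<bar> * hyp_dist x y"
  using assms by (simp add: kern_def influence_eq norm_geod_log hyp_dist_eq hyp_space_def)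

lemma kern_self: "x \<in> hyp_space \<Longrightarrow> kern \<phi> x x = 0"
  using norm_kern[of x x \<phi>] by (simp add: hyp_dist_eq hyp_cosh_def)

lemma kern_add: "kern (\<lambda>r. \<phi> r + \<psi> r) = (\<lambda>x y. kern \<phi> x y + kern \<psi> x y)"
  by (intro ext) (simp add: kern_def add_divide_distrib scaleR_add_left)

lemma kern_scale: "kern (\<lambda>r. a * \<phi> r) = (\<lambda>x y. a *\<^sub>R kern \<phi> x y)"
  by (intro ext) (simp add: kern_def)

definition nice_function :: "real \<Rightarrow> (real \<Rightarrow> real) \<Rightarrow> bool" where
  "nice_function R \<phi> \<longleftrightarrow> \<phi> \<in> borel_measurable borel \<and> (\<exists>K. \<forall>r. \<bar>\<phi> r\<bar> \<le> K) \<and> (\<forall>r. r \<notin> {0..2 * R} \<longrightarrow> \<phi> r = 0)"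

lemma admissible_nice:
  assumes "\<phi> \<in> admissible_functions R"
  shows "nice_function R \<phi>"
proof -
  have z: "\<phi> r = 0" if "r \<notin> {0..2 * R}" for r using assms that by (auto simp: admissible_functions_def)
  have c: "continuous_on {0..2 * R} \<phi>" using assms by (auto simp: admissible_functions_def)
  have "(\<lambda>r. if r \<in> {0..2 * R} then \<phi> r else 0) \<in> borel_measurable borel"
    using c by (intro borel_measurable_continuous_on_if) auto
  moreover have "(\<lambda>r. if r \<in> {0..2 * R} then \<phi> r else 0) = \<phi>" using z by auto
  moreover have "\<exists>K. \<forall>r. \<bar>\<phi> r\<bar> \<le> K"
  proof -
    have "bounded (\<phi> ` {0..2 * R})" by (intro compact_imp_bounded compact_continuous_image c) auto
    then obtain K where K: "\<forall>r\<in>{0..2 * R}. \<bar>\<phi> r\<bar> \<le> K" unfolding bounded_iff by auto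
    have "\<bar>\<phi> r\<bar> \<le> max K 0" for r using K z[of r] by (cases "r \<in> {0..2 * R}") (auto simp: le_max_iff_disj)
    then show ?thesis by blast
  qed
  ultimately show ?thesis using z unfolding nice_function_def by auto
qed

lemma triple_expectation_kern:
  "triple_expectation p R \<phi> = (let U = uniform_measure hyp_volume (hyp_ball p R) in
     \<integral>(x, y, z). kern \<phi> x y \<bullet> kern \<phi> x z \<partial>(U \<Otimes>\<^sub>M (U \<Otimes>\<^sub>M U)))"
  unfolding triple_expectation_def hyp_metric_def kern_def by (simp add: power2_eq_square mult_ac)

lemma prod_inner_interaction_field:
  "prod_inner N X (interaction_field N \<phi> X) (interaction_field N \<phi> X) =
    (1 / real N) ^ 3 * (\<Sum>i\<in>{1..N}. (norm (\<Sum>j\<in>{1..N}. kern \<phi> (X i) (X j)))\<^sup>2)"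
proof -
  have "hyp_metric (X i) (interaction_field N \<phi> X i) (interaction_field N \<phi> X i) =
    (1 / real N)\<^sup>2 * (norm (\<Sum>j\<in>{1..N}. kern \<phi> (X i) (X j)))\<^sup>2" for i
  proof -
    have "(\<Sum>j\<in>{1..N}. kern \<phi> (X i) (X j)) =
        (1 / height (X i)) *\<^sub>R (\<Sum>j\<in>{1..N}. \<phi> (hyp_dist (X i) (X j)) *\<^sub>R influence (X i) (X j))"
      by (simp add: kern_def scaleR_sum_right divide_inverse mult.commute)
    then show ?thesis
      unfolding hyp_metric_def interaction_field_def power2_norm_eq_inner
      by (simp only:) (simp add: power2_eq_square)
  qed
  then show ?thesis unfolding prod_inner_def
    by (simp add: sum_distrib_left power2_eq_square power3_eq_cube mult.assoc)
qed

locale hyp_ball_model =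
  fixes p :: "'n::{finite,linorder} point" and R :: real
  assumes p: "p \<in> hyp_space" and R: "R > 0"
begin

definition U :: "'n point measure" where "U = uniform_measure hyp_volume (hyp_ball p R)"

lemma ball_sets: "hyp_ball p R \<in> sets hyp_volume"
  using open_hyp_ball[OF p R] by (intro in_sets_hyp_volume) (auto simp: hyp_ball_def)

lemma p_in_ball: "p \<in> hyp_ball p R"
  using p R by (simp add: hyp_ball_def hyp_dist_eq hyp_cosh_def)

lemma vol_ball: "emeasure hyp_volume (hyp_ball p R) \<noteq> 0" "emeasure hyp_volume (hyp_ball p R) \<noteq> \<infinity>"
proof -
  have "emeasure hyp_volume (hyp_ball p R) > 0"
    using p_in_ball by (intro emeasure_hyp_volume_open open_hyp_ball p R) (auto simp: hyp_ball_def)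
  then show "emeasure hyp_volume (hyp_ball p R) \<noteq> 0" by simp
  show "emeasure hyp_volume (hyp_ball p R) \<noteq> \<infinity>" using emeasure_hyp_ball_finite[OF p R] by simp
qed

sublocale U: prob_space U
  unfolding U_def by (rule prob_space_uniform_measure[OF vol_ball])

sublocale UU: pair_prob_space U U ..

lemma space_U[simp]: "space U = hyp_space" by (simp add: U_def)

lemma sets_U[measurable_cong]: "sets U = sets (restrict_space borel hyp_space)"
  by (simp add: U_def sets_hyp_volume)

lemma space_UU: "space (U \<Otimes>\<^sub>M U) = hyp_space \<times> hyp_space" by (simp add: space_pair_measure)

lemma proj_measurable:
  "fst \<in> measurable (U \<Otimes>\<^sub>M U) (restrict_space borel hyp_space)"
  "snd \<in> measurable (U \<Otimes>\<^sub>M U) (restrict_space borel hyp_space)"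
  by (subst measurable_cong_sets[OF refl sets_U[symmetric]], measurable)+

lemma dist_measurable[measurable]: "(\<lambda>z. hyp_dist (fst z) (snd z)) \<in> borel_measurable (U \<Otimes>\<^sub>M U)"
  by (rule hyp_dist_measurable[OF proj_measurable])

lemma bounded_kernel_kern:
  assumes "nice_function R \<phi>"
  shows "bounded_kernel U (kern \<phi> :: 'n point \<Rightarrow> _)"
proof -
  have [measurable]: "\<phi> \<in> borel_measurable borel" and z: "\<And>r. r \<notin> {0..2 * R} \<Longrightarrow> \<phi> r = 0"
    using assms by (auto simp: nice_function_def)
  obtain K where K: "\<And>r. \<bar>\<phi> r\<bar> \<le> K" using assms by (auto simp: nice_function_def)
  have K0: "K \<ge> 0" using K[of 0] by linarith
  note [measurable] = influence_measurable[OF proj_measurable]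
  have [measurable]: "fst \<in> borel_measurable (U \<Otimes>\<^sub>M U)"
    using proj_measurable(1) by (simp add: measurable_restrict_space2_iff)
  have "(\<lambda>z. kern \<phi> (fst z) (snd z)) \<in> borel_measurable (U \<Otimes>\<^sub>M U)"
    unfolding kern_def by measurable
  moreover have "norm (kern \<phi> x y) \<le> K * (2 * R)" if "x \<in> space U" "y \<in> space U" for x y
  proof (cases "hyp_dist x y \<in> {0..2 * R}")
    case True
    then show ?thesis using that K[of "hyp_dist x y"] K0 by (auto simp: norm_kern intro!: mult_mono)
  next
    case False
    then show ?thesis using that K0 R by (simp add: norm_kern z)
  qed
  ultimately show ?thesis unfolding bounded_kernel_def by (auto simp: case_prod_beta)
qed

lemma triple_expectation_eq:
  assumes "nice_function R \<phi>"
  shows "triple_expectation p R \<phi> = mean_sq U (kern \<phi>)"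
  using U.mean_sq_triple[OF bounded_kernel_kern[OF assms]]
  by (simp add: triple_expectation_kern Let_def flip: U_def)

lemma config_measure_U: "config_measure p R N = PiM {1..N} (\<lambda>_. U)"
  unfolding U_def by (rule config_measure_eq[OF p R])

lemma field_L2_norm_eq:
  assumes "nice_function R \<phi>" "N \<ge> 1"
  shows "(field_L2_norm N (config_measure p R N) (interaction_field N \<phi>))\<^sup>2 =
    (real N - 1) / (real N)\<^sup>2 * total_sq U (kern \<phi>) + (real N - 1) * (real N - 2) / (real N)\<^sup>2 * mean_sq U (kern \<phi>)"
proof -
  let ?I = "\<integral>X. prod_inner N X (interaction_field N \<phi> X) (interaction_field N \<phi> X) \<partial>config_measure p R N"
  have "?I = (1 / real N) ^ 3 * (\<integral>X. (\<Sum>i\<in>{1..N}. (norm (\<Sum>j\<in>{1..N}. kern \<phi> (X i) (X j)))\<^sup>2) \<partial>PiM {1..N} (\<lambda>_. U))"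
    unfolding prod_inner_interaction_field config_measure_U by simp
  also have "\<dots> = (1 / real N) ^ 3 * (real N * (real N - 1) * total_sq U (kern \<phi>)
      + real N * (real N - 1) * (real N - 2) * mean_sq U (kern \<phi>))"
  proof -
    have "\<And>x. x \<in> space U \<Longrightarrow> kern \<phi> x x = 0" by (simp add: kern_self)
    from U.pairwise_energy[OF bounded_kernel_kern[OF assms(1)] this, of "{1..N}"] show ?thesis by simp
  qed
  also have "\<dots> = (real N - 1) / (real N)\<^sup>2 * total_sq U (kern \<phi>) + (real N - 1) * (real N - 2) / (real N)\<^sup>2 * mean_sq U (kern \<phi>)"
    using assms(2) by (simp add: power2_eq_square power3_eq_cube field_simps)
  finally have eq: "?I = \<dots>" .
  have "?I \<ge> 0"
    unfolding prod_inner_interaction_field by (intro Bochner_Integration.integral_nonneg) (auto intro!: mult_nonneg_nonneg sum_nonneg)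
  then show ?thesis unfolding field_L2_norm_def by (simp add: eq)
qed

lemma rho_measure_eq:
  assumes N: "N \<ge> 2"
  shows "rho_measure p R N = distr (density (U \<Otimes>\<^sub>M U) (\<lambda>z. ennreal ((hyp_dist (fst z) (snd z))\<^sup>2)))
     (restrict_space borel {0..}) (\<lambda>z. hyp_dist (fst z) (snd z))"
    (is "_ = ?D")
proof -
  let ?RB = "restrict_space borel {0::real..}"
  let ?g = "\<lambda>z :: 'n point \<times> 'n point. hyp_dist (fst z) (snd z)"
  have mg: "?g \<in> measurable (U \<Otimes>\<^sub>M U) ?RB"
    by (intro measurable_restrict_space2 dist_measurable) (auto simp: space_UU hyp_dist_nonneg)
  have eq: "ennreal (1 / (real N * (real N - 1))) *
        (\<Sum>(i, j) \<in> {(i, j). i \<in> {1..N} \<and> j \<in> {1..N} \<and> i \<noteq> j}.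
           \<integral>\<^sup>+ X \<in> (\<lambda>X. hyp_dist (X i) (X j)) -` B. ennreal ((hyp_dist (X i) (X j))\<^sup>2)
             \<partial>config_measure p R N) = emeasure ?D B"
    if B: "B \<in> sets ?RB" for B
  proof -
    have B'[measurable]: "B \<in> sets borel" using B by (auto simp: sets_restrict_space)
    have D: "emeasure ?D B = (\<integral>\<^sup>+ z. ennreal ((?g z)\<^sup>2) * indicator B (?g z) \<partial>(U \<Otimes>\<^sub>M U))"
    proof -
      have "emeasure ?D B = emeasure (density (U \<Otimes>\<^sub>M U) (\<lambda>z. ennreal ((?g z)\<^sup>2))) (?g -` B \<inter> space (U \<Otimes>\<^sub>M U))"
        using mg B by (subst emeasure_distr) (auto simp: measurable_density_eq1)
      also have "\<dots> = (\<integral>\<^sup>+ z. ennreal ((?g z)\<^sup>2) * indicator (?g -` B \<inter> space (U \<Otimes>\<^sub>M U)) z \<partial>(U \<Otimes>\<^sub>M U))"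
        using measurable_sets[OF mg B] by (intro emeasure_density) auto
      also have "\<dots> = (\<integral>\<^sup>+ z. ennreal ((?g z)\<^sup>2) * indicator B (?g z) \<partial>(U \<Otimes>\<^sub>M U))"
        by (intro nn_integral_cong) (auto simp: indicator_def)
      finally show ?thesis .
    qed
    have each: "(\<integral>\<^sup>+ X \<in> (\<lambda>X. hyp_dist (X i) (X j)) -` B. ennreal ((hyp_dist (X i) (X j))\<^sup>2) \<partial>config_measure p R N) = emeasure ?D B"
      if "i \<in> {1..N}" "j \<in> {1..N}" "i \<noteq> j" for i j
    proof -
      have m: "(\<lambda>X. (X i, X j)) \<in> measurable (PiM {1..N} (\<lambda>_. U)) (U \<Otimes>\<^sub>M U)" using that by measurable
      have "(\<integral>\<^sup>+ X \<in> (\<lambda>X. hyp_dist (X i) (X j)) -` B. ennreal ((hyp_dist (X i) (X j))\<^sup>2) \<partial>config_measure p R N) =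
        (\<integral>\<^sup>+ X. (\<lambda>z. ennreal ((?g z)\<^sup>2) * indicator B (?g z)) (X i, X j) \<partial>PiM {1..N} (\<lambda>_. U))"
        unfolding config_measure_U by (intro nn_integral_cong) (auto simp: indicator_def)
      also have "\<dots> = (\<integral>\<^sup>+ z. ennreal ((?g z)\<^sup>2) * indicator B (?g z) \<partial>distr (PiM {1..N} (\<lambda>_. U)) (U \<Otimes>\<^sub>M U) (\<lambda>X. (X i, X j)))"
        using m by (subst nn_integral_distr) auto
      also have "distr (PiM {1..N} (\<lambda>_. U)) (U \<Otimes>\<^sub>M U) (\<lambda>X. (X i, X j)) = U \<Otimes>\<^sub>M U"
        using that by (intro U.distr_PiM_pair) auto
      finally show ?thesis unfolding D .
    qed
    let ?S = "{(i, j). i \<in> {1..N} \<and> j \<in> {1..N} \<and> i \<noteq> j}"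
    have S: "?S = (SIGMA i:{1..N}. {1..N} - {i})" by auto
    have "card ?S = N * (N - 1)" unfolding S by (subst card_SigmaI) auto
    then have "(\<Sum>(i, j) \<in> ?S. \<integral>\<^sup>+ X \<in> (\<lambda>X. hyp_dist (X i) (X j)) -` B. ennreal ((hyp_dist (X i) (X j))\<^sup>2)
             \<partial>config_measure p R N) = of_nat (N * (N - 1)) * emeasure ?D B"
      using each by (subst sum.cong[OF refl, where h = "\<lambda>_. emeasure ?D B"]) auto
    moreover have "ennreal (1 / (real N * (real N - 1))) * of_nat (N * (N - 1)) = 1"
    proof -
      have "of_nat (N * (N - 1)) = ennreal (real N * (real N - 1))"
        using N by (simp add: ennreal_of_nat_eq_real_of_nat of_nat_diff)
      then show ?thesis using N by (simp flip: ennreal_mult')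
    qed
    ultimately show ?thesis by (simp only: mult.assoc[symmetric] mult_1_left)
  qed
  have "rho_measure p R N = measure_of {0..} (sets ?RB) (emeasure ?D)"
    unfolding rho_measure_def
  proof (rule measure_of_eq)
    show "sets ?RB \<subseteq> Pow {0..}" using sets.space_closed[of ?RB] by (simp add: space_restrict_space)
    fix B assume "B \<in> sigma_sets {0..} (sets ?RB)"
    then have "B \<in> sets ?RB" using sets.sigma_sets_eq[of ?RB] by (simp add: space_restrict_space)
    then show "ennreal (1 / (real N * (real N - 1))) *
        (\<Sum>(i, j) \<in> {(i, j). i \<in> {1..N} \<and> j \<in> {1..N} \<and> i \<noteq> j}.
           \<integral>\<^sup>+ X \<in> (\<lambda>X. hyp_dist (X i) (X j)) -` B. ennreal ((hyp_dist (X i) (X j))\<^sup>2)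
             \<partial>config_measure p R N) = emeasure ?D B" by (rule eq)
  qed
  also have "\<dots> = ?D" using measure_of_of_measure[of ?D] by (simp add: space_restrict_space)
  finally show ?thesis .
qed

lemma L2_norm_eq:
  assumes "N \<ge> 2" and nice: "nice_function R \<phi>"
  shows "L2_norm R (rho_measure p R N) \<phi> = sqrt (total_sq U (kern \<phi>))"
proof -
  have [measurable]: "\<phi> \<in> borel_measurable borel" and z: "\<And>r. r \<notin> {0..2 * R} \<Longrightarrow> \<phi> r = 0"
    using nice by (auto simp: nice_function_def)
  let ?RB = "restrict_space borel {0::real..}" and ?\<rho> = "rho_measure p R N"
  let ?g = "\<lambda>z :: 'n point \<times> 'n point. hyp_dist (fst z) (snd z)"
  have mg: "?g \<in> measurable (U \<Otimes>\<^sub>M U) ?RB"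
    by (intro measurable_restrict_space2 dist_measurable) (auto simp: space_UU hyp_dist_nonneg)
  have sets: "sets ?\<rho> = sets ?RB" and sp: "space ?\<rho> = {0..}"
    unfolding rho_measure_eq[OF assms(1)] by (auto simp: space_restrict_space)
  have "(\<integral>r. (\<phi> r)\<^sup>2 \<partial>restrict_space ?\<rho> {0..2 * R}) = (\<integral>r. indicator {0..2 * R} r *\<^sub>R (\<phi> r)\<^sup>2 \<partial>?\<rho>)"
  proof (rule integral_restrict_space)
    have "{0..2 * R} \<inter> space ?\<rho> = {0..} \<inter> {0..2 * R}" by (auto simp: sp)
    moreover have "{0..} \<inter> {0..2 * R} \<in> sets ?RB" unfolding sets_restrict_space by (rule imageI) simp
    ultimately show "{0..2 * R} \<inter> space ?\<rho> \<in> sets ?\<rho>" by (simp only: sets)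
  qed
  also have "\<dots> = (\<integral>r. (\<phi> r)\<^sup>2 \<partial>?\<rho>)"
  proof (rule Bochner_Integration.integral_cong[OF refl])
    show "indicator {0..2 * R} r *\<^sub>R (\<phi> r)\<^sup>2 = (\<phi> r)\<^sup>2" for r using z[of r] by (cases "r \<in> {0..2 * R}") auto
  qed
  also have "\<dots> = (\<integral>z. (\<phi> (?g z))\<^sup>2 \<partial>density (U \<Otimes>\<^sub>M U) (\<lambda>z. ennreal ((?g z)\<^sup>2)))"
    unfolding rho_measure_eq[OF assms(1)] using mg
    by (subst integral_distr) (auto intro!: measurable_restrict_space1)
  also have "\<dots> = (\<integral>z. (?g z)\<^sup>2 *\<^sub>R (\<phi> (?g z))\<^sup>2 \<partial>(U \<Otimes>\<^sub>M U))"
    by (subst integral_density) auto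
  also have "\<dots> = (\<integral>z. (norm (kern \<phi> (fst z) (snd z)))\<^sup>2 \<partial>(U \<Otimes>\<^sub>M U))"
    by (rule Bochner_Integration.integral_cong) (auto simp: space_UU norm_kern power_mult_distrib)
  finally show ?thesis unfolding L2_norm_def total_sq_def case_prod_beta by simp
qed

end

section \<open>Reflections and semicircular geodesics\<close>

lemma admissible_constant_sign:
  assumes adm: "\<phi> \<in> admissible_functions R" and nz: "\<phi> \<noteq> (\<lambda>_. 0)" and R: "R > 0"
  obtains a b s :: real where "0 \<le> b" "b < a" "a < R" "\<And>r. r \<ge> a \<Longrightarrow> \<phi> r = 0"
    "\<bar>s\<bar> = 1" "\<And>r. b \<le> r \<Longrightarrow> r < a \<Longrightarrow> s * \<phi> r > 0"
proof -
  define S where "S = {r. \<phi> r \<noteq> 0}"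
  have cont: "continuous_on {0..2 * R} \<phi>" and sub: "closure S \<subseteq> {0..<R}"
    and fin: "finite {r \<in> closure S. \<phi> r = 0}"
    using adm by (auto simp: admissible_functions_def S_def)
  have S0: "S \<noteq> {}" using nz by (auto simp: S_def)
  have SR: "S \<subseteq> {0..<R}" using sub closure_subset by blast
  then have bdd: "bdd_above S" by (auto intro!: bdd_aboveI[of _ R])
  define a where "a = Sup S"
  have acl: "a \<in> closure S" unfolding a_def by (rule closure_contains_Sup[OF S0 bdd])
  have aR: "0 \<le> a" "a < R" using acl sub by auto
  have above: "\<phi> r = 0" if "r > a" for r
    using cSup_upper[OF _ bdd, of r] that by (auto simp: S_def a_def)
  have closed0: "closed {r \<in> {c..d}. \<phi> r = 0}" if "0 \<le> c" "d \<le> 2 * R" for c d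
    using that by (intro continuous_closed_preimage_constant continuous_on_subset[OF cont]) auto
  have a0: "\<phi> a = 0"
  proof -
    have "closure {a<..<2 * R} \<subseteq> {r \<in> {0..2 * R}. \<phi> r = 0}"
      using aR above by (intro closure_minimal closed0) auto
    moreover have "a \<in> closure {a<..<2 * R}" using aR by simp
    ultimately show ?thesis by blast
  qed
  define Z where "Z = insert 0 {r \<in> closure S. \<phi> r = 0 \<and> r < a}"
  have finZ: "finite Z" unfolding Z_def using fin by (auto intro: rev_finite_subset)
  have apos: "a > 0"
  proof -
    obtain r where r: "r \<in> S" using S0 by blast
    then have "r \<le> a" "r \<noteq> a" using cSup_upper[OF r bdd] a0 by (auto simp: a_def S_def)
    then show ?thesis using SR r by force
  qed
  have "Max Z < a" using finZ apos by (subst Max_less_iff) (auto simp: Z_def)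
  then obtain b where b: "b \<in> S" "Max Z < b" using less_cSup_iff[OF S0 bdd, of "Max Z"] by (auto simp: a_def)
  have Zb: "z < b" if "z \<in> Z" for z using Max_ge[OF finZ that] b by linarith
  have b0: "b > 0" using Zb[of 0] by (simp add: Z_def)
  have "b \<le> a" using cSup_upper[OF b(1) bdd] by (simp add: a_def)
  then have ba: "b < a" using b(1) a0 by (cases "b = a") (auto simp: S_def)
  have nonzero: "\<phi> t \<noteq> 0" if t: "b \<le> t" "t < a" for t
  proof
    assume zt: "\<phi> t = 0"
    define W where "W = {r \<in> {b..t}. \<phi> r = 0}"
    have "closed W" unfolding W_def by (rule closed0) (use t b0 aR in auto)
    moreover have "W \<noteq> {}" "bdd_below W" unfolding W_def using t zt by (auto intro!: bdd_belowI[of _ b])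
    ultimately have W: "closed W" "W \<noteq> {}" "bdd_below W" .
    define t0 where "t0 = Inf W"
    have t0W: "t0 \<in> W" unfolding t0_def by (rule closed_contains_Inf[OF W(2,3,1)])
    then have t0: "b \<le> t0" "t0 \<le> t" "\<phi> t0 = 0" by (auto simp: W_def)
    then have "b < t0" using b(1) by (cases "b = t0") (auto simp: S_def)
    moreover have "{b<..<t0} \<subseteq> S"
    proof
      fix r assume r: "r \<in> {b<..<t0}"
      then have "r \<notin> W" using cInf_lower[OF _ W(3), of r] by (auto simp: t0_def)
      then show "r \<in> S" using r t0 by (auto simp: W_def S_def)
    qed
    ultimately have "t0 \<in> closure S" using closure_mono[of "{b<..<t0}" S] by auto
    then have "t0 \<in> Z" using t0 t by (auto simp: Z_def)
    then show False using Zb[of t0] t0 by simp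
  qed
  define s where "s = sgn (\<phi> b)"
  have bS: "\<phi> b \<noteq> 0" using nonzero[of b] ba by simp
  have s: "\<bar>s\<bar> = 1" using bS by (simp add: s_def abs_sgn_eq)
  have sign: "s * \<phi> r > 0" if r: "b \<le> r" "r < a" for r
  proof (rule ccontr)
    assume neg: "\<not> s * \<phi> r > 0"
    have c: "continuous_on {b..r} (\<lambda>x. s * \<phi> x)"
      using r b0 aR by (intro continuous_intros continuous_on_subset[OF cont]) auto
    have "s * \<phi> b \<ge> 0" by (simp add: s_def sgn_if)
    then obtain t where "b \<le> t" "t \<le> r" "s * \<phi> t = 0"
      using IVT2'[OF _ _ r(1) c, of 0] neg by auto
    then show False using nonzero[of t] r s by auto
  qed
  show ?thesis
  proof (rule that[of b a s])
    show "\<phi> r = 0" if "r \<ge> a" for r using that above[of r] a0 by (cases "r = a") auto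
  qed (use b0 ba aR s sign in auto)
qed

lemma admissible_continuous:
  assumes adm: "\<phi> \<in> admissible_functions R" and R: "R > 0"
  shows "continuous_on {0..} \<phi>"
proof -
  have c: "continuous_on {0..2 * R} \<phi>" and z: "\<And>r. r \<ge> R \<Longrightarrow> \<phi> r = 0"
  proof -
    show "continuous_on {0..2 * R} \<phi>" using adm by (auto simp: admissible_functions_def)
    fix r :: real assume r: "r \<ge> R"
    show "\<phi> r = 0"
    proof (rule ccontr)
      assume "\<phi> r \<noteq> 0"
      then have "r \<in> closure {r. \<phi> r \<noteq> 0}" by (intro subsetD[OF closure_subset]) simp
      moreover have "closure {r. \<phi> r \<noteq> 0} \<subseteq> {0..<R}" using adm by (simp add: admissible_functions_def)
      ultimately show False using r by auto
    qed
  qed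
  have "continuous_on {2 * R..} (\<lambda>_. 0 :: real)" by simp
  then have "continuous_on {2 * R..} \<phi>"
    by (rule continuous_on_eq) (use z R in auto)
  then have "continuous_on ({0..2 * R} \<union> {2 * R..}) \<phi>" using c by (intro continuous_on_closed_Un) auto
  moreover have "{0..2 * R} \<union> {2 * R..} = {0..}" using R by auto
  ultimately show ?thesis by simp
qed

definition refl_coord :: "'n::finite \<Rightarrow> real \<Rightarrow> (real, 'n) vec \<Rightarrow> (real, 'n) vec" where
  "refl_coord k c y = y + (2 * (c - y $ k)) *\<^sub>R axis k 1"

lemma refl_coord_nth: "refl_coord k c y $ i = (if i = k then 2 * c - y $ k else y $ i)"
  by (simp add: refl_coord_def axis_def)

lemma height_refl_coord: "k \<noteq> Max UNIV \<Longrightarrow> height (refl_coord k c y) = height y"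
  by (simp add: height_def refl_coord_nth)

lemma refl_coord_hyp_space: "k \<noteq> Max UNIV \<Longrightarrow> refl_coord k c y \<in> hyp_space \<longleftrightarrow> y \<in> hyp_space"
  by (simp add: hyp_space_def height_refl_coord)

lemma refl_coord_refl_coord: "refl_coord k c (refl_coord k c y) = y"
  by (simp add: vec_eq_iff refl_coord_nth)

lemma continuous_on_refl_coord: "continuous_on A (refl_coord k c)"
  unfolding refl_coord_def by (intro continuous_intros)

lemma refl_coord_measurable[measurable]: "refl_coord k c \<in> borel_measurable borel"
  by (intro borel_measurable_continuous_onI continuous_on_refl_coord)

lemma hyp_cosh_refl_coord:
  assumes "k \<noteq> Max UNIV" "x \<in> hyp_space" "y \<in> hyp_space"
  shows "hyp_cosh x (refl_coord k c y) = hyp_cosh x y + 2 * (c - x $ k) * (c - y $ k) / (height x * height y)"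
proof -
  have "(norm (x - refl_coord k c y))\<^sup>2 = (norm (x - y))\<^sup>2 + 4 * (c - x $ k) * (c - y $ k)"
  proof -
    have "(norm (x - refl_coord k c y))\<^sup>2 = (norm (x - y))\<^sup>2 - 4 * (c - y $ k) * (x $ k - y $ k) + (2 * (c - y $ k))\<^sup>2"
      unfolding power2_norm_eq_inner refl_coord_def
      by (simp add: inner_diff_left inner_diff_right inner_add_left inner_add_right inner_axis inner_axis' inner_axis_axis
          inner_commute power2_eq_square algebra_simps)
    then show ?thesis by (simp add: power2_eq_square algebra_simps)
  qed
  moreover have "1 + (A + 4 * u * v) / (2 * h * l) = 1 + A / (2 * h * l) + 2 * u * v / (h * l)"
    if "h > 0" "l > 0" for A u v h l :: real
    using that by (simp add: field_simps)
  ultimately show ?thesis using assms(2,3) unfolding hyp_cosh_def height_refl_coord[OF assms(1)]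
    by (simp only: hyp_space_def mem_Collect_eq)
qed

lemma lborel_refl_coord: "distr lborel borel (refl_coord k c) = lborel"
proof -
  define e :: "(real, 'a) vec" where "e = axis k 1"
  have e: "e \<in> Basis" unfolding e_def Basis_vec_def by auto
  define s where "s = (\<lambda>j. if j = e then -1 else 1 :: real)"
  have "refl_coord k c = (\<lambda>x. (2 * c) *\<^sub>R e + (\<Sum>j\<in>Basis. (s j * (x \<bullet> j)) *\<^sub>R j))"
  proof
    fix x :: "(real, 'a) vec"
    have "(\<Sum>j\<in>Basis. (s j * (x \<bullet> j)) *\<^sub>R j) = (\<Sum>j\<in>Basis. (x \<bullet> j) *\<^sub>R j - (if j = e then (2 * (x \<bullet> e)) *\<^sub>R e else 0))"
      by (rule sum.cong) (auto simp: s_def scaleR_left_diff_distrib[symmetric])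
    also have "\<dots> = x - (2 * (x \<bullet> e)) *\<^sub>R e" using e by (simp add: sum_subtractf euclidean_representation)
    finally show "refl_coord k c x = (2 * c) *\<^sub>R e + (\<Sum>j\<in>Basis. (s j * (x \<bullet> j)) *\<^sub>R j)"
      by (simp add: refl_coord_def e_def inner_axis algebra_simps)
  qed
  moreover have "lborel = density (distr lborel borel (\<lambda>x. (2 * c) *\<^sub>R e + (\<Sum>j\<in>Basis. (s j * (x \<bullet> j)) *\<^sub>R j))) (\<lambda>_. ennreal (\<Prod>j\<in>Basis. \<bar>s j\<bar>))"
    by (rule lborel_affine_euclidean) (simp add: s_def)
  moreover have "(\<Prod>j\<in>Basis. \<bar>s j\<bar>) = 1" by (rule prod.neutral) (simp add: s_def)
  ultimately show ?thesis by (simp add: density_1)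
qed

lemma refl_coord_measurable_hyp:
  "k \<noteq> Max UNIV \<Longrightarrow> refl_coord k c \<in> measurable hyp_volume hyp_volume"
  by (subst measurable_cong_sets[OF sets_hyp_volume sets_hyp_volume])
    (auto intro!: measurable_restrict_space3 simp: refl_coord_hyp_space)

lemma hyp_volume_refl_coord:
  fixes k :: "'n::{finite,linorder}"
  assumes k: "k \<noteq> Max UNIV"
  shows "distr hyp_volume hyp_volume (refl_coord k c) = hyp_volume"
proof (rule measure_eqI)
  note m = refl_coord_measurable_hyp[OF k, of c]
  fix A assume "A \<in> sets (distr hyp_volume hyp_volume (refl_coord k c))"
  then have A: "A \<in> sets hyp_volume" by simp
  then have Ab[measurable]: "A \<in> sets borel" and sub: "A \<subseteq> hyp_space"
    by (auto simp: sets_hyp_volume sets_restrict_space)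
  let ?f = "\<lambda>x. hyp_density x * indicator A x"
  have "refl_coord k c -` A \<inter> space borel \<in> sets borel" by (rule measurable_sets[OF refl_coord_measurable Ab])
  then have vb: "refl_coord k c -` A \<in> sets borel" by simp
  have vs: "refl_coord k c -` A \<subseteq> hyp_space" using sub refl_coord_hyp_space[OF k, of c] by blast
  have "emeasure (distr hyp_volume hyp_volume (refl_coord k c)) A = emeasure hyp_volume (refl_coord k c -` A)"
    using m A vs by (subst emeasure_distr) (auto intro!: arg_cong[where f = "emeasure hyp_volume"])
  also have "\<dots> = (\<integral>\<^sup>+ x. hyp_density x * indicator (refl_coord k c -` A) x \<partial>lborel)"
    by (rule emeasure_hyp_volume[OF vb vs])
  also have "\<dots> = (\<integral>\<^sup>+ x. ?f (refl_coord k c x) \<partial>lborel)"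
    by (rule nn_integral_cong) (simp add: hyp_density_def height_refl_coord[OF k] indicator_def)
  also have "\<dots> = (\<integral>\<^sup>+ x. ?f x \<partial>distr lborel borel (refl_coord k c))"
    by (subst nn_integral_distr) auto
  also have "\<dots> = emeasure hyp_volume A"
    unfolding lborel_refl_coord by (rule emeasure_hyp_volume[OF Ab sub, symmetric])
  finally show "emeasure (distr hyp_volume hyp_volume (refl_coord k c)) A = emeasure hyp_volume A" .
qed simp

definition semicircle :: "'n::{finite,linorder} point \<Rightarrow> 'n \<Rightarrow> real \<Rightarrow> 'n point" where
  "semicircle p k t = p + (height p * tanh t) *\<^sub>R axis k 1 + (height p * (1 / cosh t - 1)) *\<^sub>R axis (Max UNIV) 1"

lemma semicircle_simps:
  assumes k: "k \<noteq> Max UNIV"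
  shows "semicircle p k 0 = p" "height (semicircle p k t) = height p / cosh t"
    "semicircle p k t $ k = p $ k + height p * tanh t"
  using k by (simp_all add: semicircle_def height_def axis_def algebra_simps)

lemma hyp_cosh_semicircle:
  assumes k: "k \<noteq> Max UNIV" and p: "p \<in> hyp_space"
  shows "hyp_cosh (semicircle p k s) (semicircle p k t) = cosh (s - t)"
proof -
  define h cs ct ss st where "h = height p" and "cs = cosh s" and "ct = cosh t" and "ss = sinh s" and "st = sinh t"
  have h: "h > 0" using p by (simp add: h_def hyp_space_def)
  have c: "cs > 0" "ct > 0" by (simp_all add: cs_def ct_def)
  have pyth: "ss\<^sup>2 = cs\<^sup>2 - 1" "st\<^sup>2 = ct\<^sup>2 - 1"
    using sinh_square_eq[of s] sinh_square_eq[of t] by (simp_all add: ss_def cs_def st_def ct_def)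
  have t: "tanh s = ss / cs" "tanh t = st / ct" by (simp_all add: tanh_def ss_def cs_def st_def ct_def)
  have "semicircle p k s - semicircle p k t =
     (h * (tanh s - tanh t)) *\<^sub>R axis k 1 + (h * (1 / cs - 1 / ct)) *\<^sub>R axis (Max UNIV) 1"
    by (simp add: semicircle_def h_def cs_def ct_def algebra_simps)
  then have "(norm (semicircle p k s - semicircle p k t))\<^sup>2 = (h * (tanh s - tanh t))\<^sup>2 + (h * (1 / cs - 1 / ct))\<^sup>2"
    unfolding power2_norm_eq_inner using k
    by (simp add: inner_add_left inner_add_right inner_axis_axis power2_eq_square)
  also have "\<dots> = h\<^sup>2 * (ss\<^sup>2 / cs\<^sup>2 + 1 / cs\<^sup>2 + st\<^sup>2 / ct\<^sup>2 + 1 / ct\<^sup>2 - 2 * (ss * st + 1) / (cs * ct))"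
    using c unfolding t by (simp add: field_simps power2_eq_square)
  also have "ss\<^sup>2 / cs\<^sup>2 + 1 / cs\<^sup>2 = 1" using c unfolding pyth by (simp add: field_simps)
  also have "1 + st\<^sup>2 / ct\<^sup>2 + 1 / ct\<^sup>2 = 2" using c unfolding pyth by (simp add: field_simps)
  finally have n: "(norm (semicircle p k s - semicircle p k t))\<^sup>2 = h\<^sup>2 * (2 - 2 * (ss * st + 1) / (cs * ct))" .
  have "hyp_cosh (semicircle p k s) (semicircle p k t) = cs * ct - ss * st"
    unfolding hyp_cosh_def n semicircle_simps[OF k] using h c
    by (simp add: h_def[symmetric] cs_def[symmetric] ct_def[symmetric] field_simps power2_eq_square)
  then show ?thesis by (simp add: cosh_diff cs_def ct_def ss_def st_def)
qed

lemma semicircle_hyp_space: "k \<noteq> Max UNIV \<Longrightarrow> p \<in> hyp_space \<Longrightarrow> semicircle p k t \<in> hyp_space"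
  by (simp add: hyp_space_def semicircle_simps)

lemma kern_nth:
  assumes "x \<in> hyp_space" "y \<in> hyp_space" "k \<noteq> Max UNIV"
  shows "kern \<phi> x y $ k = \<phi> (hyp_dist x y) * (y $ k - x $ k) / (sinhc (hyp_dist x y) 1 * height y)"
  using assms by (simp add: kern_def influence_eq geod_log_def hyp_dist_eq hyp_space_def)

section \<open>Strict positivity\<close>

lemma integrable_vec_nth:
  fixes f :: "'a \<Rightarrow> (real, 'n::finite) vec"
  assumes "integrable M f" shows "integrable M (\<lambda>x. f x $ k)"
  using integrable_inner_left[OF assms, of "axis k 1"] by (simp add: inner_axis)

lemma integral_vec_nth:
  fixes f :: "'a \<Rightarrow> (real, 'n::finite) vec"
  assumes "integrable M f" shows "(\<integral>x. f x $ k \<partial>M) = (\<integral>x. f x \<partial>M) $ k"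
  using integral_inner_left[OF assms, of "axis k 1"] by (simp add: inner_axis)

context hyp_ball_model
begin

lemma emeasure_U_open:
  assumes "open A" "A \<subseteq> hyp_ball p R" "A \<noteq> {}"
  shows "emeasure U A \<noteq> 0"
proof -
  have sub: "A \<subseteq> hyp_space" using assms(2) by (auto simp: hyp_ball_def)
  have "emeasure U A = emeasure hyp_volume (hyp_ball p R \<inter> A) / emeasure hyp_volume (hyp_ball p R)"
    unfolding U_def using ball_sets in_sets_hyp_volume[OF borel_open[OF assms(1)] sub]
    by (rule emeasure_uniform_measure)
  moreover have "hyp_ball p R \<inter> A = A" using assms(2) by blast
  ultimately show ?thesis using emeasure_hyp_volume_open[OF assms(1) sub assms(3)] vol_ball
    by (simp add: ennreal_divide_eq_0_iff)
qed

lemma integral_U: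
  fixes f :: "'n point \<Rightarrow> real"
  assumes [measurable]: "f \<in> borel_measurable hyp_volume"
  shows "(\<integral>y. f y \<partial>U) = (\<integral>y. indicator (hyp_ball p R) y * f y \<partial>hyp_volume) / measure hyp_volume (hyp_ball p R)"
    and "integrable U f \<longleftrightarrow> integrable hyp_volume (\<lambda>y. indicator (hyp_ball p R) y * f y)"
proof -
  let ?B = "hyp_ball p R" let ?v = "measure hyp_volume ?B"
  have [measurable]: "?B \<in> sets hyp_volume" by (rule ball_sets)
  have v: "emeasure hyp_volume ?B = ennreal ?v" using vol_ball(2) by (simp add: emeasure_eq_ennreal_measure)
  then have v0: "?v > 0" using vol_ball(1) by (simp add: zero_less_measure_iff)
  have U: "U = density hyp_volume (\<lambda>y. ennreal (indicator ?B y / ?v))"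
    unfolding U_def uniform_measure_def v using v0
    by (intro arg_cong[where f = "density hyp_volume"] ext) (auto simp: indicator_def divide_ennreal[symmetric])
  show "(\<integral>y. f y \<partial>U) = (\<integral>y. indicator ?B y * f y \<partial>hyp_volume) / ?v"
    unfolding U by (subst integral_density) auto
  have "integrable U f \<longleftrightarrow> integrable hyp_volume (\<lambda>y. (1 / ?v) * (indicator ?B y * f y))"
    unfolding U by (subst integrable_density) auto
  also have "\<dots> \<longleftrightarrow> integrable hyp_volume (\<lambda>y. indicator ?B y * f y)" using v0 by (subst integrable_mult_left_iff) auto
  finally show "integrable U f \<longleftrightarrow> integrable hyp_volume (\<lambda>y. indicator ?B y * f y)" .
qed

text \<open>The point \<open>x0\<close> lies at distance \<open>s\<close> from \<open>p\<close>, just close enough to the boundary that only the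
  outermost shell of the support of \<open>\<phi>\<close> leaves the ball. Reflecting in the vertical hyperplane
  through \<open>x0\<close> cancels everything except that shell, on which \<open>\<phi>\<close> has a constant sign.\<close>

lemma mean_kern_nonzero:
  assumes adm: "\<phi> \<in> admissible_functions R" and nz: "\<phi> \<noteq> (\<lambda>_. 0)" and k: "k \<noteq> Max UNIV"
  obtains x0 where "x0 \<in> hyp_ball p R" "(\<integral>y. kern \<phi> x0 y $ k \<partial>U) \<noteq> 0"
proof -
  have nice: "nice_function R \<phi>" by (rule admissible_nice[OF adm])
  obtain a b \<sigma> where ba: "0 \<le> b" "b < a" "a < R" and z: "\<And>r. r \<ge> a \<Longrightarrow> \<phi> r = 0"
    and \<sigma>: "\<bar>\<sigma>\<bar> = 1" and sign: "\<And>r. b \<le> r \<Longrightarrow> r < a \<Longrightarrow> \<sigma> * \<phi> r > 0"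
    using admissible_constant_sign[OF adm nz R] by metis
  have sign': "\<sigma> * \<phi> r \<ge> 0" if "b \<le> r" for r using sign[of r] z[of r] that by (cases "r < a") auto
  define s where "s = R - (a + b) / 2"
  have s: "0 < s" "R - a < s" "s < R - b" "s < R" using ba by (auto simp: s_def)
  define x0 where "x0 = semicircle p k s"
  define c where "c = x0 $ k"
  define rf where "rf = refl_coord k c"
  have x0: "x0 \<in> hyp_space" unfolding x0_def by (rule semicircle_hyp_space[OF k p])
  have hp: "height p > 0" using p by (simp add: hyp_space_def)
  have p0: "p = semicircle p k 0" by (simp add: semicircle_simps[OF k])
  have cosh_p: "hyp_cosh p (semicircle p k t) = cosh t" for t
    using hyp_cosh_semicircle[OF k p, of 0 t] by (simp add: semicircle_simps[OF k])
  have dpx0: "hyp_dist p x0 = s"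
    using s by (simp add: hyp_dist_eq p x0 x0_def[symmetric]) (simp add: x0_def cosh_p arcosh_cosh_real)
  have x0B: "x0 \<in> hyp_ball p R" using x0 s dpx0 by (simp add: hyp_ball_def)
  have cp: "c - p $ k = height p * tanh s" unfolding c_def x0_def by (simp add: semicircle_simps[OF k])
  have cp0: "c > p $ k" using cp hp s by (smt (verit) mult_pos_pos tanh_real_pos_iff)
  have rfs: "rf y \<in> hyp_space" if "y \<in> hyp_space" for y using that by (simp add: rf_def refl_coord_hyp_space[OF k])
  have rfk: "rf y $ k = 2 * c - y $ k" for y by (simp add: rf_def refl_coord_nth)
  have rfrf: "rf (rf y) = y" for y by (simp add: rf_def refl_coord_refl_coord)
  have cosh_x0: "hyp_cosh x0 (rf y) = hyp_cosh x0 y" if "y \<in> hyp_space" for y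
    unfolding rf_def using hyp_cosh_refl_coord[OF k x0 that, of c] by (simp add: c_def)
  have dist_x0: "hyp_dist x0 (rf y) = hyp_dist x0 y" if "y \<in> hyp_space" for y
    using that by (simp add: hyp_dist_eq x0 rfs cosh_x0)
  have cosh_less: "hyp_cosh p y < hyp_cosh p (rf y)" if "y \<in> hyp_space" "y $ k < c" for y
  proof -
    have "2 * (c - p $ k) * (c - y $ k) / (height p * height y) > 0"
      using that hp cp0 by (auto simp: hyp_space_def)
    then show ?thesis unfolding rf_def using hyp_cosh_refl_coord[OF k p that(1), of c] by linarith
  qed
  let ?B = "hyp_ball p R"
  have B: "y \<in> ?B \<longleftrightarrow> y \<in> hyp_space \<and> hyp_cosh p y < cosh R" for y by (simp add: hyp_ball_eq[OF p R])
  have mono: "y \<in> ?B" if "y \<in> hyp_space" "y $ k < c" "rf y \<in> ?B" for y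
    using cosh_less[OF that(1,2)] that by (simp add: B)
  have far: "hyp_dist x0 y > b" if y: "y \<in> hyp_space" "y \<notin> ?B" for y
    using hyp_dist_triangle[OF p x0 y(1)] y s dpx0 by (auto simp: hyp_ball_def)
  define f where "f = (\<lambda>y. kern \<phi> x0 y $ k)"
  have f_eq: "f y = \<phi> (hyp_dist x0 y) * (y $ k - c) / (sinhc (hyp_dist x0 y) 1 * height y)" if "y \<in> hyp_space" for y
    unfolding f_def c_def by (rule kern_nth[OF x0 that k])
  have f_rf: "f (rf y) = - f y" if "y \<in> hyp_space" for y
    using that by (simp add: f_eq rfs dist_x0 rfk) (simp add: rf_def height_refl_coord[OF k] minus_divide_left algebra_simps)
  have den: "sinhc (hyp_dist x0 y) 1 * height y > 0" if "y \<in> hyp_space" for y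
    using that hyp_dist_nonneg[OF x0 that] by (auto simp: hyp_space_def intro!: mult_pos_pos sinhc_pos)
  have f_sign: "\<sigma> * f y = (\<sigma> * \<phi> (hyp_dist x0 y)) * (y $ k - c) / (sinhc (hyp_dist x0 y) 1 * height y)" if "y \<in> hyp_space" for y
    using that by (simp add: f_eq)
  have f_neg: "\<sigma> * f y \<le> 0" if "y \<in> hyp_space" "hyp_dist x0 y > b" "y $ k \<le> c" for y
    unfolding f_sign[OF that(1)] using den[OF that(1)] sign'[of "hyp_dist x0 y"] that
    by (intro divide_nonpos_pos mult_nonneg_nonpos) auto
  define q where "q = (\<lambda>y. (indicator ?B y - indicator ?B (rf y)) * f y)"
  have q_near: "\<sigma> * q y \<le> 0" if yh: "y \<in> hyp_space" and yc: "y $ k \<le> c" for y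
  proof (cases "y $ k = c")
    case True
    then show ?thesis using yh by (simp add: q_def f_eq)
  next
    case False
    then have lt: "y $ k < c" using yc by simp
    consider "y \<in> ?B" "rf y \<notin> ?B" | "(y \<in> ?B) = (rf y \<in> ?B)" using mono[OF yh lt] by blast
    then show ?thesis
    proof cases
      case 1
      then have "hyp_dist x0 y > b" using far[OF rfs[OF yh]] dist_x0[OF yh] by simp
      then show ?thesis using f_neg[OF yh _ yc] 1 by (simp add: q_def)
    qed (simp add: q_def indicator_def)
  qed
  have q_rf: "q (rf y) = q y" if "y \<in> hyp_space" for y
    unfolding q_def rfrf f_rf[OF that] by (simp add: algebra_simps)
  have q_le: "\<sigma> * q y \<le> 0" if "y \<in> hyp_space" for y
  proof (cases "y $ k \<le> c")
    case False
    then show ?thesis using q_near[OF rfs[OF that]] q_rf[OF that] by (simp add: rfk)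
  qed (use q_near that in auto)
  define E where "E = {y \<in> hyp_space. y $ k < c \<and> hyp_cosh p y < cosh R \<and> hyp_cosh p (rf y) > cosh R
      \<and> hyp_cosh x0 y > cosh b \<and> hyp_cosh x0 y < cosh a}"
  have q_less: "\<sigma> * q y < 0" if "y \<in> E" for y
  proof -
    have y: "y \<in> hyp_space" "y $ k < c" "y \<in> ?B" "rf y \<notin> ?B" "hyp_cosh x0 y > cosh b" "hyp_cosh x0 y < cosh a"
      using that by (auto simp: E_def B)
    have d: "hyp_dist x0 y > b" using far[OF rfs[OF y(1)] y(4)] dist_x0[OF y(1)] by simp
    moreover have "hyp_dist x0 y < a" using hyp_dist_less_iff[OF x0 y(1), of a] ba y by simp
    ultimately have "\<sigma> * \<phi> (hyp_dist x0 y) > 0" by (intro sign) auto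
    then have "\<sigma> * f y < 0"
      unfolding f_sign[OF y(1)] using den[OF y(1)] y by (intro divide_neg_pos mult_pos_neg) auto
    then show ?thesis using y by (simp add: q_def)
  qed
  have E_open: "open E"
  proof -
    have 1: "open {y. y $ k < c}" by (intro open_Collect_less continuous_intros)
    have 2: "open {y \<in> hyp_space. hyp_cosh p y < cosh R}" "open {y \<in> hyp_space. hyp_cosh x0 y > cosh b}"
      "open {y \<in> hyp_space. hyp_cosh x0 y < cosh a}"
      using open_hyp_space p x0 by (auto intro!: open_hyp_cosh_less continuous_intros)
    have 3: "open {y \<in> hyp_space. hyp_cosh p (rf y) > cosh R}"
      using open_hyp_space p rfs unfolding rf_def by (intro open_hyp_cosh_less continuous_on_refl_coord) auto
    have "E = {y. y $ k < c} \<inter> {y \<in> hyp_space. hyp_cosh p y < cosh R} \<inter> {y \<in> hyp_space. hyp_cosh p (rf y) > cosh R}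
       \<inter> {y \<in> hyp_space. hyp_cosh x0 y > cosh b} \<inter> {y \<in> hyp_space. hyp_cosh x0 y < cosh a}"
      unfolding E_def by auto
    then show ?thesis using 1 2 3 by (simp only: open_Int)
  qed
  have E_ne: "E \<noteq> {}"
  proof -
    define V where "V = (\<lambda>u. cosh u * (1 - 2 * tanh s * (tanh u - tanh s)))"
    have V: "hyp_cosh p (rf (semicircle p k u)) = V u" for u
    proof -
      have "hyp_cosh p (rf (semicircle p k u)) = cosh u + 2 * (height p * tanh s) * (height p * (tanh s - tanh u)) / (height p * (height p / cosh u))"
        unfolding rf_def hyp_cosh_refl_coord[OF k p semicircle_hyp_space[OF k p]] cosh_p cp
        by (simp add: semicircle_simps[OF k] c_def x0_def algebra_simps)
      also have "\<dots> = V u" using hp cosh_real_pos[of u] by (simp add: V_def field_simps)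
      finally show ?thesis .
    qed
    have "isCont V R" unfolding V_def by (intro continuous_intros) (simp add: cosh_real_pos less_imp_neq[symmetric])
    moreover have "V R < cosh R"
    proof -
      have "tanh s > 0" "tanh R > tanh s" using s by (simp_all add: tanh_real_less_iff)
      then have "1 - 2 * tanh s * (tanh R - tanh s) < 1" by simp
      then show ?thesis unfolding V_def using cosh_real_pos[of R] by (metis mult.right_neutral mult_less_cancel_left_pos)
    qed
    ultimately have "eventually (\<lambda>u. V u < cosh R) (at R)"
      unfolding isCont_def by (rule order_tendstoD(2))
    then have "eventually (\<lambda>u. V u < cosh R) (at_right R)" by (rule filter_leD[OF at_le, rotated]) simp
    moreover have "eventually (\<lambda>u. u \<in> {R<..<s + a}) (at_right R)"
      using s by (intro eventually_at_right_real) simp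
    ultimately have "eventually (\<lambda>u. V u < cosh R \<and> u \<in> {R<..<s + a}) (at_right R)" by (rule eventually_conj)
    then obtain u where u: "V u < cosh R" "R < u" "u < s + a"
      using eventually_happens'[OF trivial_limit_at_right_real] by auto
    define y where "y = rf (semicircle p k u)"
    have g: "semicircle p k u \<in> hyp_space" by (rule semicircle_hyp_space[OF k p])
    have "y \<in> hyp_space" unfolding y_def by (rule rfs[OF g])
    moreover have "y $ k < c"
    proof -
      have "tanh s < tanh u" using u s by (simp add: tanh_real_less_iff)
      then have "c < semicircle p k u $ k" unfolding c_def x0_def semicircle_simps[OF k] using hp by simp
      then show ?thesis by (simp add: y_def rfk)
    qed
    moreover have "hyp_cosh p y < cosh R" using u V by (simp add: y_def)
    moreover have "hyp_cosh p (rf y) > cosh R"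
      unfolding y_def rfrf cosh_p using u R by (simp add: cosh_real_nonneg_less_iff)
    moreover have "hyp_cosh x0 y = cosh (u - s)"
      unfolding y_def cosh_x0[OF g] unfolding x0_def hyp_cosh_semicircle[OF k p] using cosh_minus[of "s - u"] by simp
    moreover have "cosh (u - s) > cosh b" "cosh (u - s) < cosh a"
      using u s ba by (simp_all add: cosh_real_nonneg_less_iff)
    ultimately have "y \<in> E" by (simp add: E_def)
    then show ?thesis by blast
  qed
  have bk: "bounded_kernel U (kern \<phi> :: 'n point \<Rightarrow> _)" by (rule bounded_kernel_kern[OF nice])
  have fint: "integrable U f"
    unfolding f_def using U.bounded_kernel_section[OF bk, of x0] x0 by (intro integrable_vec_nth) simp
  then have fmeas[measurable]: "f \<in> borel_measurable hyp_volume"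
    using borel_measurable_integrable[OF fint] by (simp add: measurable_cong_sets[OF sets_U refl] measurable_cong_sets[OF sets_hyp_volume refl])
  have int1: "integrable hyp_volume (\<lambda>y. indicator ?B y * f y)" using fint integral_U(2)[OF fmeas] by simp
  have dist: "distr hyp_volume hyp_volume rf = hyp_volume" unfolding rf_def by (rule hyp_volume_refl_coord[OF k])
  have mrf: "rf \<in> measurable hyp_volume hyp_volume" unfolding rf_def by (rule refl_coord_measurable_hyp[OF k])
  let ?J = "\<integral>y. indicator ?B y * f y \<partial>hyp_volume"
  have int2: "integrable hyp_volume (\<lambda>y. indicator ?B (rf y) * f (rf y))"
    using integrable_distr[OF mrf, of "\<lambda>y. indicator ?B y * f y"] int1 dist by simp
  have J2: "(\<integral>y. indicator ?B (rf y) * f (rf y) \<partial>hyp_volume) = ?J"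
    using integral_distr[OF mrf borel_measurable_integrable[OF int1]] dist by simp
  have qeq: "indicator ?B y * f y + indicator ?B (rf y) * f (rf y) = q y" if "y \<in> space hyp_volume" for y
    using that by (simp add: q_def f_rf algebra_simps)
  have intq: "integrable hyp_volume q"
    using Bochner_Integration.integrable_add[OF int1 int2] by (subst (asm) Bochner_Integration.integrable_cong[OF refl qeq])
  have Jq: "(\<integral>y. q y \<partial>hyp_volume) = 2 * ?J"
  proof -
    have "(\<integral>y. q y \<partial>hyp_volume) = (\<integral>y. indicator ?B y * f y + indicator ?B (rf y) * f (rf y) \<partial>hyp_volume)"
      by (rule Bochner_Integration.integral_cong[OF refl]) (simp only: qeq)
    also have "\<dots> = 2 * ?J" using int1 int2 J2 by simp
    finally show ?thesis .
  qed
  have "?J \<noteq> 0"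
  proof
    assume J0: "?J = 0"
    have "(\<integral>y. - (\<sigma> * q y) \<partial>hyp_volume) = 0" using Jq J0 by simp
    then have "AE y in hyp_volume. - (\<sigma> * q y) = 0"
      using intq q_le by (subst (asm) integral_nonneg_eq_0_iff_AE) (auto intro!: AE_I2)
    then have "AE y in hyp_volume. y \<notin> E" by eventually_elim (use q_less in force)
    moreover have "E \<in> sets hyp_volume" using E_open by (intro in_sets_hyp_volume) (auto simp: E_def)
    ultimately have "E \<in> null_sets hyp_volume" by (subst AE_iff_null_sets) auto
    then have "emeasure hyp_volume E = 0" by auto
    then show False using emeasure_hyp_volume_open[OF E_open _ E_ne] by (auto simp: E_def)
  qed
  then have "(\<integral>y. f y \<partial>U) \<noteq> 0"
    using integral_U(1)[OF fmeas] vol_ball by (simp add: measure_def enn2real_eq_0_iff)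
  then show ?thesis using that[OF x0B] by (simp add: f_def)
qed

lemma mean_sq_pos:
  assumes adm: "\<phi> \<in> admissible_functions R" and nz: "\<phi> \<noteq> (\<lambda>_. 0)" and k: "(k :: 'n) \<noteq> Max UNIV"
  shows "mean_sq U (kern \<phi> :: 'n point \<Rightarrow> _) > 0"
proof (rule ccontr)
  assume neg: "\<not> ?thesis"
  obtain x0 where x0B: "x0 \<in> hyp_ball p R" and x0: "(\<integral>y. kern \<phi> x0 y $ k \<partial>U) \<noteq> 0"
    by (rule mean_kern_nonzero[OF adm nz k])
  have x0h: "x0 \<in> hyp_space" using x0B by (simp add: hyp_ball_def)
  have nice: "nice_function R \<phi>" by (rule admissible_nice[OF adm])
  have bk: "bounded_kernel U (kern \<phi> :: 'n point \<Rightarrow> _)" by (rule bounded_kernel_kern[OF nice])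
  obtain K where K: "\<And>x y. x \<in> space U \<Longrightarrow> y \<in> space U \<Longrightarrow> norm (kern \<phi> x y) \<le> K"
    using bk unfolding bounded_kernel_def by blast
  obtain M where M: "\<And>r. \<bar>\<phi> r\<bar> \<le> M" using nice by (auto simp: nice_function_def)
  note [measurable] = U.bounded_kernel_mean_measurable[OF bk]
  have bd: "norm (\<integral>y. kern \<phi> x y \<partial>U) \<le> K" if "x \<in> space U" for x
    using K that by (intro U.norm_integral_le_bound) auto
  have int: "integrable U (\<lambda>x. (norm (\<integral>y. kern \<phi> x y \<partial>U))\<^sup>2)"
    by (rule U.integrable_bounded[of _ "K\<^sup>2"]) (use bd in \<open>auto intro!: power_mono\<close>)
  have "mean_sq U (kern \<phi> :: 'n point \<Rightarrow> _) = 0" using neg mean_sq_nonneg[of U "kern \<phi>"] by linarith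
  then have ae: "AE x in U. (\<integral>y. kern \<phi> x y \<partial>U) = 0"
    unfolding mean_sq_def using int by (subst (asm) integral_nonneg_eq_0_iff_AE) auto
  have "\<exists>x. x \<in> ball x0 (1 / real (Suc n)) \<inter> hyp_ball p R \<and> (\<integral>y. kern \<phi> x y \<partial>U) = 0" for n
  proof (rule ccontr)
    let ?V = "ball x0 (1 / real (Suc n)) \<inter> hyp_ball p R"
    assume no: "\<nexists>x. x \<in> ?V \<and> (\<integral>y. kern \<phi> x y \<partial>U) = 0"
    have o: "open ?V" by (intro open_Int open_ball open_hyp_ball p R)
    have "?V \<in> sets U"
      using in_sets_hyp_volume[OF borel_open[OF o]] by (auto simp: U_def hyp_ball_def)
    moreover have "AE x in U. x \<notin> ?V" using ae by eventually_elim (use no in blast)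
    ultimately have "?V \<in> null_sets U" by (subst AE_iff_null_sets) auto
    then have "emeasure U ?V = 0" by auto
    moreover have "x0 \<in> ?V" using x0B by simp
    ultimately show False using emeasure_U_open[OF o] by blast
  qed
  then obtain X where XV: "\<And>n. X n \<in> ball x0 (1 / real (Suc n)) \<inter> hyp_ball p R"
    and X0: "\<And>n. (\<integral>y. kern \<phi> (X n) y \<partial>U) = 0" by metis
  have Xh: "X n \<in> hyp_space" for n using XV[of n] by (simp add: hyp_ball_def)
  have lim: "X \<longlonglongrightarrow> x0"
  proof (rule metric_LIMSEQ_I)
    fix e :: real assume "e > 0"
    then obtain n0 where n0: "inverse (real (Suc n0)) < e" using reals_Archimedean by blast
    show "\<exists>n0. \<forall>n\<ge>n0. dist (X n) x0 < e"
    proof (intro exI allI impI)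
      fix n assume "n \<ge> n0"
      then have "1 / real (Suc n) \<le> inverse (real (Suc n0))" by (simp add: field_simps)
      then show "dist (X n) x0 < e" using XV[of n] n0 by (simp add: dist_commute)
    qed
  qed
  have hlim: "(\<lambda>n. height (X n)) \<longlonglongrightarrow> height x0" unfolding height_def by (intro tendsto_intros lim)
  have clim: "(\<lambda>n. hyp_cosh (X n) y) \<longlonglongrightarrow> hyp_cosh x0 y" if y: "y \<in> hyp_space" for y
    unfolding hyp_cosh_def using x0h y by (intro tendsto_intros lim hlim) (auto simp: hyp_space_def)
  have dlim: "(\<lambda>n. hyp_dist (X n) y) \<longlonglongrightarrow> hyp_dist x0 y" if y: "y \<in> hyp_space" for y
  proof -
    have "(\<lambda>n. arcosh (hyp_cosh (X n) y)) \<longlonglongrightarrow> arcosh (hyp_cosh x0 y)"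
      by (rule continuous_on_tendsto_compose[OF continuous_on_arcosh[OF order_refl] clim[OF y]])
        (auto intro!: always_eventually hyp_cosh_ge_1 Xh x0h y)
    then show ?thesis by (simp add: hyp_dist_eq Xh x0h y)
  qed
  have "(\<lambda>n. \<integral>y. kern \<phi> (X n) y $ k \<partial>U) \<longlonglongrightarrow> (\<integral>y. kern \<phi> x0 y $ k \<partial>U)"
  proof (rule integral_dominated_convergence[where w = "\<lambda>_. K"])
    show "(\<lambda>y. kern \<phi> x0 y $ k) \<in> borel_measurable U" "\<And>n. (\<lambda>y. kern \<phi> (X n) y $ k) \<in> borel_measurable U"
      using U.bounded_kernel_section[OF bk] x0h Xh by (auto intro!: borel_measurable_integrable integrable_vec_nth)
    show "AE y in U. norm (kern \<phi> (X n) y $ k) \<le> K" for n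
      using K Xh by (intro AE_I2) (metis component_le_norm_cart order_trans real_norm_def space_U)
    show "AE y in U. (\<lambda>n. kern \<phi> (X n) y $ k) \<longlonglongrightarrow> kern \<phi> x0 y $ k"
    proof (rule AE_I2)
      fix y assume "y \<in> space U"
      then have y: "y \<in> hyp_space" by simp
      show "(\<lambda>n. kern \<phi> (X n) y $ k) \<longlonglongrightarrow> kern \<phi> x0 y $ k"
      proof (cases "y = x0")
        case True
        have "(\<lambda>n. M * hyp_dist (X n) y) \<longlonglongrightarrow> M * hyp_dist x0 y" by (intro tendsto_intros dlim y)
        moreover have "hyp_dist x0 y = 0" using True x0h by (simp add: hyp_dist_eq hyp_cosh_def)
        ultimately have 1: "(\<lambda>n. M * hyp_dist (X n) y) \<longlonglongrightarrow> 0" by simp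
        have "norm (kern \<phi> (X n) y $ k) \<le> M * hyp_dist (X n) y" for n
        proof -
          have "norm (kern \<phi> (X n) y $ k) \<le> norm (kern \<phi> (X n) y)" using component_le_norm_cart by simp
          also have "\<dots> \<le> M * hyp_dist (X n) y"
            unfolding norm_kern[OF Xh y] using M hyp_dist_nonneg[OF Xh y] by (intro mult_right_mono) auto
          finally show ?thesis .
        qed
        then have "(\<lambda>n. kern \<phi> (X n) y $ k) \<longlonglongrightarrow> 0"
          by (intro Lim_null_comparison[OF _ 1] always_eventually) auto
        then show ?thesis using True kern_self[OF x0h] by simp
      next
        case False
        have pos: "hyp_dist x0 y > 0"
        proof -
          have "(norm (x0 - y))\<^sup>2 > 0" using False by simp
          then have "hyp_cosh x0 y > 1" using x0h y by (simp add: hyp_cosh_def hyp_space_def)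
          then show ?thesis by (simp add: hyp_dist_eq x0h y)
        qed
        have sc: "isCont (\<lambda>s. sinhc s 1) (hyp_dist x0 y)"
        proof -
          have "isCont (\<lambda>s. sinh s / s) (hyp_dist x0 y)" using pos by (intro continuous_intros) auto
          moreover have "eventually (\<lambda>s. sinh s / s = sinhc s 1) (nhds (hyp_dist x0 y))"
            using eventually_nhds_in_open[of "{0<..}" "hyp_dist x0 y"] pos by (auto simp: sinhc_def elim!: eventually_mono)
          ultimately show ?thesis using isCont_cong by fastforce
        qed
        have \<phi>lim: "(\<lambda>n. \<phi> (hyp_dist (X n) y)) \<longlonglongrightarrow> \<phi> (hyp_dist x0 y)"
          by (rule continuous_on_tendsto_compose[OF admissible_continuous[OF adm R] dlim[OF y]])
            (auto intro!: always_eventually hyp_dist_nonneg Xh x0h y)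
        have "(\<lambda>n. \<phi> (hyp_dist (X n) y) * (y $ k - X n $ k) / (sinhc (hyp_dist (X n) y) 1 * height y)) \<longlonglongrightarrow>
           \<phi> (hyp_dist x0 y) * (y $ k - x0 $ k) / (sinhc (hyp_dist x0 y) 1 * height y)"
        proof (intro tendsto_intros \<phi>lim lim isCont_tendsto_compose[OF sc] dlim y)
          show "sinhc (hyp_dist x0 y) 1 * height y \<noteq> 0"
            using sinhc_pos[of "hyp_dist x0 y" 1] pos y by (simp add: hyp_space_def)
        qed
        then show ?thesis by (simp add: kern_nth[OF _ y k] Xh x0h)
      qed
    qed
  qed simp
  moreover have "(\<integral>y. kern \<phi> (X n) y $ k \<partial>U) = 0" for n
  proof -
    have "(\<integral>y. kern \<phi> (X n) y $ k \<partial>U) = (\<integral>y. kern \<phi> (X n) y \<partial>U) $ k"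
      using U.bounded_kernel_section[OF bk, of "X n"] Xh
      by (intro integral_vec_nth) simp
    then show ?thesis using X0 by simp
  qed
  ultimately have "(\<lambda>n. 0) \<longlonglongrightarrow> (\<integral>y. kern \<phi> x0 y $ k \<partial>U)" by simp
  then show False using x0 by (simp add: LIMSEQ_const_iff)
qed

end

section \<open>Coercivity\<close>

context hyp_ball_model
begin

lemma compact_subspace_coercive:
  assumes N: "N \<ge> 2" and comp: "compact_subspace_L2 R (rho_measure p R N) H"
    and adm: "H \<subseteq> admissible_functions R" and k: "(k :: 'n) \<noteq> Max UNIV"
  obtains e where "e > 0" "\<And>\<phi>. \<phi> \<in> H \<Longrightarrow> L2_norm R (rho_measure p R N) \<phi> = 1 \<Longrightarrow> triple_expectation p R \<phi> \<ge> e"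
proof -
  let ?K = "kern :: (real \<Rightarrow> real) \<Rightarrow> 'n point \<Rightarrow> _"
  define nrm where "nrm = L2_norm R (rho_measure p R N)"
  define tsq where "tsq = (\<lambda>\<phi>. sqrt (mean_sq U (?K \<phi>)))"
  have nice: "nice_function R \<phi>" if "\<phi> \<in> H" for \<phi> using admissible_nice adm that by blast
  note bk = bounded_kernel_kern[OF nice]
  have nrm: "nrm \<phi> = sqrt (total_sq U (?K \<phi>))" if "\<phi> \<in> H" for \<phi>
    unfolding nrm_def by (rule L2_norm_eq[OF N nice[OF that]])
  have add: "(\<lambda>r. \<phi> r + \<psi> r) \<in> H" if "\<phi> \<in> H" "\<psi> \<in> H" for \<phi> \<psi>
    using comp that unfolding compact_subspace_L2_def by blast
  have scale: "(\<lambda>r. a * \<phi> r) \<in> H" if "\<phi> \<in> H" for a \<phi>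
    using comp that unfolding compact_subspace_L2_def by blast
  have diff: "(\<lambda>r. \<phi> r - \<psi> r) \<in> H" if "\<phi> \<in> H" "\<psi> \<in> H" for \<phi> \<psi>
    using add[OF that(1) scale[OF that(2), of "-1"]] by simp
  have nrm_add: "nrm (\<lambda>r. \<phi> r + \<psi> r) \<le> nrm \<phi> + nrm \<psi>" and tsq_add: "tsq (\<lambda>r. \<phi> r + \<psi> r) \<le> tsq \<phi> + tsq \<psi>"
    if "\<phi> \<in> H" "\<psi> \<in> H" for \<phi> \<psi>
    unfolding nrm[OF add[OF that]] nrm[OF that(1)] nrm[OF that(2)] tsq_def kern_add
    by (intro U.total_sq_triangle U.mean_sq_triangle bk that)+
  have nrm_minus: "nrm (\<lambda>r. \<phi> r - \<psi> r) = nrm (\<lambda>r. \<psi> r - \<phi> r)" for \<phi> \<psi>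
    unfolding nrm_def L2_norm_def by (simp add: power2_commute)
  have tsq_le: "tsq \<phi> \<le> nrm \<phi>" if "\<phi> \<in> H" for \<phi>
    unfolding nrm[OF that] tsq_def by (intro real_sqrt_le_mono U.mean_sq_le_total_sq bk that)
  have tsq_pos: "tsq \<phi> > 0" if "\<phi> \<in> H" "\<phi> \<noteq> (\<lambda>_. 0)" for \<phi>
    unfolding tsq_def using mean_sq_pos[OF _ that(2) k] adm that(1) by auto
  have nrm0: "nrm (\<lambda>_. 0) = 0" by (simp add: nrm_def L2_norm_def)
  have nrm_pos: "nrm \<phi> > 0" if "\<phi> \<in> H" "\<phi> \<noteq> (\<lambda>_. 0)" for \<phi>
    using tsq_pos[OF that] tsq_le[OF that(1)] by linarith
  define d where "d = (\<lambda>\<phi> \<psi>. nrm (\<lambda>r. \<phi> r - \<psi> r))"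
  have shift: "nrm \<phi> \<le> nrm \<psi> + d \<phi> \<psi>" "tsq \<phi> \<le> tsq \<psi> + d \<phi> \<psi>" if "\<phi> \<in> H" "\<psi> \<in> H" for \<phi> \<psi>
    using nrm_add[OF that(2) diff[OF that]] tsq_add[OF that(2) diff[OF that]] tsq_le[OF diff[OF that]]
    unfolding d_def by simp_all
  interpret MS: Metric_space H d
  proof
    show "0 \<le> d \<phi> \<psi>" for \<phi> \<psi> by (simp add: d_def nrm_def L2_norm_def)
    show "d \<phi> \<psi> = d \<psi> \<phi>" for \<phi> \<psi> unfolding d_def by (rule nrm_minus)
    show "d \<phi> \<psi> = 0 \<longleftrightarrow> \<phi> = \<psi>" if "\<phi> \<in> H" "\<psi> \<in> H" for \<phi> \<psi>
    proof
      assume "d \<phi> \<psi> = 0"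
      then have "(\<lambda>r. \<phi> r - \<psi> r) = (\<lambda>_. 0)" using nrm_pos[OF diff[OF that]] by (force simp: d_def)
      then show "\<phi> = \<psi>" by (simp add: fun_eq_iff)
    qed (simp add: d_def nrm0)
    show "d \<phi> \<xi> \<le> d \<phi> \<psi> + d \<psi> \<xi>" if "\<phi> \<in> H" "\<psi> \<in> H" "\<xi> \<in> H" for \<phi> \<psi> \<xi>
      using nrm_add[OF diff[OF that(1,2)] diff[OF that(2,3)]] by (simp add: d_def)
  qed
  have "\<exists>e>0. \<forall>\<phi>\<in>H. nrm \<phi> = 1 \<longrightarrow> tsq \<phi> \<ge> e"
  proof (rule ccontr)
    assume "\<not> ?thesis"
    then have "\<forall>e>0. \<exists>\<phi>\<in>H. nrm \<phi> = 1 \<and> tsq \<phi> < e" by (meson not_le)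
    then have "\<exists>\<phi>. \<phi> \<in> H \<and> nrm \<phi> = 1 \<and> tsq \<phi> < inverse (real (Suc n))" for n
      by (meson inverse_positive_iff_positive of_nat_0_less_iff zero_less_Suc)
    then obtain f where f: "\<And>n. f n \<in> H" "\<And>n. nrm (f n) = 1" "\<And>n. tsq (f n) < inverse (real (Suc n))"
      by metis
    have "compactin MS.mtopology {\<phi> \<in> H. nrm \<phi> \<le> 1}"
      using comp unfolding compact_subspace_L2_def d_def nrm_def by blast
    moreover have "range f \<subseteq> {\<phi> \<in> H. nrm \<phi> \<le> 1}" using f by auto
    ultimately obtain l r where l: "l \<in> {\<phi> \<in> H. nrm \<phi> \<le> 1}" and r: "strict_mono r"
      and lim: "limitin MS.mtopology (f \<circ> r) l sequentially"
      unfolding MS.compactin_sequentially by blast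
    have lH: "l \<in> H" using l by simp
    have dlim: "(\<lambda>n. d (f (r n)) l) \<longlonglongrightarrow> 0"
    proof (rule metric_LIMSEQ_I)
      fix e :: real assume "e > 0"
      then obtain n0 where "\<forall>n\<ge>n0. d (f (r n)) l < e"
        using lim unfolding MS.limit_metric_sequentially comp_def by meson
      then show "\<exists>n0. \<forall>n\<ge>n0. dist (d (f (r n)) l) 0 < e" by (auto simp: MS.nonneg)
    qed
    have "(\<lambda>n. 1 - d (f (r n)) l) \<longlonglongrightarrow> 1 - 0" by (intro tendsto_intros dlim)
    then have "1 - 0 \<le> nrm l"
      by (rule tendsto_upperbound) (use shift(1)[OF f(1) lH] f(2) in \<open>auto intro!: always_eventually simp: diff_le_eq\<close>)
    then have "l \<noteq> (\<lambda>_. 0)" using nrm0 by auto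
    then have "tsq l > 0" using tsq_pos lH by simp
    moreover have "(\<lambda>n. inverse (real (Suc (r n))) + d (f (r n)) l) \<longlonglongrightarrow> 0 + 0"
      by (intro tendsto_intros dlim LIMSEQ_subseq_LIMSEQ[OF LIMSEQ_inverse_real_of_nat r, unfolded comp_def])
    then have "tsq l \<le> 0 + 0"
    proof (rule tendsto_lowerbound)
      have "tsq l \<le> inverse (real (Suc (r n))) + d (f (r n)) l" for n
        using shift(2)[OF lH f(1), of "r n"] f(3)[of "r n"] MS.commute[of l "f (r n)"] by linarith
      then show "eventually (\<lambda>n. tsq l \<le> inverse (real (Suc (r n))) + d (f (r n)) l) sequentially" by simp
    qed simp
    ultimately show False by simp
  qed
  then obtain e where e: "e > 0" "\<And>\<phi>. \<phi> \<in> H \<Longrightarrow> nrm \<phi> = 1 \<Longrightarrow> tsq \<phi> \<ge> e" by blast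
  show ?thesis
  proof (rule that[of "e\<^sup>2"])
    show "e\<^sup>2 > 0" using e by simp
    fix \<phi> assume \<phi>: "\<phi> \<in> H" "L2_norm R (rho_measure p R N) \<phi> = 1"
    have "e\<^sup>2 \<le> (tsq \<phi>)\<^sup>2" using e \<phi> by (intro power_mono) (auto simp: nrm_def)
    then show "triple_expectation p R \<phi> \<ge> e\<^sup>2"
      unfolding triple_expectation_eq[OF nice[OF \<phi>(1)]] tsq_def by (simp add: mean_sq_nonneg)
  qed
qed

lemma field_ratio_eq:
  assumes N: "N \<ge> 2" and adm: "\<phi> \<in> admissible_functions R" and nz: "\<phi> \<noteq> (\<lambda>_. 0)" and k: "(k :: 'n) \<noteq> Max UNIV"
  defines "c \<equiv> L2_norm R (rho_measure p R N) \<phi>"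
  shows "c > 0"
    and "(field_L2_norm N (config_measure p R N) (interaction_field N \<phi>))\<^sup>2 / c\<^sup>2 =
      (real N - 1) / (real N)\<^sup>2 + triple_expectation p R (\<lambda>r. (1 / c) * \<phi> r) * ((real N - 1) * (real N - 2) / (real N)\<^sup>2)"
    and "L2_norm R (rho_measure p R N) (\<lambda>r. (1 / c) * \<phi> r) = 1"
proof -
  let ?K = "kern :: (real \<Rightarrow> real) \<Rightarrow> 'n point \<Rightarrow> _"
  have nice: "nice_function R \<phi>" by (rule admissible_nice[OF adm])
  have nice': "nice_function R (\<lambda>r. (1 / c) * \<phi> r)"
  proof -
    obtain M where "\<And>r. \<bar>\<phi> r\<bar> \<le> M" using nice by (auto simp: nice_function_def)
    then have "\<bar>(1 / c) * \<phi> r\<bar> \<le> \<bar>1 / c\<bar> * M" for r unfolding abs_mult by (intro mult_left_mono) auto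
    then show ?thesis using nice by (auto simp: nice_function_def)
  qed
  have c: "c = sqrt (total_sq U (?K \<phi>))" unfolding c_def by (rule L2_norm_eq[OF N nice])
  have tot: "total_sq U (?K \<phi>) > 0"
    using mean_sq_pos[OF adm nz k] U.mean_sq_le_total_sq[OF bounded_kernel_kern[OF nice]] by linarith
  then show c0: "c > 0" by (simp add: c)
  have c2: "c\<^sup>2 = total_sq U (?K \<phi>)" using tot by (simp add: c)
  have T: "triple_expectation p R (\<lambda>r. (1 / c) * \<phi> r) = mean_sq U (?K \<phi>) / c\<^sup>2"
    unfolding triple_expectation_eq[OF nice'] kern_scale mean_sq_scale by (simp add: power_divide)
  show "(field_L2_norm N (config_measure p R N) (interaction_field N \<phi>))\<^sup>2 / c\<^sup>2 =
      (real N - 1) / (real N)\<^sup>2 + triple_expectation p R (\<lambda>r. (1 / c) * \<phi> r) * ((real N - 1) * (real N - 2) / (real N)\<^sup>2)"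
    unfolding T using N c0 by (subst field_L2_norm_eq[OF nice]) (auto simp: c2[symmetric] add_divide_distrib mult.commute)
  show "L2_norm R (rho_measure p R N) (\<lambda>r. (1 / c) * \<phi> r) = 1"
    unfolding L2_norm_eq[OF N nice'] kern_scale total_sq_scale c2[symmetric] using c0 by (simp add: power_divide)
qed

end

theorem proposition4p4:
  fixes p :: "'n::{finite,linorder} point" and R0 :: real and N :: nat
    and H :: "(real \<Rightarrow> real) set"
  assumes "CARD('n) = 2 \<or> CARD('n) = 3"
    and "R0 > 0" and "p \<in> hyp_space" and "N \<ge> 2"
    and "compact_subspace_L2 R0 (rho_measure p R0 N) H"
    and "H \<subseteq> admissible_functions R0"
  shows "(INF \<phi> \<in> H - {\<lambda>_. 0}.
            ereal ((field_L2_norm N (config_measure p R0 N) (interaction_field N \<phi>))\<^sup>2 /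
                   (L2_norm R0 (rho_measure p R0 N) \<phi>)\<^sup>2))
         \<ge> ereal ((real N - 1) / (real N)\<^sup>2) +
            coercivity_const p R0 N H * ereal ((real N - 1) * (real N - 2) / (real N)\<^sup>2) \<and>
         coercivity_const p R0 N H > 0"
proof
  interpret hyp_ball_model p R0 by standard (use assms in auto)
  have "UNIV \<noteq> {Max UNIV :: 'n}"
  proof
    assume "UNIV = {Max UNIV :: 'n}"
    then have "CARD('n) = 1" by (metis card_1_singleton_iff One_nat_def)
    then show False using assms(1) by simp
  qed
  then obtain k :: 'n where k: "k \<noteq> Max UNIV" by blast
  let ?c = "coercivity_const p R0 N H" and ?n = "(real N - 1) * (real N - 2) / (real N)\<^sup>2"
  show "?c > 0"
  proof -
    obtain e where e: "e > 0" "\<And>\<phi>. \<phi> \<in> H \<Longrightarrow> L2_norm R0 (rho_measure p R0 N) \<phi> = 1 \<Longrightarrow> triple_expectation p R0 \<phi> \<ge> e"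
      using compact_subspace_coercive[OF assms(4-6) k] by metis
    have "ereal e \<le> ?c" unfolding coercivity_const_def by (rule INF_greatest) (use e in auto)
    moreover have "0 < ereal e" using e(1) by simp
    ultimately show ?thesis by (rule less_le_trans[rotated])
  qed
  have n: "?n \<ge> 0" using assms(4) by simp
  show "ereal ((real N - 1) / (real N)\<^sup>2) + ?c * ereal ?n \<le> (INF \<phi> \<in> H - {\<lambda>_. 0}.
            ereal ((field_L2_norm N (config_measure p R0 N) (interaction_field N \<phi>))\<^sup>2 /
                   (L2_norm R0 (rho_measure p R0 N) \<phi>)\<^sup>2))"
  proof (rule INF_greatest)
    fix \<phi> assume \<phi>: "\<phi> \<in> H - {\<lambda>_. 0}"
    then have adm: "\<phi> \<in> admissible_functions R0" and nz: "\<phi> \<noteq> (\<lambda>_. 0)" using assms(6) by auto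
    let ?a = "L2_norm R0 (rho_measure p R0 N) \<phi>"
    note ratio = field_ratio_eq[OF assms(4) adm nz k]
    let ?\<psi> = "\<lambda>r. (1 / ?a) * \<phi> r"
    have "?\<psi> \<in> H" using assms(5) \<phi> unfolding compact_subspace_L2_def by blast
    then have "?c \<le> ereal (triple_expectation p R0 ?\<psi>)"
      unfolding coercivity_const_def using ratio(3) by (intro INF_lower) auto
    then have "?c * ereal ?n \<le> ereal (triple_expectation p R0 ?\<psi>) * ereal ?n"
      using n by (intro ereal_mult_right_mono) auto
    then have "ereal ((real N - 1) / (real N)\<^sup>2) + ?c * ereal ?n
       \<le> ereal ((real N - 1) / (real N)\<^sup>2) + ereal (triple_expectation p R0 ?\<psi>) * ereal ?n"
      by (rule add_left_mono)
    then show "ereal ((real N - 1) / (real N)\<^sup>2) + ?c * ereal ?n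
       \<le> ereal ((field_L2_norm N (config_measure p R0 N) (interaction_field N \<phi>))\<^sup>2 / ?a\<^sup>2)"
      unfolding ratio(2) by simp
  qed
qed

end
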